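(* Let $\mathcal T$ be a physical theory. Then $(\widetilde{\mathcal D}'_{\mathcal T},m,\Phi)$ is a comodule-coalgebra on $(\widetilde{\mathcal D}_{\mathcal T},m,\Delta)$, where $\widetilde{\mathcal D}_{\mathcal T}$ and $\widetilde{\mathcal D}'_{\mathcal T}$ are isomorphic as algebras. Here the coaction is $\Delta:\widetilde{\mathcal D}'_{\mathcal T}\to\widetilde{\mathcal D}_{\mathcal T}\otimes\widetilde{\mathcal D}'_{\mathcal T}$, $\Delta(\bar\Gamma,\bar\gamma)=\sum_{\bar\delta\subseteq\bar\gamma,\ \bar\gamma/\bar\delta\in\mathcal T}(\bar\Gamma,\bar\delta)\otimes(\bar\Gamma/\bar\delta,\bar\gamma/\bar\delta)$.
   Context: **Feynman graphs.** A graph $\Gamma$ is given by a finite set $\mathcal V(\Gamma)$ of vertices, a finite set $\mathcal E(\Gamma)$ of half-edges, a map $\partial:\mathcal E(\Gamma)\to\mathcal V(\Gamma)$ and an involution $\sigma_\Gamma:\mathcal E(\Gamma)\to\mathcal E(\Gamma)$. Half-edges are partitioned into types and $\sigma_\Gamma$ respects types. Fixed points of $\sigma_\Gamma$ are the external edges; pairs $\{e,\sigma_\Gamma(e)\}$ with $e\ne\sigma_\Gamma(e)$ are the internal edges. Graphs are considered up to isomorphism. $\pi_0(\Gamma)$ is the set of connected components. A $1PI$ graph is a connected graph which remains connected when any one internal edge is cut (replaced by two external edges); a graph is locally $1PI$ if all its connected components are $1PI$. The residue $\mathrm{res}\,\Gamma$ is obtained by shrinking each connected component to a point (retaining its external edges).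 A covering subgraph $\gamma$ of $\Gamma$ is a graph obtained from $\Gamma$ by cutting some internal edges (same vertices and half-edges). $\Gamma/\gamma$ is obtained by shrinking each connected component of $\gamma$ inside $\Gamma$ to a point. **Theory.** A theory $\mathcal T$ prescribes a set $\mathcal E(\mathcal T)$ of half-edge types and a set $\mathcal V(\mathcal T)$ of vertex types. The types of the half-edges adjacent to a vertex need not determine its type; vertex types sharing the same collection of half-edge types are distinguished by an integer index. **Specified graphs.** A specified graph of $\mathcal T$ is a couple $\bar\Gamma=(\Gamma,\underline i)$ where $\Gamma$ is a locally $1PI$ superficially divergent graph (the residue of each component is a vertex of $\mathcal T$) with half-edges and vertices of the types prescribed by $\mathcal T$, and $\underline i:\pi_0(\Gamma)\to\mathbb N$ is such that $\underline i(\gamma)$ is one of the indices allowed by the possible types of the vertex obtained by contracting the component $\gamma$. A specified graph $\bar\gamma=(\gamma,\underline j)$ is a specified covering subgraph of $\bar\Gamma=(\Gamma,\underline i)$, written $\bar\gamma\subset\bar\Gamma$, if $\gamma$ is a covering subgraph of $\Gamma$ and $\underline j(\gamma_0)=\underline i(\gamma_0)$ for every component $\gamma_0$ of $\gamma$ that is also a component of $\Gamma$. The contracted graph $\bar\Gamma/\bar\gamma$ is $\Gamma/\gamma$ with the new vertices given the types specified by $\underline j$ (for a component of $\gamma$ reduced to a single vertex, its own type), and with specification $\underline i$. A condition "$\in\mathcal T$" means being a specified graph of the theory. **Spaces.** $\widetilde V_{\mathcal T}$ is the vector space (over a field $k$) generated by the connected ($1PI$) specified graphs, and $\widetilde{\mathcal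 H}_{\mathcal T}=S(\widetilde V_{\mathcal T})$ is spanned by all specified graphs. $\widetilde{\mathcal D}_{\mathcal T}$ is the vector space spanned by the pairs $(\bar\Gamma,\bar\gamma)$ of locally $1PI$ specified graphs with $\bar\gamma\subset\bar\Gamma$ and $\bar\Gamma/\bar\gamma\in\widetilde{\mathcal H}_{\mathcal T}$; it is the free commutative algebra generated by the connected pairs ($\Gamma$ connected), with product $m\big((\bar\Gamma_1,\bar\gamma_1)\otimes(\bar\Gamma_2,\bar\gamma_2)\big)=(\bar\Gamma_1\bar\Gamma_2,\bar\gamma_1\bar\gamma_2)$ (juxtaposition), and it is a bialgebra with coproduct $$\Delta(\bar\Gamma,\bar\gamma)=\sum_{\bar\delta\subseteq\bar\gamma,\ \bar\gamma/\bar\delta\in\mathcal T}(\bar\Gamma,\bar\delta)\otimes(\bar\Gamma/\bar\delta,\bar\gamma/\bar\delta).$$ $\widetilde{\mathcal F}_{\mathcal T}$ is the vector space spanned by pairs $(\bar\Gamma,\bar\gamma)$ with $\bar\Gamma$ a connected $1PI$ specified graph, $\bar\gamma\subset\bar\Gamma$ and $\bar\Gamma/\bar\gamma\in\widetilde V_{\mathcal T}$. $\widetilde{\mathcal D}'_{\mathcal T}=\mathcal S(\widetilde{\mathcal F}_{\mathcal T})$ is the symmetric algebra (product $m$) with its usual unshuffling coproduct $\Phi$ (the algebra morphism for which the elements of $\widetilde{\mathcal F}_{\mathcal T}$ are primitive). **Comodule-coalgebra.** Saying that $(\widetilde{\mathcal D}'_{\mathcal T},m,\Phi)$ is a comodule-coalgebra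 on $(\widetilde{\mathcal D}_{\mathcal T},m,\Delta)$ means that $\Delta:\widetilde{\mathcal D}'_{\mathcal T}\to\widetilde{\mathcal D}_{\mathcal T}\otimes\widetilde{\mathcal D}'_{\mathcal T}$ is a left coaction and that $\Phi$ is a morphism of left comodules: $$(I\otimes\Phi)\circ\Delta=m^{13}\circ(\Delta\otimes\Delta)\circ\Phi,$$ where $m^{13}:=(m\otimes I\otimes I)\circ\tau^{23}$ and $\tau^{23}$ exchanges the second and third of four tensor factors.
   Formalization: It is assumed that each collection of half-edge types is shared by only finitely many vertex types (otherwise the coproduct sum can be infinite), and a component reduced to a single vertex must carry that vertex's own index as its specification. *)

theory Defs
  imports
    Complex_Main
    "HOL-Library.Multiset"
    "HOL-Library.Product_Plus"
    "HOL-Library.Poly_Mapping"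
begin

section \<open>Feynman graphs\<close>

text \<open>
  The type of a vertex is the multiset of the types of its half-edges together with an index;
  as the multiset can be read off the graph, only the index is stored.
\<close>

record ('v, 'h, 't) fgraph =
  verts :: "'v set"
  halfs :: "'h set"
  bd :: "'h \<Rightarrow> 'v"
  invol :: "'h \<Rightarrow> 'h"
  htype :: "'h \<Rightarrow> 't"
  vindex :: "'v \<Rightarrow> nat"

text \<open>
  The involution is extended by the identity outside the half-edges, so that a covering
  subgraph of a given graph is determined by its internal edges.
\<close>

definition feynman_graph :: "('v, 'h, 't, 'z) fgraph_scheme \<Rightarrow> bool" where
  "feynman_graph G \<longleftrightarrow>
     finite (verts G) \<and> finite (halfs G) \<and> bd G ` halfs G \<subseteq> verts G \<and>
     (\<forall>e\<in>halfs G. invol G e \<in> halfs G \<and> invol G (invol G e) = e \<and>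
        htype G (invol G e) = htype G e) \<and>
     (\<forall>e. e \<notin> halfs G \<longrightarrow> invol G e = e)"

definition adjacency :: "('v, 'h, 't, 'z) fgraph_scheme \<Rightarrow> ('v \<times> 'v) set" where
  "adjacency G = {(bd G e, bd G (invol G e)) |e. e \<in> halfs G}"

definition component_of :: "('v, 'h, 't, 'z) fgraph_scheme \<Rightarrow> 'v \<Rightarrow> 'v set" where
  "component_of G v = (adjacency G)\<^sup>* `` {v}"

text \<open>A connected component is represented by its set of vertices.\<close>

definition pi0 :: "('v, 'h, 't, 'z) fgraph_scheme \<Rightarrow> 'v set set" where
  "pi0 G = component_of G ` verts G"

definition connected_graph :: "('v, 'h, 't, 'z) fgraph_scheme \<Rightarrow> bool" where
  "connected_graph G \<longleftrightarrow> is_singleton (pi0 G)"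

definition cut_edge :: "'h \<Rightarrow> ('v, 'h, 't, 'z) fgraph_scheme \<Rightarrow> ('v, 'h, 't, 'z) fgraph_scheme" where
  "cut_edge e G = G\<lparr>invol := (invol G)(e := e, invol G e := invol G e)\<rparr>"

definition one_PI :: "('v, 'h, 't, 'z) fgraph_scheme \<Rightarrow> bool" where
  "one_PI G \<longleftrightarrow> connected_graph G \<and>
     (\<forall>e\<in>halfs G. invol G e \<noteq> e \<longrightarrow> connected_graph (cut_edge e G))"

definition restrict_graph ::
  "('v, 'h, 't, 'z) fgraph_scheme \<Rightarrow> 'v set \<Rightarrow> ('v, 'h, 't, 'z) fgraph_scheme" where
  "restrict_graph G C =
     G\<lparr>verts := C, halfs := {e \<in> halfs G. bd G e \<in> C},
       invol := (\<lambda>e. if e \<in> halfs G \<and> bd G e \<in> C then invol G e else e)\<rparr>"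

definition locally_one_PI :: "('v, 'h, 't, 'z) fgraph_scheme \<Rightarrow> bool" where
  "locally_one_PI G \<longleftrightarrow> (\<forall>C\<in>pi0 G. one_PI (restrict_graph G C))"

definition external :: "('v, 'h, 't, 'z) fgraph_scheme \<Rightarrow> 'h set" where
  "external G = {e \<in> halfs G. invol G e = e}"

definition vertex_legs :: "('v, 'h, 't, 'z) fgraph_scheme \<Rightarrow> 'v \<Rightarrow> 't multiset" where
  "vertex_legs G v = image_mset (htype G) (mset_set {e \<in> halfs G. bd G e = v})"

text \<open>The half-edge types of the vertex to which a component is shrunk in the residue.\<close>

definition residue_legs :: "('v, 'h, 't, 'z) fgraph_scheme \<Rightarrow> 'v set \<Rightarrow> 't multiset" where
  "residue_legs G C = image_mset (htype G) (mset_set {e \<in> external G. bd G e \<in> C})"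


section \<open>Theories and specified graphs\<close>

record 't qft =
  edge_types :: "'t set"
  vertex_types :: "('t multiset \<times> nat) set"

text \<open>
  Only finitely many vertex types may share a collection of half-edge types: otherwise the sum
  over specified covering subgraphs in the coproduct would be infinite.
\<close>

definition physical_theory :: "'t qft \<Rightarrow> bool" where
  "physical_theory T \<longleftrightarrow>
     (\<forall>(M, i)\<in>vertex_types T. set_mset M \<subseteq> edge_types T) \<and>
     (\<forall>M. finite {i. (M, i) \<in> vertex_types T})"

record ('v, 'h, 't) sgraph = "('v, 'h, 't) fgraph" +
  spec :: "'v set \<rightharpoonup> nat"

text \<open>
  The last condition: shrinking a component without internal edges yields the vertex it consists
  of, whose type is already given, so that its own index is the only one allowed.  Membership of
  the specified residue in the vertex types contains superficial divergence.
\<close>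

definition specified_graph :: "'t qft \<Rightarrow> ('v, 'h, 't) sgraph \<Rightarrow> bool" where
  "specified_graph T G \<longleftrightarrow>
     feynman_graph G \<and> locally_one_PI G \<and>
     htype G ` halfs G \<subseteq> edge_types T \<and>
     (\<forall>v\<in>verts G. (vertex_legs G v, vindex G v) \<in> vertex_types T) \<and>
     dom (spec G) = pi0 G \<and>
     (\<forall>C\<in>pi0 G. (residue_legs G C, the (spec G C)) \<in> vertex_types T) \<and>
     (\<forall>v\<in>verts G. {e \<in> halfs G. bd G e = v} \<subseteq> external G \<longrightarrow> spec G {v} = Some (vindex G v))"

definition covering_subgraph ::
  "('v, 'h, 't) sgraph \<Rightarrow> ('v, 'h, 't) sgraph \<Rightarrow> bool" where
  "covering_subgraph g G \<longleftrightarrow>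
     g = G\<lparr>invol := invol g, spec := spec g\<rparr> \<and> (\<forall>e. invol g e = e \<or> invol g e = invol G e)"

text \<open>
  A component of the subgraph is also a component of the whole graph only if it has the same
  vertices and the same internal edges.
\<close>

definition specified_subgraph ::
  "('v, 'h, 't) sgraph \<Rightarrow> ('v, 'h, 't) sgraph \<Rightarrow> bool" where
  "specified_subgraph g G \<longleftrightarrow>
     covering_subgraph g G \<and>
     (\<forall>C \<in> pi0 g \<inter> pi0 G. (\<forall>e\<in>halfs G. bd G e \<in> C \<longrightarrow> invol g e = invol G e)
        \<longrightarrow> spec g C = spec G C)"

text \<open>
  The vertices of the contracted graph are the components of the subgraph, and its components
  are the sets of such vertices whose union is a component of the original graph.  For a
  component without internal edges the specification is the index of its vertex.
\<close>

definition contract ::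
  "('v, 'h, 't) sgraph \<Rightarrow> ('v, 'h, 't) sgraph \<Rightarrow> ('v set, 'h, 't) sgraph" where
  "contract G g =
     \<lparr>verts = pi0 g, halfs = external g,
      bd = (\<lambda>e. component_of g (bd g e)),
      invol = (\<lambda>e. if e \<in> external g then invol G e else e),
      htype = htype g,
      vindex = (\<lambda>C. the (spec g C)),
      spec = (\<lambda>K. if K \<subseteq> pi0 g then spec G (\<Union>K) else None)\<rparr>"

definition restrict_sgraph ::
  "('v, 'h, 't) sgraph \<Rightarrow> 'v set \<Rightarrow> ('v, 'h, 't) sgraph" where
  "restrict_sgraph G C = (restrict_graph G C)\<lparr>spec := spec G |` Pow C\<rparr>"

definition disjoint_union ::
  "('v, 'h, 't) sgraph \<Rightarrow> ('w, 'g, 't) sgraph \<Rightarrow> ('v + 'w, 'h + 'g, 't) sgraph" where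
  "disjoint_union G H =
     \<lparr>verts = verts G <+> verts H, halfs = halfs G <+> halfs H,
      bd = map_sum (bd G) (bd H), invol = map_sum (invol G) (invol H),
      htype = case_sum (htype G) (htype H), vindex = case_sum (vindex G) (vindex H),
      spec = (\<lambda>K. if K \<subseteq> range Inl then spec G (Inl -` K)
                  else if K \<subseteq> range Inr then spec H (Inr -` K) else None)\<rparr>"

definition empty_sgraph :: "('v, 'h, 't) sgraph" where
  "empty_sgraph =
     \<lparr>verts = {}, halfs = {}, bd = (\<lambda>_. undefined), invol = id, htype = (\<lambda>_. undefined),
      vindex = (\<lambda>_. undefined), spec = Map.empty\<rparr>"


section \<open>Isomorphism classes of pairs\<close>

definition sgraph_iso ::
  "('v \<Rightarrow> 'w) \<Rightarrow> ('h \<Rightarrow> 'g) \<Rightarrow> ('v, 'h, 't) sgraph \<Rightarrow> ('w, 'g, 't) sgraph \<Rightarrow> bool" where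
  "sgraph_iso f g G H \<longleftrightarrow>
     bij_betw f (verts G) (verts H) \<and> bij_betw g (halfs G) (halfs H) \<and>
     (\<forall>e\<in>halfs G. bd H (g e) = f (bd G e) \<and> invol H (g e) = g (invol G e) \<and>
        htype H (g e) = htype G e) \<and>
     (\<forall>v\<in>verts G. vindex H (f v) = vindex G v) \<and>
     (\<forall>C\<in>pi0 G. spec H (f ` C) = spec G C)"

type_synonym ('v, 'h, 't) spair = "('v, 'h, 't) sgraph \<times> ('v, 'h, 't) sgraph"

definition graph_pair :: "('v, 'h, 't) spair \<Rightarrow> bool" where
  "graph_pair = (\<lambda>(G, g). feynman_graph G \<and> feynman_graph g \<and>
     dom (spec G) = pi0 G \<and> dom (spec g) = pi0 g \<and> specified_subgraph g G)"

definition pair_iso :: "('v, 'h, 't) spair \<Rightarrow> ('w, 'g, 't) spair \<Rightarrow> bool" where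
  "pair_iso P Q \<longleftrightarrow>
     (\<exists>f g. sgraph_iso f g (fst P) (fst Q) \<and> sgraph_iso f g (snd P) (snd Q))"

text \<open>
  All graphs being finite, an isomorphism class is represented by the set of its members with
  vertices and half-edges labelled by natural numbers.
\<close>

type_synonym 't pclass = "(nat, nat, 't) spair set"

definition pair_class :: "('v, 'h, 't) spair \<Rightarrow> 't pclass" where
  "pair_class P = {Q. graph_pair Q \<and> pair_iso P Q}"

definition rep :: "'t pclass \<Rightarrow> (nat, nat, 't) spair" where
  "rep c = (SOME P. P \<in> c)"

definition D_pair :: "'t qft \<Rightarrow> ('v, 'h, 't) spair \<Rightarrow> bool" where
  "D_pair T = (\<lambda>(G, g). specified_graph T G \<and> specified_graph T g \<and> specified_subgraph g G \<and>
     specified_graph T (contract G g))"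

definition F_pair :: "'t qft \<Rightarrow> ('v, 'h, 't) spair \<Rightarrow> bool" where
  "F_pair T = (\<lambda>(G, g). D_pair T (G, g) \<and> connected_graph G \<and> connected_graph (contract G g))"

definition D_basis :: "'t qft \<Rightarrow> 't pclass set" where
  "D_basis T = pair_class ` {P :: (nat, nat, 't) spair. D_pair T P}"

definition F_basis :: "'t qft \<Rightarrow> 't pclass set" where
  "F_basis T = pair_class ` {P :: (nat, nat, 't) spair. F_pair T P}"

text \<open>
  The symmetric algebra of the space with basis \<open>F_basis T\<close> is the polynomial algebra on that
  basis, with the monomials (multisets of basis elements) as a basis.
\<close>

definition D'_basis :: "'t qft \<Rightarrow> 't pclass multiset set" where
  "D'_basis T = {M. set_mset M \<subseteq> F_basis T}"

definition juxtapose :: "('v, 'h, 't) spair \<Rightarrow> ('w, 'g, 't) spair \<Rightarrow> ('v + 'w, 'h + 'g, 't) spair" where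
  "juxtapose P Q = (disjoint_union (fst P) (fst Q), disjoint_union (snd P) (snd Q))"

definition component_classes :: "('v, 'h, 't) spair \<Rightarrow> 't pclass multiset" where
  "component_classes = (\<lambda>(G, g).
     image_mset (\<lambda>C. pair_class (restrict_sgraph G C, restrict_sgraph g C)) (mset_set (pi0 G)))"

definition sub_specs :: "'t qft \<Rightarrow> ('v, 'h, 't) sgraph \<Rightarrow> ('v, 'h, 't) sgraph set" where
  "sub_specs T g =
     {d. specified_graph T d \<and> specified_subgraph d g \<and> specified_graph T (contract g d)}"


section \<open>Linear algebra on free vector spaces\<close>

text \<open>
  The vector space with basis \<open>A\<close> consists of the finitely supported functions on the ambient
  type with support in \<open>A\<close>; the tensor product of the spaces with bases \<open>A\<close> and \<open>B\<close> is the space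
  with basis \<open>A \<times> B\<close>.
\<close>

abbreviation basis :: "'a \<Rightarrow> 'a \<Rightarrow>\<^sub>0 'k::field" where
  "basis a \<equiv> Poly_Mapping.single a 1"

definition scale :: "'k::field \<Rightarrow> ('a \<Rightarrow>\<^sub>0 'k) \<Rightarrow> ('a \<Rightarrow>\<^sub>0 'k)" where
  "scale c x = Poly_Mapping.map ((*) c) x"

definition free_space :: "'a set \<Rightarrow> ('a \<Rightarrow>\<^sub>0 'k::field) set" where
  "free_space A = {x. Poly_Mapping.keys x \<subseteq> A}"

definition lin :: "('a \<Rightarrow> ('b \<Rightarrow>\<^sub>0 'k::field)) \<Rightarrow> ('a \<Rightarrow>\<^sub>0 'k) \<Rightarrow> ('b \<Rightarrow>\<^sub>0 'k)" where
  "lin f x = (\<Sum>a\<in>Poly_Mapping.keys x. scale (Poly_Mapping.lookup x a) (f a))"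

definition tensor :: "('a \<Rightarrow>\<^sub>0 'k::field) \<Rightarrow> ('b \<Rightarrow>\<^sub>0 'k) \<Rightarrow> ('a \<times> 'b \<Rightarrow>\<^sub>0 'k)" where
  "tensor x y = lin (\<lambda>a. lin (\<lambda>b. basis (a, b)) y) x"

definition tensor_map ::
  "(('a \<Rightarrow>\<^sub>0 'k::field) \<Rightarrow> ('c \<Rightarrow>\<^sub>0 'k)) \<Rightarrow> (('b \<Rightarrow>\<^sub>0 'k) \<Rightarrow> ('d \<Rightarrow>\<^sub>0 'k))
    \<Rightarrow> ('a \<times> 'b \<Rightarrow>\<^sub>0 'k) \<Rightarrow> ('c \<times> 'd \<Rightarrow>\<^sub>0 'k)" where
  "tensor_map f g = lin (\<lambda>(a, b). tensor (f (basis a)) (g (basis b)))"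

definition assoc_map :: "(('a \<times> 'b) \<times> 'c \<Rightarrow>\<^sub>0 'k::field) \<Rightarrow> ('a \<times> ('b \<times> 'c) \<Rightarrow>\<^sub>0 'k)" where
  "assoc_map = lin (\<lambda>((a, b), c). basis (a, (b, c)))"

definition tau23 ::
  "(('a \<times> 'b) \<times> ('c \<times> 'd) \<Rightarrow>\<^sub>0 'k::field) \<Rightarrow> (('a \<times> 'c) \<times> ('b \<times> 'd) \<Rightarrow>\<^sub>0 'k)" where
  "tau23 = lin (\<lambda>((a, b), (c, d)). basis ((a, c), (b, d)))"

definition mult_map ::
  "(('a \<Rightarrow>\<^sub>0 'k::field) \<Rightarrow> ('a \<Rightarrow>\<^sub>0 'k) \<Rightarrow> ('a \<Rightarrow>\<^sub>0 'k)) \<Rightarrow> ('a \<times> 'a \<Rightarrow>\<^sub>0 'k) \<Rightarrow> ('a \<Rightarrow>\<^sub>0 'k)" where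
  "mult_map m = lin (\<lambda>(a, b). m (basis a) (basis b))"

definition m13 ::
  "(('a \<Rightarrow>\<^sub>0 'k::field) \<Rightarrow> ('a \<Rightarrow>\<^sub>0 'k) \<Rightarrow> ('a \<Rightarrow>\<^sub>0 'k))
    \<Rightarrow> (('a \<times> 'b) \<times> ('a \<times> 'b) \<Rightarrow>\<^sub>0 'k) \<Rightarrow> ('a \<times> ('b \<times> 'b) \<Rightarrow>\<^sub>0 'k)" where
  "m13 m = tensor_map (mult_map m) id \<circ> tau23"

definition counit_map ::
  "(('a \<Rightarrow>\<^sub>0 'k::field) \<Rightarrow> 'k) \<Rightarrow> ('a \<times> 'b \<Rightarrow>\<^sub>0 'k) \<Rightarrow> ('b \<Rightarrow>\<^sub>0 'k)" where
  "counit_map eps = lin (\<lambda>(a, b). scale (eps (basis a)) (basis b))"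

definition linear_on ::
  "'a set \<Rightarrow> 'b set \<Rightarrow> (('a \<Rightarrow>\<^sub>0 'k::field) \<Rightarrow> ('b \<Rightarrow>\<^sub>0 'k)) \<Rightarrow> bool" where
  "linear_on A B f \<longleftrightarrow>
     (\<forall>x\<in>free_space A. f x \<in> free_space B) \<and>
     (\<forall>x\<in>free_space A. \<forall>y\<in>free_space A. f (x + y) = f x + f y) \<and>
     (\<forall>c. \<forall>x\<in>free_space A. f (scale c x) = scale c (f x))"

definition comm_algebra ::
  "'a set \<Rightarrow> (('a \<Rightarrow>\<^sub>0 'k::field) \<Rightarrow> ('a \<Rightarrow>\<^sub>0 'k) \<Rightarrow> ('a \<Rightarrow>\<^sub>0 'k)) \<Rightarrow> ('a \<Rightarrow>\<^sub>0 'k) \<Rightarrow> bool" where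
  "comm_algebra A m u \<longleftrightarrow>
     u \<in> free_space A \<and>
     (\<forall>x\<in>free_space A. linear_on A A (m x)) \<and>
     (\<forall>x\<in>free_space A. \<forall>y\<in>free_space A. m x y = m y x) \<and>
     (\<forall>x\<in>free_space A. \<forall>y\<in>free_space A. \<forall>z\<in>free_space A. m (m x y) z = m x (m y z)) \<and>
     (\<forall>x\<in>free_space A. m u x = x)"

definition algebra_iso ::
  "'a set \<Rightarrow> (('a \<Rightarrow>\<^sub>0 'k::field) \<Rightarrow> ('a \<Rightarrow>\<^sub>0 'k) \<Rightarrow> ('a \<Rightarrow>\<^sub>0 'k)) \<Rightarrow> ('a \<Rightarrow>\<^sub>0 'k) \<Rightarrow>
   'b set \<Rightarrow> (('b \<Rightarrow>\<^sub>0 'k) \<Rightarrow> ('b \<Rightarrow>\<^sub>0 'k) \<Rightarrow> ('b \<Rightarrow>\<^sub>0 'k)) \<Rightarrow> ('b \<Rightarrow>\<^sub>0 'k) \<Rightarrow>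
   (('a \<Rightarrow>\<^sub>0 'k) \<Rightarrow> ('b \<Rightarrow>\<^sub>0 'k)) \<Rightarrow> bool" where
  "algebra_iso A m u B m' u' f \<longleftrightarrow>
     comm_algebra A m u \<and> comm_algebra B m' u' \<and>
     linear_on A B f \<and> bij_betw f (free_space A) (free_space B) \<and>
     (\<forall>x\<in>free_space A. \<forall>y\<in>free_space A. f (m x y) = m' (f x) (f y)) \<and> f u = u'"

definition left_coaction ::
  "'a set \<Rightarrow> (('a \<Rightarrow>\<^sub>0 'k::field) \<Rightarrow> ('a \<times> 'a \<Rightarrow>\<^sub>0 'k)) \<Rightarrow> (('a \<Rightarrow>\<^sub>0 'k) \<Rightarrow> 'k) \<Rightarrow>
   'b set \<Rightarrow> (('b \<Rightarrow>\<^sub>0 'k) \<Rightarrow> ('a \<times> 'b \<Rightarrow>\<^sub>0 'k)) \<Rightarrow> bool" where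
  "left_coaction A cop eps B coa \<longleftrightarrow>
     linear_on B (A \<times> B) coa \<and>
     (\<forall>x\<in>free_space B. assoc_map (tensor_map cop id (coa x)) = tensor_map id coa (coa x)) \<and>
     (\<forall>x\<in>free_space B. counit_map eps (coa x) = x)"

definition comodule_coalgebra ::
  "'a set \<Rightarrow> (('a \<Rightarrow>\<^sub>0 'k::field) \<Rightarrow> ('a \<Rightarrow>\<^sub>0 'k) \<Rightarrow> ('a \<Rightarrow>\<^sub>0 'k)) \<Rightarrow>
   (('a \<Rightarrow>\<^sub>0 'k) \<Rightarrow> ('a \<times> 'a \<Rightarrow>\<^sub>0 'k)) \<Rightarrow> (('a \<Rightarrow>\<^sub>0 'k) \<Rightarrow> 'k) \<Rightarrow>
   'b set \<Rightarrow> (('b \<Rightarrow>\<^sub>0 'k) \<Rightarrow> ('b \<times> 'b \<Rightarrow>\<^sub>0 'k)) \<Rightarrow> (('b \<Rightarrow>\<^sub>0 'k) \<Rightarrow> ('a \<times> 'b \<Rightarrow>\<^sub>0 'k)) \<Rightarrow> bool" where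
  "comodule_coalgebra A m cop eps B Phi coa \<longleftrightarrow>
     left_coaction A cop eps B coa \<and>
     linear_on B (B \<times> B) Phi \<and>
     (\<forall>x\<in>free_space B. tensor_map id Phi (coa x) = m13 m (tensor_map coa coa (Phi x)))"


section \<open>The structures on pairs of graphs\<close>

text \<open>
  The definitions through a chosen representative do not depend on the choice, as all the
  constructions involved are invariant under isomorphism of pairs.
\<close>

definition D_mult :: "('t pclass \<Rightarrow>\<^sub>0 'k::field) \<Rightarrow> ('t pclass \<Rightarrow>\<^sub>0 'k) \<Rightarrow> ('t pclass \<Rightarrow>\<^sub>0 'k)" where
  "D_mult x y = lin (\<lambda>c. lin (\<lambda>d. basis (pair_class (juxtapose (rep c) (rep d)))) y) x"

definition D_one :: "'t pclass \<Rightarrow>\<^sub>0 'k::field" where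
  "D_one = basis (pair_class (empty_sgraph :: (nat, nat, 't) sgraph, empty_sgraph))"

definition D_coproduct :: "'t qft \<Rightarrow> ('t pclass \<Rightarrow>\<^sub>0 'k::field) \<Rightarrow> ('t pclass \<times> 't pclass \<Rightarrow>\<^sub>0 'k)" where
  "D_coproduct T = lin (\<lambda>c. case rep c of (G, g) \<Rightarrow>
     \<Sum>d\<in>sub_specs T g. basis (pair_class (G, d), pair_class (contract G d, contract g d)))"

text \<open>The counit is 1 on the pairs whose subgraph has no internal edge and 0 on the others.\<close>

definition D_counit :: "('t pclass \<Rightarrow>\<^sub>0 'k::field) \<Rightarrow> 'k" where
  "D_counit x = (\<Sum>c\<in>Poly_Mapping.keys x.
     if external (snd (rep c)) = halfs (snd (rep c)) then Poly_Mapping.lookup x c else 0)"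

text \<open>
  The product of \<open>'a multiset \<Rightarrow>\<^sub>0 'k\<close> is that of polynomials, and the product of
  \<open>'a multiset \<times> 'a multiset \<Rightarrow>\<^sub>0 'k\<close> is the componentwise one of the tensor square.
\<close>

definition unshuffle :: "('a multiset \<Rightarrow>\<^sub>0 'k::field) \<Rightarrow> ('a multiset \<times> 'a multiset \<Rightarrow>\<^sub>0 'k)" where
  "unshuffle = lin (\<lambda>M. \<Prod>x\<in>#M. basis ({#x#}, {#}) + basis ({#}, {#x#}))"

text \<open>
  The element of the symmetric algebra that a pair denotes is the product of its connected
  components.
\<close>

definition D_to_D' :: "('t pclass \<Rightarrow>\<^sub>0 'k::field) \<Rightarrow> ('t pclass multiset \<Rightarrow>\<^sub>0 'k)" where
  "D_to_D' = lin (\<lambda>c. basis (component_classes (rep c)))"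

definition D'_rep :: "'t qft \<Rightarrow> 't pclass multiset \<Rightarrow> (nat, nat, 't) spair" where
  "D'_rep T M = (SOME P. D_pair T P \<and> component_classes P = M)"

definition D'_coaction ::
  "'t qft \<Rightarrow> ('t pclass multiset \<Rightarrow>\<^sub>0 'k::field) \<Rightarrow> ('t pclass \<times> 't pclass multiset \<Rightarrow>\<^sub>0 'k)" where
  "D'_coaction T = lin (\<lambda>M. case D'_rep T M of (G, g) \<Rightarrow>
     \<Sum>d\<in>sub_specs T g.
       basis (pair_class (G, d), component_classes (contract G d, contract g d)))"

end

theory Submission
  imports Defs "HOL-Library.Disjoint_Sets"
begin

text \<open>
  A connected graph stays connected when an edge is cut exactly if the ends of that edge stay
  connected.  In this form local one-particle irreducibility passes to \<open>G / d\<close>, and back from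
  \<open>d\<close> and \<open>G / d\<close> to \<open>G\<close>.  Hence \<open>G / d\<close> is automatically a specified graph when \<open>G\<close> and
  \<open>d \<subseteq> G\<close> are, and the specified subgraphs of \<open>g / d\<close> are exactly the \<open>e / d\<close> with
  \<open>d \<subseteq> e \<subseteq> g\<close>.  Together with \<open>(G / d) / (e / d) \<cong> G / e\<close> this makes both sides of
  coassociativity a sum over the chains \<open>d \<subseteq> e \<subseteq> g\<close>.

  Isomorphisms of the connected components glue, so a pair is determined up to isomorphism by the
  multiset of its components; this is the algebra isomorphism.  A subgraph of a disjoint union is a
  disjoint union of subgraphs, so the coaction is multiplicative, as is the unshuffling coproduct,
  and it suffices to check that the latter is a comodule morphism on connected pairs.  There it
  holds because contraction preserves connectedness.
\<close>


section \<open>Connectivity\<close>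

text \<open>The obstacle is that every structure map is defined on isomorphism classes through a
  chosen representative, while contraction and juxtaposition change the types of the labels. Each
  formula is therefore proved for an arbitrary pair with arbitrary labels, and sums over specified
  subgraphs are transported along isomorphisms. Injections in both directions suffice, because these
  sets of subgraphs are finite; this is where the finiteness clause of
  \<open>physical_theory\<close> enters. Specifications could clash where a component of the smaller
  graph survives unchanged in the larger one. Such a component is a vertex without internal edges of
  the contracted graph, and there the last clause of \<open>specified_graph\<close> forces the
  index. The same clause makes the subgraph without internal edges unique, which is the counit law.
  In the comodule morphism identity the left tensor factor is a class and not a monomial, so its
  product is not that of the ambient ring. Replacing the class by its multiset of components turns
  both sides into ring-multiplicative functions of the monomial.\<close>

definition reach :: "('v, 'h, 't, 'z) fgraph_scheme \<Rightarrow> ('v \<times> 'v) set" where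
  "reach G = (adjacency G)\<^sup>*"

lemma reach_refl [simp]: "(v, v) \<in> reach G"
  unfolding reach_def by simp

lemma reach_trans: "(u, v) \<in> reach G \<Longrightarrow> (v, w) \<in> reach G \<Longrightarrow> (u, w) \<in> reach G"
  unfolding reach_def by simp

lemma reach_induct [consumes 1, case_names refl step]:
  assumes "(u, v) \<in> reach G" "P u"
    and "\<And>e. e \<in> halfs G \<Longrightarrow> (u, bd G e) \<in> reach G \<Longrightarrow> P (bd G e) \<Longrightarrow> P (bd G (invol G e))"
  shows "P v"
  using assms(1) unfolding reach_def
proof (induction rule: rtrancl_induct)
  case (step y z)
  then show ?case using assms(3) unfolding adjacency_def reach_def by blast
qed (rule assms(2))

lemma feynman_graphD:
  assumes "feynman_graph G"
  shows "finite (verts G)" "finite (halfs G)"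
    "\<And>e. e \<in> halfs G \<Longrightarrow> bd G e \<in> verts G"
    "\<And>e. invol G e \<in> halfs G \<longleftrightarrow> e \<in> halfs G"
    "\<And>e. invol G (invol G e) = e"
    "\<And>e. htype G (invol G e) = htype G e"
    "\<And>e. e \<notin> halfs G \<Longrightarrow> invol G e = e"
proof -
  show "invol G e \<in> halfs G \<longleftrightarrow> e \<in> halfs G" for e
    using assms unfolding feynman_graph_def by (cases "e \<in> halfs G") auto
  show "invol G (invol G e) = e" for e
    using assms unfolding feynman_graph_def by (cases "e \<in> halfs G") auto
  show "htype G (invol G e) = htype G e" for e
    using assms unfolding feynman_graph_def by (cases "e \<in> halfs G") auto
qed (use assms in \<open>auto simp: feynman_graph_def\<close>)

lemma invol_eq_iff:
  assumes "feynman_graph G" shows "invol G a = invol G b \<longleftrightarrow> a = b"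
  using feynman_graphD(5)[OF assms] by metis

lemma reach_edge: "e \<in> halfs G \<Longrightarrow> (bd G e, bd G (invol G e)) \<in> reach G"
  unfolding reach_def adjacency_def by blast

text \<open>An edge need only be sent to a path, not to an edge. In this form the statement covers
  both contraction, which collapses edges, and rerouting around a cut edge.\<close>

lemma reach_hom:
  assumes "\<And>e. e \<in> halfs G \<Longrightarrow> (\<phi> (bd G e), \<phi> (bd G (invol G e))) \<in> reach H"
    and "(u, v) \<in> reach G"
  shows "(\<phi> u, \<phi> v) \<in> reach H"
  using assms(2)
proof (induction rule: reach_induct)
  case (step e)
  then show ?case using assms(1)[of e] by (auto intro: reach_trans)
qed simp

lemma reach_closed:
  assumes "\<And>e. e \<in> halfs G \<Longrightarrow> bd G e \<in> C \<Longrightarrow> bd G (invol G e) \<in> C"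
    and "(u, v) \<in> reach G" "u \<in> C"
  shows "v \<in> C"
  using assms(2) by (induction rule: reach_induct) (use assms(1,3) in auto)

lemma reach_sym:
  assumes "feynman_graph G" "(u, v) \<in> reach G" shows "(v, u) \<in> reach G"
proof -
  have "sym (adjacency G)"
    unfolding adjacency_def sym_def using feynman_graphD(4,5)[OF assms(1)] by force
  then show ?thesis using assms(2) unfolding reach_def by (meson symD sym_rtrancl)
qed

lemma mem_component_of: "w \<in> component_of G v \<longleftrightarrow> (v, w) \<in> reach G"
  unfolding component_of_def reach_def by simp

lemma component_of_self [simp]: "v \<in> component_of G v"
  by (simp add: mem_component_of)

lemma component_of_eq_iff:
  assumes "feynman_graph G"
  shows "component_of G u = component_of G v \<longleftrightarrow> (u, v) \<in> reach G"
proof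
  assume "component_of G u = component_of G v"
  then show "(u, v) \<in> reach G" by (metis component_of_self mem_component_of)
next
  assume "(u, v) \<in> reach G"
  then show "component_of G u = component_of G v"
    using reach_sym[OF assms] by (auto simp: mem_component_of) (meson reach_trans)+
qed

lemma reach_verts:
  assumes "feynman_graph G" "(u, v) \<in> reach G" "u \<in> verts G" shows "v \<in> verts G"
  using reach_closed[of G "verts G"] assms feynman_graphD(3,4)[OF assms(1)] by blast

lemma component_of_subset:
  assumes "feynman_graph G" "v \<in> verts G" shows "component_of G v \<subseteq> verts G"
  using reach_verts[OF assms(1)] assms(2) by (auto simp: mem_component_of)

lemma pi0_subset: "feynman_graph G \<Longrightarrow> C \<in> pi0 G \<Longrightarrow> C \<subseteq> verts G"
  unfolding pi0_def using component_of_subset by (metis imageE)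

lemma pi0_nonempty: "C \<in> pi0 G \<Longrightarrow> C \<noteq> {}"
  unfolding pi0_def using component_of_self by (metis empty_iff imageE)

lemma pi0_eq:
  assumes "feynman_graph G" "C \<in> pi0 G" "v \<in> C"
  shows "C = component_of G v"
  using assms component_of_eq_iff[OF assms(1)] unfolding pi0_def
  by (metis (no_types, lifting) imageE mem_component_of)

lemma component_of_in_pi0 [simp]: "v \<in> verts G \<Longrightarrow> component_of G v \<in> pi0 G"
  unfolding pi0_def by simp

lemma pi0_disjoint:
  assumes "feynman_graph G" "C \<in> pi0 G" "D \<in> pi0 G" "v \<in> C" "v \<in> D"
  shows "C = D"
  using pi0_eq[OF assms(1)] assms by metis

lemma Union_pi0: "feynman_graph G \<Longrightarrow> \<Union>(pi0 G) = verts G"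
  unfolding pi0_def using component_of_subset[of G] component_of_self[of _ G] by blast

lemma finite_pi0: "feynman_graph G \<Longrightarrow> finite (pi0 G)"
  unfolding pi0_def using feynman_graphD(1) by blast

lemma pi0_closed:
  assumes "feynman_graph G" "C \<in> pi0 G" "e \<in> halfs G"
  shows "bd G (invol G e) \<in> C \<longleftrightarrow> bd G e \<in> C"
proof -
  have "(bd G e, bd G (invol G e)) \<in> reach G" by (rule reach_edge[OF assms(3)])
  then show ?thesis using pi0_eq[OF assms(1,2)] reach_sym[OF assms(1)]
    by (metis mem_component_of reach_trans)
qed

lemma pi0_cong: "reach G = reach H \<Longrightarrow> verts G = verts H \<Longrightarrow> pi0 G = pi0 H"
  unfolding pi0_def component_of_def reach_def by simp

lemma isolated_component:
  assumes "\<And>e. e \<in> halfs G \<Longrightarrow> bd G e = v \<Longrightarrow> invol G e = e"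
  shows "component_of G v = {v}"
  using reach_closed[of G "{v}" v] assms by (auto simp: mem_component_of)

subsection \<open>One-particle irreducibility\<close>

lemma cut_edge_simps [simp]:
  "verts (cut_edge e G) = verts G" "halfs (cut_edge e G) = halfs G" "bd (cut_edge e G) = bd G"
  "htype (cut_edge e G) = htype G" "vindex (cut_edge e G) = vindex G"
  "invol (cut_edge e G) = (invol G)(e := e, invol G e := invol G e)"
  by (simp_all add: cut_edge_def)

lemma restrict_graph_simps [simp]:
  "verts (restrict_graph G C) = C" "halfs (restrict_graph G C) = {e \<in> halfs G. bd G e \<in> C}"
  "bd (restrict_graph G C) = bd G" "htype (restrict_graph G C) = htype G"
  "vindex (restrict_graph G C) = vindex G"
  "invol (restrict_graph G C) = (\<lambda>e. if e \<in> halfs G \<and> bd G e \<in> C then invol G e else e)"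
  by (simp_all add: restrict_graph_def)

lemma feynman_cut_edge:
  assumes "feynman_graph G" shows "feynman_graph (cut_edge e G)"
  using feynman_graphD[OF assms] invol_eq_iff[OF assms] unfolding feynman_graph_def
  by (auto split: if_splits)

text \<open>A path that starts in the closed set C never leaves it, so none of its edges is lost in
  the restriction.\<close>

lemma reach_restrict:
  assumes "\<And>e. e \<in> halfs G \<Longrightarrow> bd G e \<in> C \<Longrightarrow> bd G (invol G e) \<in> C" "u \<in> C"
  shows "(u, v) \<in> reach (restrict_graph G C) \<longleftrightarrow> (u, v) \<in> reach G"
proof
  assume "(u, v) \<in> reach (restrict_graph G C)"
  then show "(u, v) \<in> reach G"
    using reach_hom[of "restrict_graph G C" id G] reach_edge[of _ G] by auto
next
  assume "(u, v) \<in> reach G"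
  then have "(u, v) \<in> reach (restrict_graph G C) \<and> v \<in> C"
  proof (induction rule: reach_induct)
    case (step e)
    then have "(bd G e, bd G (invol G e)) \<in> reach (restrict_graph G C)"
      using reach_edge[of e "restrict_graph G C"] by auto
    then show ?case using step assms(1) by (auto intro: reach_trans)
  qed (use assms in simp)
  then show "(u, v) \<in> reach (restrict_graph G C)" by simp
qed

lemma connected_graph_iff:
  assumes "feynman_graph G"
  shows "connected_graph G \<longleftrightarrow> verts G \<noteq> {} \<and> (\<forall>u\<in>verts G. \<forall>v\<in>verts G. (u, v) \<in> reach G)"
proof
  assume "connected_graph G"
  then obtain C where C: "pi0 G = {C}" unfolding connected_graph_def is_singleton_def by auto
  then have "component_of G v = C" if "v \<in> verts G" for v
    using component_of_in_pi0[OF that] by (simp only: C singleton_iff)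
  moreover have "verts G \<noteq> {}" using C unfolding pi0_def by auto
  ultimately show "verts G \<noteq> {} \<and> (\<forall>u\<in>verts G. \<forall>v\<in>verts G. (u, v) \<in> reach G)"
    using component_of_eq_iff[OF assms] by metis
next
  assume R: "verts G \<noteq> {} \<and> (\<forall>u\<in>verts G. \<forall>v\<in>verts G. (u, v) \<in> reach G)"
  show "connected_graph G"
    unfolding connected_graph_def
  proof (rule is_singletonI')
    show "pi0 G \<noteq> {}" using R unfolding pi0_def by auto
    show "x = y" if "x \<in> pi0 G" "y \<in> pi0 G" for x y
      using that R unfolding pi0_def by (metis (no_types, lifting) component_of_eq_iff[OF assms] imageE)
  qed
qed

lemma feynman_restrict_graph:
  assumes "feynman_graph G" "\<And>e. e \<in> halfs G \<Longrightarrow> bd G e \<in> C \<Longrightarrow> bd G (invol G e) \<in> C" "finite C"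
  shows "feynman_graph (restrict_graph G C)"
  using feynman_graphD[OF assms(1)] assms(2,3) unfolding feynman_graph_def by auto

lemma cut_edge_restrict_graph:
  assumes "feynman_graph G" "\<And>e. e \<in> halfs G \<Longrightarrow> bd G e \<in> C \<Longrightarrow> bd G (invol G e) \<in> C"
    and "e \<in> halfs G" "bd G e \<in> C"
  shows "cut_edge e (restrict_graph G C) = restrict_graph (cut_edge e G) C"
proof -
  have "(\<lambda>e'. if e' \<in> halfs G \<and> bd G e' \<in> C then invol G e' else e')(e := e, invol G e := invol G e) =
    (\<lambda>e'. if e' \<in> halfs G \<and> bd G e' \<in> C then ((invol G)(e := e, invol G e := invol G e)) e' else e')"
    using assms feynman_graphD(4)[OF assms(1)] by auto
  then show ?thesis
    using assms(3,4) unfolding cut_edge_def restrict_graph_def by (simp cong: if_cong)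
qed

text \<open>The property becomes a condition on single edges that mentions neither components nor
  restrictions, so it can be compared between a graph, its subgraphs and its quotients. Quantifying
  over all half-edges is harmless, as the two ends of an external half-edge coincide.\<close>

lemma locally_one_PI_iff:
  assumes G: "feynman_graph G"
  shows "locally_one_PI G \<longleftrightarrow> (\<forall>e\<in>halfs G. (bd G e, bd G (invol G e)) \<in> reach (cut_edge e G))"
proof -
  \<comment> \<open>C is a component of G, but H will also be a graph with an edge cut, in which C
    is only known to be closed under edges.\<close>
  have conn: "connected_graph (restrict_graph H C) \<longleftrightarrow> (\<forall>u\<in>C. \<forall>v\<in>C. (u, v) \<in> reach H)"
    if H: "feynman_graph H" and C: "C \<in> pi0 G"
      and cl: "\<And>e. e \<in> halfs H \<Longrightarrow> bd H e \<in> C \<Longrightarrow> bd H (invol H e) \<in> C"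
    for H :: "('a, 'b, 'c, 'd) fgraph_scheme" and C
  proof -
    have "finite C" using C pi0_subset[OF G] feynman_graphD(1)[OF G] finite_subset by blast
    then have "feynman_graph (restrict_graph H C)" using feynman_restrict_graph[OF H cl] by blast
    from connected_graph_iff[OF this] show ?thesis
      using reach_restrict[OF cl] pi0_nonempty[OF C] by simp
  qed
  have cl: "bd G e \<in> C \<Longrightarrow> bd G (invol G e) \<in> C" if "C \<in> pi0 G" "e \<in> halfs G" for e C
    using pi0_closed[OF G that] by simp
  have same: "reach (cut_edge e G) = reach G"
    if e: "e \<in> halfs G" and r: "(bd G e, bd G (invol G e)) \<in> reach (cut_edge e G)" for e
  proof -
    \<comment> \<open>Every passage through e is replaced by the detour r, run backwards for the
      partner half-edge.\<close>
    have "(u, v) \<in> reach (cut_edge e G)" if "(u, v) \<in> reach G" for u v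
    proof (rule reach_hom[of G "\<lambda>x. x", OF _ that])
      fix e' assume e': "e' \<in> halfs G"
      consider "e' = e" | "e' = invol G e" | "e' \<noteq> e" "e' \<noteq> invol G e" by blast
      then show "(bd G e', bd G (invol G e')) \<in> reach (cut_edge e G)"
      proof cases
        case 2
        then show ?thesis
          using r reach_sym[OF feynman_cut_edge[OF G]] by (simp add: feynman_graphD(5)[OF G])
      next
        case 3
        then show ?thesis using reach_edge[of e' "cut_edge e G"] e' by simp
      qed (use r in simp)
    qed
    moreover have "(u, v) \<in> reach G" if "(u, v) \<in> reach (cut_edge e G)" for u v
      by (rule reach_hom[of "cut_edge e G" "\<lambda>x. x", OF _ that]) (auto intro: reach_edge)
    ultimately show ?thesis by (meson subrelI subset_antisym)
  qed
  have piece: "one_PI (restrict_graph G C) \<longleftrightarrow>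
      (\<forall>e\<in>halfs G. bd G e \<in> C \<longrightarrow> (bd G e, bd G (invol G e)) \<in> reach (cut_edge e G))"
    if C: "C \<in> pi0 G" for C
  proof -
    have R: "(u, v) \<in> reach G" if "u \<in> C" "v \<in> C" for u v
      using that pi0_eq[OF G C] mem_component_of by metis
    then have "connected_graph (restrict_graph G C)" using conn[OF G C cl[OF C]] by blast
    moreover have "connected_graph (cut_edge e (restrict_graph G C)) \<longleftrightarrow>
        (\<forall>u\<in>C. \<forall>v\<in>C. (u, v) \<in> reach (cut_edge e G))" if "e \<in> halfs G" "bd G e \<in> C" for e
    proof -
      have "connected_graph (restrict_graph (cut_edge e G) C) \<longleftrightarrow>
        (\<forall>u\<in>C. \<forall>v\<in>C. (u, v) \<in> reach (cut_edge e G))"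
        by (rule conn[OF feynman_cut_edge[OF G] C]) (use cl[OF C] in auto)
      then show ?thesis using cut_edge_restrict_graph[OF G cl[OF C] that] by simp
    qed
    ultimately have "one_PI (restrict_graph G C) \<longleftrightarrow>
      (\<forall>e\<in>halfs G. bd G e \<in> C \<longrightarrow> invol G e \<noteq> e \<longrightarrow> (\<forall>u\<in>C. \<forall>v\<in>C. (u, v) \<in> reach (cut_edge e G)))"
      unfolding one_PI_def by (simp add: Ball_def) metis
    also have "\<dots> \<longleftrightarrow> (\<forall>e\<in>halfs G. bd G e \<in> C \<longrightarrow> (bd G e, bd G (invol G e)) \<in> reach (cut_edge e G))"
    proof -
      have "invol G e \<noteq> e \<longrightarrow> (\<forall>u\<in>C. \<forall>v\<in>C. (u, v) \<in> reach (cut_edge e G))"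
        if "e \<in> halfs G" "(bd G e, bd G (invol G e)) \<in> reach (cut_edge e G)" for e
        using R unfolding same[OF that] by blast
      moreover have "(bd G e, bd G (invol G e)) \<in> reach (cut_edge e G)"
        if "e \<in> halfs G" "bd G e \<in> C" "invol G e \<noteq> e \<longrightarrow> (\<forall>u\<in>C. \<forall>v\<in>C. (u, v) \<in> reach (cut_edge e G))" for e
        using that cl[OF C that(1,2)] by (cases "invol G e = e") auto
      ultimately show ?thesis by blast
    qed
    finally show ?thesis .
  qed
  show ?thesis
  proof (intro iffI ballI)
    fix e assume "locally_one_PI G" "e \<in> halfs G"
    moreover from this have "component_of G (bd G e) \<in> pi0 G" using feynman_graphD(3)[OF G] by simp
    ultimately show "(bd G e, bd G (invol G e)) \<in> reach (cut_edge e G)"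
      unfolding locally_one_PI_def using piece component_of_self by metis
  next
    assume "\<forall>e\<in>halfs G. (bd G e, bd G (invol G e)) \<in> reach (cut_edge e G)"
    then show "locally_one_PI G" unfolding locally_one_PI_def using piece by simp
  qed
qed


section \<open>Isomorphisms\<close>

lemma sgraph_isoD:
  assumes "sgraph_iso f k G H"
  shows "bij_betw f (verts G) (verts H)" "bij_betw k (halfs G) (halfs H)"
    "\<And>e. e \<in> halfs G \<Longrightarrow> bd H (k e) = f (bd G e)"
    "\<And>e. e \<in> halfs G \<Longrightarrow> invol H (k e) = k (invol G e)"
    "\<And>e. e \<in> halfs G \<Longrightarrow> htype H (k e) = htype G e"
    "\<And>v. v \<in> verts G \<Longrightarrow> vindex H (f v) = vindex G v"
    "\<And>C. C \<in> pi0 G \<Longrightarrow> spec H (f ` C) = spec G C"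
  using assms unfolding sgraph_iso_def by blast+

lemma sgraph_iso_halfs: "sgraph_iso f k G H \<Longrightarrow> halfs H = k ` halfs G"
  and sgraph_iso_verts: "sgraph_iso f k G H \<Longrightarrow> verts H = f ` verts G"
  using sgraph_isoD(1,2) by (metis bij_betw_def)+

lemma sgraph_iso_inj: "sgraph_iso f k G H \<Longrightarrow> inj_on k (halfs G)"
  and sgraph_iso_inj_verts: "sgraph_iso f k G H \<Longrightarrow> inj_on f (verts G)"
  using sgraph_isoD(1,2) by (metis bij_betw_def)+

lemma reach_image:
  assumes "sgraph_iso f k G H" "feynman_graph G" "(u, v) \<in> reach G"
  shows "(f u, f v) \<in> reach H"
proof (rule reach_hom[OF _ assms(3)])
  fix e assume e: "e \<in> halfs G"
  then have "k e \<in> halfs H" using sgraph_iso_halfs[OF assms(1)] by simp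
  from reach_edge[OF this] show "(f (bd G e), f (bd G (invol G e))) \<in> reach H"
    using sgraph_isoD(3,4)[OF assms(1)] e feynman_graphD(4)[OF assms(2)] by simp
qed

text \<open>The inverse vertex map is handled directly: that the inverse of an isomorphism is again
  one involves the components of H, whose description rests on this lemma.\<close>

lemma reach_preimage:
  assumes I: "sgraph_iso f k G H" and G: "feynman_graph G"
    and "u \<in> verts G" "v \<in> verts G" "(f u, f v) \<in> reach H"
  shows "(u, v) \<in> reach G"
proof -
  let ?f = "inv_into (verts G) f"
  have inv: "?f (f x) = x" if "x \<in> verts G" for x
    using inv_into_f_f[OF sgraph_iso_inj_verts[OF I] that] .
  have "(?f (f u), ?f (f v)) \<in> reach G"
  proof (rule reach_hom[OF _ assms(5)])
    fix e' assume "e' \<in> halfs H"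
    then obtain e where e: "e \<in> halfs G" "e' = k e" using sgraph_iso_halfs[OF I] by auto
    then have "invol G e \<in> halfs G" using feynman_graphD(4)[OF G] by simp
    then have "?f (bd H e') = bd G e" "?f (bd H (invol H e')) = bd G (invol G e)"
      using e inv feynman_graphD(3)[OF G] sgraph_isoD(3,4)[OF I] by simp_all
    then show "(?f (bd H e'), ?f (bd H (invol H e'))) \<in> reach G" using reach_edge[OF e(1)] by simp
  qed
  then show ?thesis using inv assms(3,4) by simp
qed

lemma component_of_image:
  assumes "sgraph_iso f k G H" "feynman_graph G" "feynman_graph H" "v \<in> verts G"
  shows "component_of H (f v) = f ` component_of G v"
proof (intro set_eqI iffI)
  fix y assume "y \<in> component_of H (f v)"
  then have y: "(f v, y) \<in> reach H" by (simp add: mem_component_of)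
  moreover have "f v \<in> verts H" using assms(4) sgraph_iso_verts[OF assms(1)] by simp
  ultimately obtain w where "w \<in> verts G" "y = f w"
    using reach_verts[OF assms(3)] sgraph_iso_verts[OF assms(1)] by blast
  then show "y \<in> f ` component_of G v"
    using reach_preimage[OF assms(1,2,4)] y by (auto simp: mem_component_of)
qed (use reach_image[OF assms(1,2)] in \<open>auto simp: mem_component_of\<close>)

lemma pi0_image:
  assumes "sgraph_iso f k G H" "feynman_graph G" "feynman_graph H"
  shows "pi0 H = (`) f ` pi0 G"
  unfolding pi0_def sgraph_iso_verts[OF assms(1)] image_image
  using component_of_image[OF assms] by (rule image_cong[OF refl])

lemma sgraph_iso_trans:
  assumes "sgraph_iso f k G H" "sgraph_iso f' k' H K" "feynman_graph G" "feynman_graph H"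
  shows "sgraph_iso (f' \<circ> f) (k' \<circ> k) G K"
  unfolding sgraph_iso_def
proof (intro conjI ballI)
  show "bij_betw (f' \<circ> f) (verts G) (verts K)" "bij_betw (k' \<circ> k) (halfs G) (halfs K)"
    using sgraph_isoD(1,2)[OF assms(1)] sgraph_isoD(1,2)[OF assms(2)] bij_betw_trans by blast+
  have h: "k e \<in> halfs H" if "e \<in> halfs G" for e
    using sgraph_iso_halfs[OF assms(1)] that by simp
  fix e assume e: "e \<in> halfs G"
  show "bd K ((k' \<circ> k) e) = (f' \<circ> f) (bd G e)" "invol K ((k' \<circ> k) e) = (k' \<circ> k) (invol G e)"
    "htype K ((k' \<circ> k) e) = htype G e"
    using sgraph_isoD(3-5)[OF assms(1) e] sgraph_isoD(3-5)[OF assms(2) h[OF e]] by simp_all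
next
  fix v assume "v \<in> verts G"
  then show "vindex K ((f' \<circ> f) v) = vindex G v"
    using sgraph_isoD(6)[OF assms(1)] sgraph_isoD(6)[OF assms(2)] sgraph_iso_verts[OF assms(1)] by simp
next
  fix C assume C: "C \<in> pi0 G"
  then have "f ` C \<in> pi0 H" using pi0_image[OF assms(1,3,4)] by simp
  from sgraph_isoD(7)[OF assms(2) this] show "spec K ((f' \<circ> f) ` C) = spec G C"
    using sgraph_isoD(7)[OF assms(1) C] by (simp add: image_comp)
qed

lemma sgraph_iso_sym:
  assumes "sgraph_iso f k G H" "feynman_graph G" "feynman_graph H"
  shows "sgraph_iso (inv_into (verts G) f) (inv_into (halfs G) k) H G"
  unfolding sgraph_iso_def
proof (intro conjI ballI)
  show "bij_betw (inv_into (verts G) f) (verts H) (verts G)"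
    "bij_betw (inv_into (halfs G) k) (halfs H) (halfs G)"
    using sgraph_isoD(1,2)[OF assms(1)] bij_betw_inv_into by blast+
  have f: "inv_into (verts G) f (f v) = v" if "v \<in> verts G" for v
    using inv_into_f_f[OF sgraph_iso_inj_verts[OF assms(1)] that] .
  have k: "inv_into (halfs G) k (k e) = e" if "e \<in> halfs G" for e
    using inv_into_f_f[OF sgraph_iso_inj[OF assms(1)] that] .
  fix e assume "e \<in> halfs H"
  then obtain e' where e: "e' \<in> halfs G" "e = k e'" using sgraph_iso_halfs[OF assms(1)] by auto
  show "bd G (inv_into (halfs G) k e) = inv_into (verts G) f (bd H e)"
    "invol G (inv_into (halfs G) k e) = inv_into (halfs G) k (invol H e)"
    "htype G (inv_into (halfs G) k e) = htype H e"
    using sgraph_isoD(3-5)[OF assms(1) e(1)] e k f feynman_graphD(3,4)[OF assms(2)] by simp_all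
next
  fix v assume "v \<in> verts H"
  then obtain v' where "v' \<in> verts G" "v = f v'" using sgraph_iso_verts[OF assms(1)] by auto
  then show "vindex G (inv_into (verts G) f v) = vindex H v"
    using sgraph_isoD(6)[OF assms(1)] inv_into_f_f[OF sgraph_iso_inj_verts[OF assms(1)]] by simp
next
  fix C assume "C \<in> pi0 H"
  then obtain C' where C: "C' \<in> pi0 G" "C = f ` C'" using pi0_image[OF assms] by auto
  then have "inv_into (verts G) f ` C = C'"
    using inv_into_image_cancel[OF sgraph_iso_inj_verts[OF assms(1)] pi0_subset[OF assms(2)]] by blast
  then show "spec G (inv_into (verts G) f ` C) = spec H C"
    using sgraph_isoD(7)[OF assms(1)] C by simp
qed

lemma external_image:
  assumes "sgraph_iso f k G H" "feynman_graph G"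
  shows "external H = k ` external G"
proof -
  have "k (invol G e) = k e \<longleftrightarrow> invol G e = e" if "e \<in> halfs G" for e
    using inj_on_eq_iff[OF sgraph_iso_inj[OF assms(1)]] that feynman_graphD(4)[OF assms(2)] by simp
  then show ?thesis
    unfolding external_def sgraph_iso_halfs[OF assms(1)] using sgraph_isoD(4)[OF assms(1)] by auto
qed

lemma image_mset_image:
  assumes "inj_on k A" "\<And>e. e \<in> A \<Longrightarrow> h' (k e) = h e"
  shows "image_mset h' (mset_set (k ` A)) = image_mset h (mset_set A)"
proof (cases "finite A")
  case True
  have "image_mset h' (mset_set (k ` A)) = image_mset (h' \<circ> k) (mset_set A)"
    using image_mset_mset_set[OF assms(1)] by (metis multiset.map_comp)
  also have "\<dots> = image_mset h (mset_set A)"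
    by (rule image_mset_cong) (use assms(2) True in auto)
  finally show ?thesis .
qed (use assms(1) in \<open>simp add: finite_image_iff\<close>)

lemma vertex_legs_image:
  assumes "sgraph_iso f k G H" "feynman_graph G" "v \<in> verts G"
  shows "vertex_legs H (f v) = vertex_legs G v"
proof -
  have "{e \<in> halfs H. bd H e = f v} = k ` {e \<in> halfs G. bd G e = v}"
    using sgraph_isoD(3)[OF assms(1)] inj_on_eq_iff[OF sgraph_iso_inj_verts[OF assms(1)]]
      feynman_graphD(3)[OF assms(2)] assms(3) sgraph_iso_halfs[OF assms(1)] by auto
  moreover have "inj_on k {e \<in> halfs G. bd G e = v}"
    using sgraph_iso_inj[OF assms(1)] by (rule inj_on_subset) auto
  ultimately show ?thesis
    unfolding vertex_legs_def using sgraph_isoD(5)[OF assms(1)] by (auto intro: image_mset_image)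
qed

lemma residue_legs_image:
  assumes "sgraph_iso f k G H" "feynman_graph G" "C \<subseteq> verts G"
  shows "residue_legs H (f ` C) = residue_legs G C"
proof -
  have "{e \<in> external H. bd H e \<in> f ` C} = k ` {e \<in> external G. bd G e \<in> C}"
  proof -
    have "f (bd G e) \<in> f ` C \<longleftrightarrow> bd G e \<in> C" if "e \<in> external G" for e
      using inj_on_image_mem_iff[OF sgraph_iso_inj_verts[OF assms(1)] _ assms(3)] that
        feynman_graphD(3)[OF assms(2)] by (simp add: external_def)
    then have "{e \<in> external G. bd H (k e) \<in> f ` C} = {e \<in> external G. bd G e \<in> C}"
      using sgraph_isoD(3)[OF assms(1)] by (intro Collect_cong) (simp add: external_def cong: conj_cong)
    then show ?thesis unfolding external_image[OF assms(1,2)] by blast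
  qed
  moreover have "inj_on k {e \<in> external G. bd G e \<in> C}"
    using sgraph_iso_inj[OF assms(1)] by (rule inj_on_subset) (auto simp: external_def)
  ultimately show ?thesis
    unfolding residue_legs_def using sgraph_isoD(5)[OF assms(1)]
    by (auto intro: image_mset_image simp: external_def)
qed

text \<open>The cut graphs need not be isomorphic as specified graphs, since cutting may create
  components on which the specifications do not correspond. Hence connectivity alone is carried
  over.\<close>

lemma sgraph_iso_cut_edge:
  assumes I: "sgraph_iso f k G H" and "feynman_graph G" "e \<in> halfs G" "(u, v) \<in> reach (cut_edge e G)"
  shows "(f u, f v) \<in> reach (cut_edge (k e) H)"
proof (rule reach_hom[OF _ assms(4)])
  fix e' assume e': "e' \<in> halfs (cut_edge e G)"
  then have "k e' \<in> halfs (cut_edge (k e) H)" using sgraph_iso_halfs[OF I] by simp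
  from reach_edge[OF this]
  show "(f (bd (cut_edge e G) e'), f (bd (cut_edge e G) (invol (cut_edge e G) e'))) \<in> reach (cut_edge (k e) H)"
    using e' assms(2,3) sgraph_isoD(3,4)[OF I] feynman_graphD(4)[OF assms(2)]
      inj_on_eq_iff[OF sgraph_iso_inj[OF I]] by (auto split: if_splits)
qed

lemma locally_one_PI_iso:
  assumes I: "sgraph_iso f k G H" and G: "feynman_graph G" and H: "feynman_graph H"
    and "locally_one_PI G"
  shows "locally_one_PI H"
  unfolding locally_one_PI_iff[OF H]
proof
  fix e' assume "e' \<in> halfs H"
  then obtain e where e: "e \<in> halfs G" "e' = k e" using sgraph_iso_halfs[OF I] by auto
  then have "(bd G e, bd G (invol G e)) \<in> reach (cut_edge e G)"
    using assms(4) unfolding locally_one_PI_iff[OF G] by blast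
  from sgraph_iso_cut_edge[OF I G e(1) this]
  show "(bd H e', bd H (invol H e')) \<in> reach (cut_edge e' H)"
    using e sgraph_isoD(3,4)[OF I] feynman_graphD(4)[OF G] by simp
qed

lemma isolated_image:
  assumes "sgraph_iso f k G H" "feynman_graph G" "v \<in> verts G"
    and "{e \<in> halfs H. bd H e = f v} \<subseteq> external H"
  shows "{e \<in> halfs G. bd G e = v} \<subseteq> external G"
proof
  fix e assume e: "e \<in> {e \<in> halfs G. bd G e = v}"
  then have "k e \<in> {e \<in> halfs H. bd H e = f v}"
    using sgraph_isoD(3)[OF assms(1)] sgraph_iso_halfs[OF assms(1)] by auto
  then have "k e \<in> k ` external G" using assms(4) external_image[OF assms(1,2)] by auto
  then show "e \<in> external G"
    using e inj_on_image_mem_iff[OF sgraph_iso_inj[OF assms(1)], of e "external G"]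
    by (auto simp: external_def)
qed

section \<open>Transport of specifications along isomorphisms\<close>

lemma specified_graphD:
  assumes "specified_graph T G"
  shows "feynman_graph G" "locally_one_PI G" "htype G ` halfs G \<subseteq> edge_types T"
    "\<And>v. v \<in> verts G \<Longrightarrow> (vertex_legs G v, vindex G v) \<in> vertex_types T"
    "dom (spec G) = pi0 G"
    "\<And>C. C \<in> pi0 G \<Longrightarrow> (residue_legs G C, the (spec G C)) \<in> vertex_types T"
    "\<And>v. v \<in> verts G \<Longrightarrow> {e \<in> halfs G. bd G e = v} \<subseteq> external G \<Longrightarrow> spec G {v} = Some (vindex G v)"
  using assms unfolding specified_graph_def by blast+

text \<open>An isomorphism says nothing about H outside its half-edges and components. The
  assumptions on H supply the normalisations there: the involution is the identity off the
  half-edges, and the specification is undefined off the components.\<close>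

lemma specified_graph_iso:
  assumes I: "sgraph_iso f k G H" and H: "feynman_graph H" "dom (spec H) = pi0 H"
    and S: "specified_graph T G"
  shows "specified_graph T H"
proof -
  note G = specified_graphD(1)[OF S]
  show ?thesis
    unfolding specified_graph_def
  proof (intro conjI ballI impI)
    show "feynman_graph H" "dom (spec H) = pi0 H" by (fact H)+
    show "locally_one_PI H" by (rule locally_one_PI_iso[OF I G H(1) specified_graphD(2)[OF S]])
    show "htype H ` halfs H \<subseteq> edge_types T"
      using specified_graphD(3)[OF S] sgraph_isoD(5)[OF I] sgraph_iso_halfs[OF I] by auto
  next
    fix v assume "v \<in> verts H"
    then obtain w where w: "w \<in> verts G" "v = f w" using sgraph_iso_verts[OF I] by auto
    then show "(vertex_legs H v, vindex H v) \<in> vertex_types T"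
      using specified_graphD(4)[OF S] vertex_legs_image[OF I G] sgraph_isoD(6)[OF I] by simp
    assume "{e \<in> halfs H. bd H e = v} \<subseteq> external H"
    then have ex: "{e \<in> halfs G. bd G e = w} \<subseteq> external G" using isolated_image[OF I G w(1)] w by simp
    then have sp: "spec G {w} = Some (vindex G w)" using specified_graphD(7)[OF S w(1)] by simp
    then have "{w} \<in> pi0 G" using specified_graphD(5)[OF S] by blast
    then show "spec H {v} = Some (vindex H v)"
      using sgraph_isoD(7)[OF I] sgraph_isoD(6)[OF I w(1)] w sp by fastforce
  next
    fix C assume "C \<in> pi0 H"
    then obtain D where D: "D \<in> pi0 G" "C = f ` D" using pi0_image[OF I G H(1)] by auto
    then show "(residue_legs H C, the (spec H C)) \<in> vertex_types T"
      using specified_graphD(6)[OF S] residue_legs_image[OF I G pi0_subset[OF G]] sgraph_isoD(7)[OF I]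
      by simp
  qed
qed

lemma covering_subgraphD:
  assumes "covering_subgraph g G"
  shows "verts g = verts G" "halfs g = halfs G" "bd g = bd G" "htype g = htype G" "vindex g = vindex G"
    "\<And>e. invol g e = e \<or> invol g e = invol G e" "g = G\<lparr>invol := invol g, spec := spec g\<rparr>"
proof -
  have g: "g = G\<lparr>invol := invol g, spec := spec g\<rparr>"
    using assms unfolding covering_subgraph_def by blast
  show "verts g = verts G" by (subst g) simp
  show "halfs g = halfs G" by (subst g) simp
  show "bd g = bd G" by (subst g) simp
  show "htype g = htype G" by (subst g) simp
  show "vindex g = vindex G" by (subst g) simp
  show "g = G\<lparr>invol := invol g, spec := spec g\<rparr>" by (fact g)
qed (use assms in \<open>auto simp: covering_subgraph_def\<close>)

lemma covering_subgraphI: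
  assumes "verts g = verts G" "halfs g = halfs G" "bd g = bd G" "htype g = htype G" "vindex g = vindex G"
    "\<And>e. invol g e = e \<or> invol g e = invol G e"
  shows "covering_subgraph g G"
  unfolding covering_subgraph_def using assms by simp

lemma feynman_covering:
  assumes "feynman_graph G" "covering_subgraph g G" "\<And>e. e \<in> halfs G \<Longrightarrow> invol g (invol g e) = e"
  shows "feynman_graph g"
  unfolding feynman_graph_def
  using feynman_graphD[OF assms(1)] covering_subgraphD[OF assms(2)] assms(3)
  by (auto; metis)

lemma specified_subgraphD:
  assumes "specified_subgraph g G"
  shows "covering_subgraph g G"
    "\<And>C. C \<in> pi0 g \<Longrightarrow> C \<in> pi0 G \<Longrightarrow> (\<And>e. e \<in> halfs G \<Longrightarrow> bd G e \<in> C \<Longrightarrow> invol g e = invol G e)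
       \<Longrightarrow> spec g C = spec G C"
  using assms unfolding specified_subgraph_def by blast+

text \<open>The covering relation is an equality of records up to involution and specification, and
  thus concerns values that no isomorphism controls; it is assumed for h and H. What is transported
  is the agreement of specifications on common components.\<close>

lemma specified_subgraph_iso:
  assumes IG: "sgraph_iso f k G H" and Ig: "sgraph_iso f k g h"
    and fey: "feynman_graph G" "feynman_graph g" "feynman_graph H" "feynman_graph h"
    and c: "covering_subgraph h H" and s: "specified_subgraph g G"
  shows "specified_subgraph h H"
proof -
  note cov = covering_subgraphD[OF specified_subgraphD(1)[OF s]]
  have "spec h C = spec H C"
    if C: "C \<in> pi0 h" "C \<in> pi0 H" and e: "\<And>e. e \<in> halfs H \<Longrightarrow> bd H e \<in> C \<Longrightarrow> invol h e = invol H e" for C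
  proof -
    \<comment> \<open>A common component has one preimage in g and one in G; injectivity of f on the
      shared vertices identifies them.\<close>
    from C obtain D D' where D: "D \<in> pi0 g" "D' \<in> pi0 G" "C = f ` D" "C = f ` D'"
      using pi0_image[OF IG fey(1,3)] pi0_image[OF Ig fey(2,4)] by auto
    have "D \<subseteq> verts G" "D' \<subseteq> verts G"
      using pi0_subset[OF fey(2) D(1)] pi0_subset[OF fey(1) D(2)] cov by auto
    then have "D' = D" using D inj_on_image_eq_iff[OF sgraph_iso_inj_verts[OF IG]] by metis
    have "invol g x = invol G x" if x: "x \<in> halfs G" "bd G x \<in> D" for x
    proof -
      have "bd H (k x) \<in> C" "k x \<in> halfs H"
        using x D(3) sgraph_isoD(3)[OF IG] sgraph_iso_halfs[OF IG] by auto
      then have "k (invol g x) = k (invol G x)"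
        using e sgraph_isoD(4)[OF IG x(1)] sgraph_isoD(4)[OF Ig, of x] x cov(2) by metis
      then show ?thesis
        using inj_on_eq_iff[OF sgraph_iso_inj[OF IG], of "invol g x" "invol G x"] x(1)
          feynman_graphD(4)[OF fey(1)] feynman_graphD(4)[OF fey(2)] cov(2) by simp
    qed
    then have "spec g D = spec G D" using specified_subgraphD(2)[OF s] D \<open>D' = D\<close> by blast
    then show ?thesis using sgraph_isoD(7)[OF IG D(2)] sgraph_isoD(7)[OF Ig D(1)] D \<open>D' = D\<close> by simp
  qed
  then show ?thesis unfolding specified_subgraph_def using c by blast
qed

subsection \<open>Relabelling\<close>

text \<open>Off the image the involution is the identity and the specification is undefined, so that
  the result again satisfies the normalisations of the involution and of the domain of the
  specification.\<close>

definition relabel :: "('v \<Rightarrow> 'w) \<Rightarrow> ('h \<Rightarrow> 'g) \<Rightarrow> ('v, 'h, 't) sgraph \<Rightarrow> ('w, 'g, 't) sgraph" where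
  "relabel f k G = (let f' = inv_into (verts G) f; k' = inv_into (halfs G) k in
     \<lparr>verts = f ` verts G, halfs = k ` halfs G, bd = (\<lambda>e. f (bd G (k' e))),
      invol = (\<lambda>e. if e \<in> k ` halfs G then k (invol G (k' e)) else e),
      htype = (\<lambda>e. htype G (k' e)), vindex = (\<lambda>v. vindex G (f' v)),
      spec = (\<lambda>C. if C \<subseteq> f ` verts G then spec G (f' ` C) else None)\<rparr>)"

lemma relabel_simps [simp]:
  "verts (relabel f k G) = f ` verts G" "halfs (relabel f k G) = k ` halfs G"
  by (simp_all add: relabel_def Let_def)

lemma relabel:
  assumes G: "feynman_graph G" and f: "inj_on f (verts G)" and k: "inj_on k (halfs G)"
  shows "sgraph_iso f k G (relabel f k G)"
    and "feynman_graph (relabel f k G)"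
proof -
  note inv = inv_into_f_f[OF f] inv_into_f_f[OF k]
  show "sgraph_iso f k G (relabel f k G)"
    unfolding sgraph_iso_def relabel_def Let_def using f k
    by (auto simp: bij_betw_def inv inv_into_image_cancel[OF f] pi0_subset[OF G] image_mono)
  show "feynman_graph (relabel f k G)"
    unfolding feynman_graph_def relabel_def Let_def using feynman_graphD[OF G]
    by (auto simp: inv)
qed

lemma dom_spec_relabel:
  assumes G: "feynman_graph G" and f: "inj_on f (verts G)" and k: "inj_on k (halfs G)"
    and d: "dom (spec G) = pi0 G"
  shows "dom (spec (relabel f k G)) = pi0 (relabel f k G)"
proof -
  have "C \<in> dom (spec (relabel f k G)) \<longleftrightarrow> C \<subseteq> f ` verts G \<and> inv_into (verts G) f ` C \<in> pi0 G" for C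
    unfolding d[symmetric] dom_def by (simp add: relabel_def Let_def)
  moreover have "C \<subseteq> f ` verts G \<and> inv_into (verts G) f ` C \<in> pi0 G \<longleftrightarrow> C \<in> (`) f ` pi0 G" for C
  proof
    assume "C \<subseteq> f ` verts G \<and> inv_into (verts G) f ` C \<in> pi0 G"
    then show "C \<in> (`) f ` pi0 G" using image_inv_into_cancel[of f "verts G" _ C] by (metis image_eqI)
  next
    assume "C \<in> (`) f ` pi0 G"
    then obtain D where "D \<in> pi0 G" "C = f ` D" by auto
    then show "C \<subseteq> f ` verts G \<and> inv_into (verts G) f ` C \<in> pi0 G"
      using inv_into_image_cancel[OF f pi0_subset[OF G]] pi0_subset[OF G] by (simp add: image_mono)
  qed
  moreover have "(`) f ` pi0 G = pi0 (relabel f k G)"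
    by (rule pi0_image[OF relabel(1)[OF G f k] G relabel(2)[OF G f k], symmetric])
  ultimately show ?thesis by (metis set_eqI)
qed

text \<open>The inverse maps inside \<open>relabel\<close> are taken on the vertices and half-edges
  of the graph itself; g and G share these, so both are relabelled by the same inverses.\<close>

lemma covering_relabel:
  assumes "covering_subgraph g G"
  shows "covering_subgraph (relabel f k g) (relabel f k G)"
proof (rule covering_subgraphI)
  note c = covering_subgraphD[OF assms]
  fix e show "invol (relabel f k g) e = e \<or> invol (relabel f k g) e = invol (relabel f k G) e"
  proof (cases "e \<in> k ` halfs G")
    case True
    then have "k (inv_into (halfs G) k e) = e" by (rule f_inv_into_f)
    then show ?thesis using c(2) c(6)[of "inv_into (halfs G) k e"] by (auto simp: relabel_def Let_def)
  qed (simp add: relabel_def Let_def c(2))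
qed (simp_all add: relabel_def Let_def covering_subgraphD(1-5)[OF assms])


section \<open>Contraction\<close>

lemma contract_simps [simp]:
  "verts (contract G d) = pi0 d" "halfs (contract G d) = external d"
  "bd (contract G d) = (\<lambda>e. component_of d (bd d e))" "htype (contract G d) = htype d"
  "invol (contract G d) = (\<lambda>e. if e \<in> external d then invol G e else e)"
  "vindex (contract G d) = (\<lambda>C. the (spec d C))"
  by (simp_all add: contract_def)

text \<open>That d is a graph is a separate assumption, since the covering relation decides
  half-edge by half-edge and would allow one half of an edge to be cut without the other. No
  condition is imposed on specifications.\<close>

locale covering =
  fixes G d :: "('v, 'h, 't) sgraph"
  assumes feynman: "feynman_graph G" and feynman_sub: "feynman_graph d"
    and cov: "covering_subgraph d G"
begin

lemma sub_simps [simp]: "verts d = verts G" "halfs d = halfs G" "bd d = bd G" "htype d = htype G"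
  "vindex d = vindex G"
  using covering_subgraphD[OF cov] by blast+

lemma invol_sub: "invol d e = e \<or> invol d e = invol G e"
  using covering_subgraphD(6)[OF cov] .

lemma invol_sub_neq: "invol d e \<noteq> e \<Longrightarrow> invol d e = invol G e"
  using invol_sub by blast

lemma reach_sub: "(u, v) \<in> reach d \<Longrightarrow> (u, v) \<in> reach G"
proof (rule reach_hom[where G = d and \<phi> = "\<lambda>x. x"])
  fix e assume "e \<in> halfs d"
  then show "(bd d e, bd d (invol d e)) \<in> reach G"
    using invol_sub[of e] reach_edge[of e G] by auto
qed

lemma component_of_sub: "component_of d v \<subseteq> component_of G v"
  using reach_sub by (auto simp: mem_component_of)

lemma external_sub: "external G \<subseteq> external d"
  using invol_sub unfolding external_def by fastforce

text \<open>Both involutions being involutive, an edge is cut as a whole. This is what makes the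
  involution of G preserve \<open>external d\<close>, so that the quotient is a graph.\<close>

lemma invol_external: "e \<in> external d \<Longrightarrow> invol G e \<in> external d"
  using invol_sub[of "invol G e"] feynman_graphD(4,5)[OF feynman] feynman_graphD(5)[OF feynman_sub]
  unfolding external_def by (simp; metis)

lemma invol_not_external: "e \<in> halfs G \<Longrightarrow> e \<notin> external d \<Longrightarrow> invol d e = invol G e"
  using invol_sub_neq[of e] unfolding external_def by auto

lemma external_contract: "external (contract G d) = external G"
  using external_sub unfolding external_def[of "contract G d"] by (auto simp: external_def)

lemma component_of_sub_eq: "component_of d u = component_of d v \<longleftrightarrow> (u, v) \<in> reach d"
  by (rule component_of_eq_iff[OF feynman_sub])

lemma finite_external: "finite (external d)"
  using feynman_graphD(2)[OF feynman] unfolding external_def by auto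

lemma feynman_contract: "feynman_graph (contract G d)"
  unfolding feynman_graph_def
  using finite_pi0[OF feynman_sub] finite_external invol_external feynman_graphD[OF feynman]
  by (auto simp: external_def)

lemma reach_contract:
  assumes "u \<in> verts G" "v \<in> verts G"
  shows "(component_of d u, component_of d v) \<in> reach (contract G d) \<longleftrightarrow> (u, v) \<in> reach G"
proof
  \<comment> \<open>A representative of each component. The ends in G of an edge of the quotient are
    joined inside d to the representatives, so the edge lifts to itself together with two paths in
    d.\<close>
  define \<phi> where "\<phi> B = (SOME x. x \<in> B)" for B :: "'v set"
  have \<phi>: "(\<phi> (component_of d x), x) \<in> reach d" for x
  proof -
    have "\<phi> (component_of d x) \<in> component_of d x"
      unfolding \<phi>_def by (rule someI[of _ x]) simp
    then show ?thesis using reach_sym[OF feynman_sub] by (simp add: mem_component_of)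
  qed
  assume "(component_of d u, component_of d v) \<in> reach (contract G d)"
  then have "(\<phi> (component_of d u), \<phi> (component_of d v)) \<in> reach G"
  proof (rule reach_hom[where G = "contract G d" and \<phi> = \<phi>, rotated])
    fix e assume e: "e \<in> halfs (contract G d)"
    then have "e \<in> halfs G" by (simp add: external_def)
    from reach_edge[OF this]
    show "(\<phi> (bd (contract G d) e), \<phi> (bd (contract G d) (invol (contract G d) e))) \<in> reach G"
      using e reach_trans[OF reach_sub[OF \<phi>]] reach_trans[OF _ reach_sym[OF feynman reach_sub[OF \<phi>]]]
      by simp
  qed
  from reach_trans[OF reach_trans[OF reach_sym[OF feynman reach_sub[OF \<phi>[of u]]] this] reach_sub[OF \<phi>[of v]]]
  show "(u, v) \<in> reach G" .
next
  assume "(u, v) \<in> reach G"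
  then show "(component_of d u, component_of d v) \<in> reach (contract G d)"
  proof (rule reach_hom[where G = G and \<phi> = "component_of d", rotated])
    fix e assume e: "e \<in> halfs G"
    show "(component_of d (bd G e), component_of d (bd G (invol G e))) \<in> reach (contract G d)"
    \<comment> \<open>A half-edge external in d survives in the quotient; one that belongs to an
      edge of d has both ends in the same component, and the edge collapses to a point.\<close>
    proof (cases "e \<in> external d")
      case True
      then show ?thesis using reach_edge[of e "contract G d"] by simp
    next
      case False
      then have "component_of d (bd G e) = component_of d (bd G (invol G e))"
        using reach_edge[of e d] e invol_not_external unfolding component_of_sub_eq by simp
      then show ?thesis by simp
    qed
  qed
qed

lemma component_of_contract:
  assumes "v \<in> verts G"
  shows "component_of (contract G d) (component_of d v) = component_of d ` component_of G v"
proof (intro set_eqI iffI)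
  fix B assume "B \<in> component_of (contract G d) (component_of d v)"
  then have r: "(component_of d v, B) \<in> reach (contract G d)" by (simp add: mem_component_of)
  then have "B \<in> pi0 d" using reach_verts[OF feynman_contract r] assms by simp
  then obtain w where w: "w \<in> verts G" "B = component_of d w" unfolding pi0_def by auto
  then show "B \<in> component_of d ` component_of G v"
    using r reach_contract[OF assms] by (auto simp: mem_component_of)
next
  fix B assume "B \<in> component_of d ` component_of G v"
  then obtain w where w: "(v, w) \<in> reach G" "B = component_of d w" by (auto simp: mem_component_of)
  then show "B \<in> component_of (contract G d) (component_of d v)"
    using reach_contract[OF assms reach_verts[OF feynman w(1) assms]] by (simp add: mem_component_of)
qed

lemma pi0_contract: "pi0 (contract G d) = (`) (component_of d) ` pi0 G"
proof -
  have "pi0 (contract G d) = (\<lambda>v. component_of (contract G d) (component_of d v)) ` verts G"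
    by (simp add: pi0_def[of "contract G d"] pi0_def[of d] image_image)
  also have "\<dots> = (\<lambda>v. component_of d ` component_of G v) ` verts G"
    by (rule image_cong[OF refl component_of_contract])
  finally show ?thesis by (simp add: pi0_def[of G] image_image)
qed

lemma Union_component_of: "\<Union>(component_of d ` component_of G v) = component_of G v"
proof
  show "\<Union>(component_of d ` component_of G v) \<subseteq> component_of G v"
    by (auto simp: mem_component_of intro: reach_trans[OF _ reach_sub])
  show "component_of G v \<subseteq> \<Union>(component_of d ` component_of G v)"
  proof
    fix x assume "x \<in> component_of G v"
    then show "x \<in> \<Union>(component_of d ` component_of G v)" by (rule UN_I) simp
  qed
qed

lemma Union_quotient: "C \<in> pi0 G \<Longrightarrow> \<Union>(component_of d ` C) = C"
  using Union_component_of unfolding pi0_def by (metis (no_types, lifting) imageE)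

lemma quotient_subset: "C \<in> pi0 G \<Longrightarrow> component_of d ` C \<subseteq> pi0 d"
  using pi0_subset[OF feynman] component_of_in_pi0[of _ d] by (auto simp: subset_iff)

text \<open>Hence taking unions inverts the passage from a component of G to the set of components
  of d inside it; this is how \<open>contract\<close> reads off the specification of the quotient
  from that of G.\<close>

lemma quotient_unique:
  assumes "K \<subseteq> pi0 d" shows "K = component_of d ` \<Union>K"
proof -
  have "B = component_of d v" if "B \<in> K" "v \<in> B" for B v
    using that assms pi0_eq[OF feynman_sub] by blast
  moreover have "B \<noteq> {}" if "B \<in> K" for B using that assms pi0_nonempty by blast
  ultimately show ?thesis by (auto simp: image_iff) (metis ex_in_conv)
qed

lemma mem_quotient:
  assumes "C \<in> pi0 G" "v \<in> verts G"
  shows "component_of d v \<in> component_of d ` C \<longleftrightarrow> v \<in> C"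
  using Union_quotient[OF assms(1)] component_of_self[of v d] by blast

lemma spec_contract: "C \<in> pi0 G \<Longrightarrow> spec (contract G d) (component_of d ` C) = spec G C"
  using Union_quotient quotient_subset by (simp add: contract_def)

lemma dom_spec_contract:
  assumes "dom (spec G) = pi0 G" shows "dom (spec (contract G d)) = pi0 (contract G d)"
proof -
  have "K \<in> dom (spec (contract G d)) \<longleftrightarrow> K \<subseteq> pi0 d \<and> \<Union>K \<in> pi0 G" for K
    unfolding assms[symmetric] dom_def by (simp add: contract_def)
  moreover have "K \<subseteq> pi0 d \<and> \<Union>K \<in> pi0 G \<longleftrightarrow> K \<in> (`) (component_of d) ` pi0 G" for K
  proof
    assume "K \<subseteq> pi0 d \<and> \<Union>K \<in> pi0 G"
    then show "K \<in> (`) (component_of d) ` pi0 G"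
      using rev_image_eqI[of "\<Union>K" "pi0 G" K "(`) (component_of d)"] quotient_unique[of K] by blast
  next
    assume "K \<in> (`) (component_of d) ` pi0 G"
    then obtain C where C: "C \<in> pi0 G" "K = component_of d ` C" by (rule imageE)
    then show "K \<subseteq> pi0 d \<and> \<Union>K \<in> pi0 G"
      using quotient_subset[OF C(1)] Union_quotient[OF C(1)] by simp
  qed
  ultimately have "K \<in> dom (spec (contract G d)) \<longleftrightarrow> K \<in> (`) (component_of d) ` pi0 G" for K
    by (rule trans)
  then show ?thesis unfolding pi0_contract by (rule set_eqI)
qed

text \<open>Together with \<open>residue_legs_contract\<close> this is why superficial divergence
  passes to the quotient: its vertices are the residues of the components of d, and its components
  have the residues of those of G.\<close>

lemma vertex_legs_contract:
  assumes "B \<in> pi0 d" shows "vertex_legs (contract G d) B = residue_legs d B"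
proof -
  have "component_of d (bd G e) = B \<longleftrightarrow> bd G e \<in> B" for e
    using pi0_eq[OF feynman_sub assms, of "bd G e"] component_of_self[of "bd G e" d] by blast
  then show ?thesis unfolding vertex_legs_def residue_legs_def by simp
qed

lemma residue_legs_contract:
  assumes "C \<in> pi0 G" shows "residue_legs (contract G d) (component_of d ` C) = residue_legs G C"
proof -
  have "{e \<in> external G. component_of d (bd G e) \<in> component_of d ` C} = {e \<in> external G. bd G e \<in> C}"
    using mem_quotient[OF assms] feynman_graphD(3)[OF feynman] by (auto simp: external_def)
  then show ?thesis unfolding residue_legs_def external_contract by simp
qed

text \<open>An edge that survives in the quotient is already cut in d, so d remains a subgraph when
  this edge is cut in G. Hence cutting and contracting commute, and \<open>reach_contract\<close>
  applies to the cut graph.\<close>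

lemma covering_cut_edge:
  assumes "e \<in> external d" shows "covering (cut_edge e G) d"
proof
  show "covering_subgraph d (cut_edge e G)"
  proof (rule covering_subgraphI)
    have "invol d e = e" "invol d (invol G e) = invol G e"
      using assms invol_external[OF assms] by (auto simp: external_def)
    then show "invol d e' = e' \<or> invol d e' = invol (cut_edge e G) e'" for e'
      using invol_sub[of e'] by auto
  qed simp_all
qed (rule feynman_cut_edge[OF feynman] feynman_sub)+

lemma contract_cut_edge:
  assumes "e \<in> external d" shows "contract (cut_edge e G) d = cut_edge e (contract G d)"
proof -
  have "(\<lambda>e'. if e' \<in> external d then ((invol G)(e := e, invol G e := invol G e)) e' else e') =
    (\<lambda>e'. if e' \<in> external d then invol G e' else e')(e := e, invol G e := invol G e)"
    using assms invol_external[OF assms] by auto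
  then show ?thesis using assms unfolding contract_def cut_edge_def by (simp cong: if_cong)
qed

lemma reach_cut_edge_contract:
  assumes "e \<in> external d" "u \<in> verts G" "v \<in> verts G"
  shows "(component_of d u, component_of d v) \<in> reach (cut_edge e (contract G d)) \<longleftrightarrow>
    (u, v) \<in> reach (cut_edge e G)"
  unfolding contract_cut_edge[OF assms(1), symmetric]
  by (rule covering.reach_contract[OF covering_cut_edge[OF assms(1)]]) (simp_all add: assms)

text \<open>The quotient satisfies the same edge condition as G, tested only on the half-edges that
  d leaves external. The inheritance results in both directions are read off from this.\<close>

lemma locally_one_PI_contract_iff:
  "locally_one_PI (contract G d) \<longleftrightarrow> (\<forall>e\<in>external d. (bd G e, bd G (invol G e)) \<in> reach (cut_edge e G))"
proof -
  have "bd G e \<in> verts G" "bd G (invol G e) \<in> verts G" if "e \<in> external d" for e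
    using that feynman_graphD(3,4)[OF feynman] by (auto simp: external_def)
  then have "(component_of d (bd G e), component_of d (bd G (invol G e))) \<in> reach (cut_edge e (contract G d))
      \<longleftrightarrow> (bd G e, bd G (invol G e)) \<in> reach (cut_edge e G)" if "e \<in> external d" for e
    using reach_cut_edge_contract that by blast
  then show ?thesis unfolding locally_one_PI_iff[OF feynman_contract] by simp
qed

lemma locally_one_PI_contract:
  assumes "locally_one_PI G" shows "locally_one_PI (contract G d)"
  using assms unfolding locally_one_PI_contract_iff locally_one_PI_iff[OF feynman]
  by (simp add: external_def)

text \<open>An edge outside d is tested in the quotient. An edge of d has a detour already in d, and
  this detour lies in G with the edge cut.\<close>

lemma locally_one_PI_if_contract:
  assumes "locally_one_PI d" "locally_one_PI (contract G d)" shows "locally_one_PI G"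
  unfolding locally_one_PI_iff[OF feynman]
proof
  fix e assume e: "e \<in> halfs G"
  show "(bd G e, bd G (invol G e)) \<in> reach (cut_edge e G)"
  proof (cases "e \<in> external d")
    case True
    then show ?thesis using assms(2) unfolding locally_one_PI_contract_iff by blast
  next
    case False
    have "(bd d e, bd d (invol d e)) \<in> reach (cut_edge e d)"
      using assms(1) e unfolding locally_one_PI_iff[OF feynman_sub] by simp
    then have r: "(bd G e, bd G (invol G e)) \<in> reach (cut_edge e d)"
      using invol_not_external[OF e False] by simp
    have "covering_subgraph (cut_edge e d) (cut_edge e G)"
      by (rule covering_subgraphI) (use invol_sub invol_not_external[OF e False] in auto)
    then interpret cut: covering "cut_edge e G" "cut_edge e d"
      by unfold_locales (rule feynman_cut_edge[OF feynman] feynman_cut_edge[OF feynman_sub])+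
    show ?thesis by (rule cut.reach_sub[OF r])
  qed
qed

text \<open>If every half-edge at B that d leaves external is external in G too, no edge of G leaves
  B. In the quotient this says that a vertex without internal edges is a component which d and G
  share with all its edges, exactly the case in which \<open>specified_subgraph\<close> compares
  specifications.\<close>

lemma component_not_external:
  assumes "B \<in> pi0 d" "\<And>e. e \<in> external d \<Longrightarrow> bd G e \<in> B \<Longrightarrow> invol G e = e"
  shows "B \<in> pi0 G" "\<And>e. e \<in> halfs G \<Longrightarrow> bd G e \<in> B \<Longrightarrow> invol d e = invol G e"
proof -
  show inv: "invol d e = invol G e" if "e \<in> halfs G" "bd G e \<in> B" for e
    using that assms(2) invol_not_external by (cases "e \<in> external d") (auto simp: external_def)
  obtain v where v: "v \<in> verts G" "B = component_of d v" using assms(1) unfolding pi0_def by auto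
  have "bd G (invol G e) \<in> B" if "e \<in> halfs G" "bd G e \<in> B" for e
    using pi0_closed[OF feynman_sub assms(1), of e] inv that by simp
  then have "component_of G v \<subseteq> B"
    using reach_closed[of G B v] v by (auto simp: mem_component_of)
  then have "B = component_of G v" using component_of_sub[of v] v(2) by blast
  then show "B \<in> pi0 G" using v(1) by simp
qed

end

section \<open>Specified subgraphs and their quotients\<close>

lemma covering_trans:
  assumes "covering_subgraph d g" "covering_subgraph g G" shows "covering_subgraph d G"
proof (rule covering_subgraphI)
  show "invol d e = e \<or> invol d e = invol G e" for e
    using covering_subgraphD(6)[OF assms(1), of e] covering_subgraphD(6)[OF assms(2), of e] by metis
qed (use covering_subgraphD(1-5)[OF assms(1)] covering_subgraphD(1-5)[OF assms(2)] in simp_all)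

lemma coveringI:
  "feynman_graph G \<Longrightarrow> feynman_graph d \<Longrightarrow> covering_subgraph d G \<Longrightarrow> covering G d"
  by (simp add: covering.intro)

lemma specified_contract:
  assumes "specified_graph T G" "specified_graph T d" "specified_subgraph d G"
  shows "specified_graph T (contract G d)"
proof -
  interpret covering G d
    using assms specified_graphD(1) specified_subgraphD(1) by (blast intro: coveringI)
  note SG = specified_graphD[OF assms(1)] and Sd = specified_graphD[OF assms(2)]
  show ?thesis
    unfolding specified_graph_def
  proof (intro conjI ballI impI)
    show "feynman_graph (contract G d)" by (rule feynman_contract)
    show "locally_one_PI (contract G d)" by (rule locally_one_PI_contract[OF SG(2)])
    show "htype (contract G d) ` halfs (contract G d) \<subseteq> edge_types T"
      using SG(3) by (auto simp: external_def)
    show "dom (spec (contract G d)) = pi0 (contract G d)" by (rule dom_spec_contract[OF SG(5)])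
  next
    fix B assume "B \<in> verts (contract G d)"
    then have B: "B \<in> pi0 d" by simp
    then show "(vertex_legs (contract G d) B, vindex (contract G d) B) \<in> vertex_types T"
      using Sd(6) by (simp add: vertex_legs_contract)
    \<comment> \<open>The vertex B takes its index from d, while the component it forms in the
      quotient takes its specification from G. B is a component of both graphs with the same edges,
      so the subgraph condition equates the two.\<close>
    assume "{e \<in> halfs (contract G d). bd (contract G d) e = B} \<subseteq> external (contract G d)"
    then have "invol G e = e" if "e \<in> external d" "bd G e \<in> B" for e
      using that pi0_eq[OF feynman_sub B] unfolding external_contract by (auto simp: external_def)
    from component_not_external[OF B this] have BG: "B \<in> pi0 G"
      and "\<And>e. e \<in> halfs G \<Longrightarrow> bd G e \<in> B \<Longrightarrow> invol d e = invol G e" by blast+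
    then have eq: "spec d B = spec G B" using specified_subgraphD(2)[OF assms(3) B] by blast
    have "spec (contract G d) {B} = spec G B" using B by (simp add: contract_def)
    moreover have "spec d B \<noteq> None" using Sd(5) B by blast
    ultimately show "spec (contract G d) {B} = Some (vindex (contract G d) B)"
      using eq by simp
  next
    fix K assume "K \<in> pi0 (contract G d)"
    then obtain C where "C \<in> pi0 G" "K = component_of d ` C" unfolding pi0_contract by blast
    then show "(residue_legs (contract G d) K, the (spec (contract G d) K)) \<in> vertex_types T"
      using SG(6) residue_legs_contract spec_contract by simp
  qed
qed

lemma sub_specs_iff:
  assumes "specified_graph T g"
  shows "d \<in> sub_specs T g \<longleftrightarrow> specified_graph T d \<and> specified_subgraph d g"
  unfolding sub_specs_def using specified_contract[OF assms] by auto

lemma D_pair_iff: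
  "D_pair T (G, g) \<longleftrightarrow> specified_graph T G \<and> specified_graph T g \<and> specified_subgraph g G"
  unfolding D_pair_def using specified_contract by auto

text \<open>On a component that d and G share with all its edges, the involution of g lies between
  two equal ones. Hence C is a component of g as well, and the two subgraph conditions can be
  chained there.\<close>

lemma specified_subgraph_trans:
  assumes fey: "feynman_graph d" "feynman_graph g" "feynman_graph G"
    and dg: "specified_subgraph d g" and gG: "specified_subgraph g G"
  shows "specified_subgraph d G"
  unfolding specified_subgraph_def
proof (intro conjI ballI impI)
  show "covering_subgraph d G"
    using covering_trans specified_subgraphD(1)[OF dg] specified_subgraphD(1)[OF gG] by blast
  interpret dg: covering g d using fey(2,1) specified_subgraphD(1)[OF dg] by (rule coveringI)
  interpret gG: covering G g using fey(3,2) specified_subgraphD(1)[OF gG] by (rule coveringI)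
  fix C assume C: "C \<in> pi0 d \<inter> pi0 G" and e: "\<forall>e\<in>halfs G. bd G e \<in> C \<longrightarrow> invol d e = invol G e"
  have gGe: "invol g e = invol G e" and dge: "invol d e = invol g e" if "e \<in> halfs G" "bd G e \<in> C" for e
  proof -
    have "invol d e = invol G e" using e that by blast
    then show "invol g e = invol G e" "invol d e = invol g e"
      using dg.invol_sub[of e] gG.invol_sub[of e] by metis+
  qed
  have Cd: "C \<in> pi0 d" and CG: "C \<in> pi0 G" using C by blast+
  have Cg: "C \<in> pi0 g"
  proof (rule dg.component_not_external(1)[OF Cd])
    fix e assume "e \<in> external d" "bd g e \<in> C"
    then show "invol g e = e" using dge[of e] by (simp add: external_def)
  qed
  have "spec d C = spec g C" using specified_subgraphD(2)[OF dg Cd Cg] dge by simp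
  also have "\<dots> = spec G C" using specified_subgraphD(2)[OF gG Cg CG] gGe by simp
  finally show "spec d C = spec G C" .
qed

lemma pair_contract_covering:
  assumes "covering g d" "covering G g"
  shows "covering G d" "covering (contract G d) (contract g d)"
proof -
  interpret dg: covering g d by fact
  interpret gG: covering G g by fact
  show dG: "covering G d"
    by (intro coveringI gG.feynman dg.feynman_sub covering_trans[OF dg.cov gG.cov])
  then interpret dG: covering G d .
  show "covering (contract G d) (contract g d)"
  proof (intro coveringI dg.feynman_contract dG.feynman_contract covering_subgraphI)
    show "invol (contract g d) e = e \<or> invol (contract g d) e = invol (contract G d) e" for e
      using gG.invol_sub by simp
  qed simp_all
qed

text \<open>A common component of the two quotients has a single union, hence comes from a common
  component of g and G. The edges contained in d agree in g and G anyway, so agreement on the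
  surviving half-edges is enough.\<close>

lemma specified_subgraph_contract:
  assumes "covering g d" "covering G g" and s: "specified_subgraph g G"
  shows "specified_subgraph (contract g d) (contract G d)"
proof -
  interpret dg: covering g d by fact
  interpret gG: covering G g by fact
  interpret dG: covering G d by (rule pair_contract_covering[OF assms(1,2)])
  interpret q: covering "contract G d" "contract g d" by (rule pair_contract_covering[OF assms(1,2)])
  show ?thesis
    unfolding specified_subgraph_def
  proof (intro conjI ballI impI)
    show "covering_subgraph (contract g d) (contract G d)" by (rule q.cov)
    fix K assume K: "K \<in> pi0 (contract g d) \<inter> pi0 (contract G d)"
      and e: "\<forall>e\<in>halfs (contract G d). bd (contract G d) e \<in> K \<longrightarrow>
        invol (contract g d) e = invol (contract G d) e"
    from K obtain C D where C: "C \<in> pi0 g" "K = component_of d ` C"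
      and D: "D \<in> pi0 G" "K = component_of d ` D"
      unfolding dg.pi0_contract dG.pi0_contract by blast
    then have [simp]: "D = C" using dg.Union_quotient[OF C(1)] dG.Union_quotient[OF D(1)] by metis
    have "invol g e = invol G e" if he: "e \<in> halfs G" "bd G e \<in> C" for e
    proof (cases "e \<in> external d")
      case True
      have "bd (contract G d) e \<in> K" using he C(2) by simp
      then show ?thesis using e True by simp
    next
      case False
      then show ?thesis using dg.invol_not_external[of e] dG.invol_not_external[of e] he by simp
    qed
    then have "spec g C = spec G C" using specified_subgraphD(2)[OF s C(1)] D(1) by simp
    then show "spec (contract g d) K = spec (contract G d) K"
      using dg.spec_contract[OF C(1)] dG.spec_contract[OF D(1)] C(2) by simp
  qed
qed

text \<open>A vertex on the left is a set of components of d, and its union is a component of g. The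
  two maps do not depend on G, so the same maps serve both members of a pair, as
  \<open>pair_iso\<close> requires.\<close>

lemma contract_contract_iso:
  assumes "covering g d" "covering G g"
  shows "sgraph_iso Union (\<lambda>x. x) (contract (contract G d) (contract g d)) (contract G g)"
proof -
  interpret dg: covering g d by fact
  interpret gG: covering G g by fact
  interpret dG: covering G d by (rule pair_contract_covering[OF assms(1,2)])
  interpret q: covering "contract G d" "contract g d" by (rule pair_contract_covering[OF assms(1,2)])
  have U: "\<Union>(component_of (contract g d) (component_of d v)) = component_of g v" if "v \<in> verts G" for v
    using dg.component_of_contract[of v] dg.Union_component_of[of v] that by simp
  have bij: "bij_betw Union (pi0 (contract g d)) (pi0 g)"
  proof (rule bij_betw_imageI)
    show "inj_on Union (pi0 (contract g d))"
      unfolding dg.pi0_contract by (rule inj_onI) (auto simp: dg.Union_quotient)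
    show "Union ` pi0 (contract g d) = pi0 g"
      unfolding dg.pi0_contract image_image using dg.Union_quotient by simp
  qed
  show ?thesis
    unfolding sgraph_iso_def
  proof (intro conjI ballI)
    show "bij_betw Union (verts (contract (contract G d) (contract g d))) (verts (contract G g))"
      using bij by simp
    show "bij_betw (\<lambda>x. x) (halfs (contract (contract G d) (contract g d))) (halfs (contract G g))"
      using dg.external_contract by (simp add: bij_betw_def)
    fix e assume "e \<in> halfs (contract (contract G d) (contract g d))"
    then have e: "e \<in> external g" using dg.external_contract by simp
    then have eG: "e \<in> halfs G" by (simp add: external_def)
    have ed: "e \<in> external d" using e dg.external_sub by blast
    show "bd (contract G g) e = \<Union>(bd (contract (contract G d) (contract g d)) e)"
      using U feynman_graphD(3)[OF gG.feynman eG] by simp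
    show "invol (contract G g) e = invol (contract (contract G d) (contract g d)) e"
      using e ed dg.external_contract by simp
    show "htype (contract G g) e = htype (contract (contract G d) (contract g d)) e" by simp
  next
    fix K assume "K \<in> verts (contract (contract G d) (contract g d))"
    then obtain C where "C \<in> pi0 g" "K = component_of d ` C" using dg.pi0_contract by auto
    then show "vindex (contract G g) (\<Union>K) = vindex (contract (contract G d) (contract g d)) K"
      using dg.spec_contract dg.Union_quotient by simp
  next
    fix L assume "L \<in> pi0 (contract (contract G d) (contract g d))"
    then obtain K where K: "K \<in> pi0 (contract G d)" "L = component_of (contract g d) ` K"
      using q.pi0_contract by auto
    then obtain C where C: "C \<in> pi0 G" "K = component_of d ` C" using dG.pi0_contract by auto
    have "Union ` L = component_of g ` C"
      unfolding K(2) C(2) image_image using U pi0_subset[OF gG.feynman C(1)] by (intro image_cong) auto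
    then show "spec (contract G g) (Union ` L) = spec (contract (contract G d) (contract g d)) L"
      using gG.spec_contract[OF C(1)] dG.spec_contract[OF C(1)] q.spec_contract[OF K(1)] K(2) C(2) by simp
  qed
qed

subsection \<open>Subgraphs of a contracted graph\<close>

text \<open>The inverse of dividing by d: the edges of d are put back, and the half-edges external
  in d follow h. The record is built in two stages because the specification is indexed by
  components, which are determined only once the involution is.\<close>

definition uncontract ::
  "('v, 'h, 't) sgraph \<Rightarrow> ('v, 'h, 't) sgraph \<Rightarrow> ('v set, 'h, 't) sgraph \<Rightarrow> ('v, 'h, 't) sgraph" where
  "uncontract g d h =
     (let g' = g\<lparr>invol := (\<lambda>e. if e \<in> external d then invol h e else invol d e)\<rparr> in
      g'\<lparr>spec := (\<lambda>C. if C \<in> pi0 g' then spec h (component_of d ` C) else None)\<rparr>)"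

lemma uncontract_simps [simp]:
  "verts (uncontract g d h) = verts g" "halfs (uncontract g d h) = halfs g"
  "bd (uncontract g d h) = bd g" "htype (uncontract g d h) = htype g"
  "vindex (uncontract g d h) = vindex g"
  "invol (uncontract g d h) = (\<lambda>e. if e \<in> external d then invol h e else invol d e)"
  by (simp_all add: uncontract_def Let_def)

lemma spec_uncontract:
  "spec (uncontract g d h) C =
    (if C \<in> pi0 (uncontract g d h) then spec h (component_of d ` C) else None)"
proof -
  have "pi0 (g\<lparr>invol := (\<lambda>e. if e \<in> external d then invol h e else invol d e)\<rparr>) = pi0 (uncontract g d h)"
    by (rule pi0_cong) (simp_all add: reach_def adjacency_def)
  then show ?thesis by (simp add: uncontract_def Let_def)
qed

context covering
begin

lemma uncontract:
  assumes h: "feynman_graph h" "covering_subgraph h (contract G d)"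
  shows covering_uncontract: "covering (uncontract G d h) d" "covering G (uncontract G d h)"
    and contract_uncontract: "dom (spec h) = pi0 h \<Longrightarrow> contract (uncontract G d h) d = h"
proof -
  let ?g = "uncontract G d h"
  note hc = covering_subgraphD(1-6)[OF h(2)]
  have hext: "invol h e \<in> external d \<longleftrightarrow> e \<in> external d" for e
    using feynman_graphD(4)[OF h(1)] hc(2) by simp
  have dext: "invol d e \<in> external d \<longleftrightarrow> e \<in> external d" for e
    using feynman_graphD(4,5)[OF feynman_sub] by (auto simp: external_def)
  have cov_g: "covering_subgraph ?g G"
  proof (rule covering_subgraphI)
    show "invol ?g e = e \<or> invol ?g e = invol G e" for e
      using hc(6)[of e] invol_sub[of e] by (auto simp: external_def)
  qed simp_all
  have fg: "feynman_graph ?g"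
  proof (rule feynman_covering[OF feynman cov_g])
    show "invol ?g (invol ?g e) = e" for e
      using hext dext feynman_graphD(5)[OF h(1)] feynman_graphD(5)[OF feynman_sub] by simp
  qed
  have "covering_subgraph d ?g"
    by (rule covering_subgraphI) (auto simp: external_def)
  with fg feynman_sub show cd: "covering ?g d" by (intro coveringI)
  show "covering G ?g" using fg feynman cov_g by (intro coveringI)
  interpret gd: covering ?g d by (rule cd)
  assume dom: "dom (spec h) = pi0 h"
  \<comment> \<open>Off \<open>external d\<close>, the set of half-edges of h, both sides are the
    identity by the convention on involutions.\<close>
  have iv: "invol (contract ?g d) = invol h"
    using feynman_graphD(7)[OF h(1)] hc(2) by (auto simp: fun_eq_iff)
  have "h = (contract G d)\<lparr>invol := invol h, spec := spec h\<rparr>"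
    using covering_subgraphD(7)[OF h(2)] .
  also have "\<dots> = contract ?g d"
  proof -
    have "adjacency h = adjacency (contract ?g d)"
      unfolding adjacency_def using hc iv by simp
    then have "pi0 h = pi0 (contract ?g d)" using hc(1) by (intro pi0_cong) (simp_all add: reach_def)
    then have pi0h: "pi0 h = (`) (component_of d) ` pi0 ?g" using gd.pi0_contract by simp
    have "spec h K = spec (contract ?g d) K" for K
    proof (cases "K \<in> pi0 h")
      case True
      then obtain C where C: "C \<in> pi0 ?g" "K = component_of d ` C" unfolding pi0h by blast
      then show ?thesis using gd.spec_contract[OF C(1)] by (simp add: spec_uncontract)
    next
      case False
      then have "K \<subseteq> pi0 d \<Longrightarrow> \<Union>K \<notin> pi0 ?g"
        unfolding pi0h by (metis quotient_unique image_eqI)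
      moreover have "spec h K = None" using False dom by auto
      ultimately show ?thesis by (simp add: contract_def spec_uncontract)
    qed
    then have "spec h = spec (contract ?g d)" by blast
    then show ?thesis using iv by (simp add: contract_def)
  qed
  finally show "contract ?g d = h" by simp
qed

text \<open>Irreducibility of the rebuilt graph comes from d and h together. Its specification is
  read from h, so compatibility with d is the delicate point; it is asked only on components that d
  and the rebuilt graph share with all edges, and those are vertices of h without internal
  edges.\<close>

lemma specified_uncontract:
  assumes SG: "specified_graph T G" and Sd: "specified_graph T d" and dG: "specified_subgraph d G"
    and Sh: "specified_graph T h" and hq: "specified_subgraph h (contract G d)"
  shows "specified_graph T (uncontract G d h)" "specified_subgraph d (uncontract G d h)"
    "specified_subgraph (uncontract G d h) G"
proof -
  let ?g = "uncontract G d h"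
  note h = specified_graphD[OF Sh]
  note hc = covering_subgraphD(1-6)[OF specified_subgraphD(1)[OF hq]]
  interpret gd: covering ?g d by (rule covering_uncontract[OF h(1) specified_subgraphD(1)[OF hq]])
  interpret gG: covering G ?g by (rule covering_uncontract[OF h(1) specified_subgraphD(1)[OF hq]])
  have hg: "contract ?g d = h"
    by (rule contract_uncontract[OF h(1) specified_subgraphD(1)[OF hq] h(5)])
  have pi0h: "pi0 h = (`) (component_of d) ` pi0 ?g" using gd.pi0_contract hg by simp
  have sg: "spec ?g C = spec h (component_of d ` C)" if "C \<in> pi0 ?g" for C
    using that by (simp add: spec_uncontract)
  have domg: "dom (spec ?g) = pi0 ?g"
  proof -
    have "spec h (component_of d ` C) \<noteq> None" if "C \<in> pi0 ?g" for C
    proof -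
      have "component_of d ` C \<in> dom (spec h)" unfolding h(5) pi0h using that by (rule imageI)
      then show ?thesis by blast
    qed
    then show ?thesis by (auto simp: spec_uncontract split: if_splits)
  qed
  have ext: "external h = external ?g" using gd.external_contract hg by simp
  \<comment> \<open>All half-edges of h at the vertex B are external, so the last clause of
    \<open>specified_graph\<close> for h forces the specification to be the index of B, which the
    quotient takes from d.\<close>
  have isolated: "spec h {B} = spec d B"
    if B: "B \<in> pi0 d" and e: "\<And>e. e \<in> halfs G \<Longrightarrow> bd G e \<in> B \<Longrightarrow> e \<in> external d \<Longrightarrow> e \<in> external ?g" for B
  proof -
    have "{e \<in> halfs h. bd h e = B} \<subseteq> external h"
    proof
      fix e assume "e \<in> {e \<in> halfs h. bd h e = B}"
      then have "e \<in> external d" "component_of d (bd G e) = B" using hc by auto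
      moreover from this have "bd G e \<in> B" using component_of_self[of "bd G e" d] by simp
      ultimately show "e \<in> external h" using e[of e] ext by (simp add: external_def)
    qed
    then have "spec h {B} = Some (the (spec d B))" using h(7)[of B] B hc by simp
    moreover have "B \<in> dom (spec d)" using specified_graphD(5)[OF Sd] B by simp
    ultimately show ?thesis by auto
  qed
  show "specified_graph T ?g"
    unfolding specified_graph_def
  proof (intro conjI ballI impI)
    show "feynman_graph ?g" by (rule gd.feynman)
    show "locally_one_PI ?g"
      using gd.locally_one_PI_if_contract[OF specified_graphD(2)[OF Sd]] h(2) hg by simp
    show "htype ?g ` halfs ?g \<subseteq> edge_types T" using specified_graphD(3)[OF SG] by simp
    show "dom (spec ?g) = pi0 ?g" by (rule domg)
  next
    fix v assume v: "v \<in> verts ?g"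
    then show "(vertex_legs ?g v, vindex ?g v) \<in> vertex_types T"
      using specified_graphD(4)[OF SG, of v] by (simp add: vertex_legs_def)
    \<comment> \<open>A vertex without internal edges in the rebuilt graph has none in d. There its
      specification is its own index, and \<open>isolated\<close> shows that h assigns the same
      value.\<close>
    assume ex: "{e \<in> halfs ?g. bd ?g e = v} \<subseteq> external ?g"
    then have "{e \<in> halfs d. bd d e = v} \<subseteq> external d" using gd.external_sub by auto
    then have sd: "spec d {v} = Some (vindex G v)" using specified_graphD(7)[OF Sd, of v] v by simp
    then have vd: "{v} \<in> pi0 d" using specified_graphD(5)[OF Sd] by blast
    have "component_of ?g v = {v}"
    proof (rule isolated_component)
      fix e assume "e \<in> halfs ?g" "bd ?g e = v"
      then have "e \<in> external ?g" using ex by blast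
      then show "invol ?g e = e" unfolding external_def by blast
    qed
    then have vg: "{v} \<in> pi0 ?g" using component_of_in_pi0[OF v] by simp
    have "component_of d v = {v}" using pi0_eq[OF feynman_sub vd, of v] by simp
    then have "spec ?g {v} = spec h {{v}}" using sg[OF vg] by simp
    also have "\<dots> = spec d {v}" by (rule isolated[OF vd]) (use ex in auto)
    finally show "spec ?g {v} = Some (vindex ?g v)" using sd by simp
  next
    fix C assume C: "C \<in> pi0 ?g"
    then have "component_of d ` C \<in> pi0 h" unfolding pi0h by simp
    from h(6)[OF this] show "(residue_legs ?g C, the (spec ?g C)) \<in> vertex_types T"
      using gd.residue_legs_contract[OF C] sg[OF C] hg by simp
  qed
  show "specified_subgraph d ?g"
    unfolding specified_subgraph_def
  proof (intro conjI ballI impI)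
    show "covering_subgraph d ?g" by (rule gd.cov)
    fix C assume "C \<in> pi0 d \<inter> pi0 ?g" and e: "\<forall>e\<in>halfs ?g. bd ?g e \<in> C \<longrightarrow> invol d e = invol ?g e"
    then have C: "C \<in> pi0 d" "C \<in> pi0 ?g" by blast+
    have "component_of d ` C = {C}"
      using pi0_eq[OF feynman_sub C(1)] pi0_nonempty[OF C(1)] by (auto simp: image_iff)
    then have "spec ?g C = spec h {C}" using sg[OF C(2)] by simp
    also have "\<dots> = spec d C" by (rule isolated[OF C(1)]) (use e in \<open>auto simp: external_def\<close>)
    finally show "spec d C = spec ?g C" by simp
  qed
  show "specified_subgraph ?g G"
    unfolding specified_subgraph_def
  proof (intro conjI ballI impI)
    show "covering_subgraph ?g G" by (rule gG.cov)
    fix C assume "C \<in> pi0 ?g \<inter> pi0 G" and e: "\<forall>e\<in>halfs G. bd G e \<in> C \<longrightarrow> invol ?g e = invol G e"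
    then have C: "C \<in> pi0 ?g" "C \<in> pi0 G" by blast+
    have "spec h (component_of d ` C) = spec (contract G d) (component_of d ` C)"
    proof (rule specified_subgraphD(2)[OF hq])
      show "component_of d ` C \<in> pi0 h" "component_of d ` C \<in> pi0 (contract G d)"
        using C pi0h pi0_contract by blast+
      fix x assume x: "x \<in> halfs (contract G d)" "bd (contract G d) x \<in> component_of d ` C"
      then have "x \<in> external d" "x \<in> halfs G" by (simp_all add: external_def)
      moreover from this have "bd G x \<in> C"
        using x mem_quotient[OF C(2) feynman_graphD(3)[OF feynman]] by simp
      ultimately show "invol h x = invol (contract G d) x" using e by auto
    qed
    then show "spec ?g C = spec G C" using sg[OF C(1)] spec_contract[OF C(2)] by simp
  qed
qed

end

lemma bij_betw_contract_sub_specs: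
  assumes g: "specified_graph T g" and d: "d \<in> sub_specs T g"
  shows "bij_betw (\<lambda>d'. contract d' d) {d' \<in> sub_specs T g. d \<in> sub_specs T d'} (sub_specs T (contract g d))"
proof (rule bij_betw_imageI)
  have Sd: "specified_graph T d" and dg: "specified_subgraph d g" using d sub_specs_iff[OF g] by blast+
  note fey = specified_graphD(1)[OF g] specified_graphD(1)[OF Sd]
  interpret covering g d using fey specified_subgraphD(1)[OF dg] by (rule coveringI)
  have q: "specified_graph T (contract g d)" by (rule specified_contract[OF g Sd dg])
  have mid: "covering d' d" "covering g d'" "specified_graph T d'" "specified_subgraph d d'"
      "specified_subgraph d' g"
    if "d' \<in> {d' \<in> sub_specs T g. d \<in> sub_specs T d'}" for d'
  proof -
    have *: "specified_graph T d'" "specified_subgraph d' g" using that sub_specs_iff[OF g] by blast+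
    moreover from this have "specified_subgraph d d'" using that sub_specs_iff[of T d'] by blast
    ultimately show "covering d' d" "covering g d'" "specified_graph T d'" "specified_subgraph d d'"
      "specified_subgraph d' g"
      using fey specified_graphD(1) specified_subgraphD(1) coveringI by blast+
  qed
  show "inj_on (\<lambda>d'. contract d' d) {d' \<in> sub_specs T g. d \<in> sub_specs T d'}"
  proof (rule inj_onI)
    fix a b assume a: "a \<in> {d' \<in> sub_specs T g. d \<in> sub_specs T d'}"
      and b: "b \<in> {d' \<in> sub_specs T g. d \<in> sub_specs T d'}" and eq: "contract a d = contract b d"
    interpret a: covering a d by (rule mid(1)[OF a])
    interpret b: covering b d by (rule mid(1)[OF b])
    interpret ga: covering g a by (rule mid(2)[OF a])
    interpret gb: covering g b by (rule mid(2)[OF b])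
    have inv: "invol a = invol b"
    proof
      fix e
      \<comment> \<open>Off the half-edges the involution is the identity by convention, on
        \<open>external d\<close> it is visible in the quotient, and the remaining half-edges belong
        to edges of d, hence of both graphs.\<close>
      consider "e \<notin> halfs g" | "e \<in> external d" | "e \<in> halfs g" "e \<notin> external d" by blast
      then show "invol a e = invol b e"
      proof cases
        case 1
        then show ?thesis using feynman_graphD(7)[OF a.feynman] feynman_graphD(7)[OF b.feynman] by simp
      next
        case 2
        then show ?thesis using arg_cong[OF eq, of invol] by (simp add: fun_eq_iff) metis
      next
        case 3
        then show ?thesis using a.invol_not_external[of e] b.invol_not_external[of e] by simp
      qed
    qed
    then have "adjacency a = adjacency b" by (simp add: adjacency_def)
    then have pi0: "pi0 a = pi0 b" by (intro pi0_cong) (simp_all add: reach_def)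
    have "spec a C = spec b C" for C
    proof (cases "C \<in> pi0 a")
      case True
      then show ?thesis using a.spec_contract[OF True] b.spec_contract[of C] pi0 eq by simp
    next
      case False
      then have "C \<notin> dom (spec a)" "C \<notin> dom (spec b)"
        using specified_graphD(5)[OF mid(3)[OF a]] specified_graphD(5)[OF mid(3)[OF b]] pi0 by simp_all
      then show ?thesis by (simp add: domIff)
    qed
    then have "spec a = spec b" by blast
    then show "a = b"
      using covering_subgraphD(7)[OF ga.cov] covering_subgraphD(7)[OF gb.cov] inv by simp
  qed
  show "(\<lambda>d'. contract d' d) ` {d' \<in> sub_specs T g. d \<in> sub_specs T d'} = sub_specs T (contract g d)"
  proof (intro set_eqI iffI)
    fix h assume "h \<in> (\<lambda>d'. contract d' d) ` {d' \<in> sub_specs T g. d \<in> sub_specs T d'}"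
    then obtain a where a: "a \<in> {d' \<in> sub_specs T g. d \<in> sub_specs T d'}" "h = contract a d" by blast
    then show "h \<in> sub_specs T (contract g d)"
      using specified_contract[OF mid(3)[OF a(1)] Sd mid(4)[OF a(1)]]
        specified_subgraph_contract[OF mid(1,2,5)[OF a(1)]] sub_specs_iff[OF q] by blast
  next
    fix h assume "h \<in> sub_specs T (contract g d)"
    then have h: "specified_graph T h" "specified_subgraph h (contract g d)" using sub_specs_iff[OF q] by blast+
    note u = specified_uncontract[OF g Sd dg h]
    have "contract (uncontract g d h) d = h"
      by (rule contract_uncontract[OF specified_graphD(1)[OF h(1)] specified_subgraphD(1)[OF h(2)]
            specified_graphD(5)[OF h(1)]])
    moreover have "uncontract g d h \<in> {d' \<in> sub_specs T g. d \<in> sub_specs T d'}"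
      using u Sd sub_specs_iff[OF g] sub_specs_iff[OF u(1)] by blast
    ultimately show "h \<in> (\<lambda>d'. contract d' d) ` {d' \<in> sub_specs T g. d \<in> sub_specs T d'}"
      by (metis (no_types, lifting) image_eqI)
  qed
qed


section \<open>Isomorphism classes of pairs\<close>

lemma graph_pairD:
  assumes "graph_pair (G, g)"
  shows "feynman_graph G" "feynman_graph g" "dom (spec G) = pi0 G" "dom (spec g) = pi0 g"
    "specified_subgraph g G" "covering_subgraph g G" "covering G g"
  using assms specified_subgraphD(1) unfolding graph_pair_def by (auto intro!: coveringI)

lemma pair_isoI: "sgraph_iso f k G H \<Longrightarrow> sgraph_iso f k g h \<Longrightarrow> pair_iso (G, g) (H, h)"
  unfolding pair_iso_def by auto

lemma pair_isoE:
  assumes "pair_iso (G, g) (H, h)"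
  obtains f k where "sgraph_iso f k G H" "sgraph_iso f k g h"
  using assms unfolding pair_iso_def by auto

lemma pair_iso_sym:
  assumes "pair_iso P Q" "graph_pair P" "graph_pair Q" shows "pair_iso Q P"
proof -
  obtain G g H h where [simp]: "P = (G, g)" "Q = (H, h)" by (cases P, cases Q) auto
  note G = graph_pairD[OF assms(2)[simplified]] and H = graph_pairD[OF assms(3)[simplified]]
  obtain f k where fk: "sgraph_iso f k G H" "sgraph_iso f k g h" using assms(1) by (auto elim: pair_isoE)
  \<comment> \<open>The inverses taken on G and on g are then the same maps, so one pair of maps
    serves both members.\<close>
  have "verts g = verts G" "halfs g = halfs G" using covering_subgraphD[OF G(6)] by blast+
  then show ?thesis
    using sgraph_iso_sym[OF fk(1) G(1) H(1)] sgraph_iso_sym[OF fk(2) G(2) H(2)] by (auto intro: pair_isoI)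
qed

lemma pair_iso_trans:
  assumes "pair_iso P Q" "pair_iso Q R" "graph_pair P" "graph_pair Q" shows "pair_iso P R"
proof -
  obtain G g H h K l where [simp]: "P = (G, g)" "Q = (H, h)" "R = (K, l)" by (cases P, cases Q, cases R) auto
  note G = graph_pairD[OF assms(3)[simplified]] and H = graph_pairD[OF assms(4)[simplified]]
  obtain f k where fk: "sgraph_iso f k G H" "sgraph_iso f k g h" using assms(1) by (auto elim: pair_isoE)
  obtain f' k' where fk': "sgraph_iso f' k' H K" "sgraph_iso f' k' h l" using assms(2) by (auto elim: pair_isoE)
  show ?thesis
    using sgraph_iso_trans[OF fk(1) fk'(1) G(1) H(1)] sgraph_iso_trans[OF fk(2) fk'(2) G(2) H(2)]
    by (auto intro: pair_isoI)
qed

lemma pair_class_eqI: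
  assumes "graph_pair P" "graph_pair Q" "pair_iso P Q" shows "pair_class P = pair_class Q"
  unfolding pair_class_def
  using pair_iso_trans[OF assms(3) _ assms(1,2)] pair_iso_trans[OF pair_iso_sym[OF assms(3,1,2)] _ assms(2,1)]
  by blast

text \<open>Finiteness allows relabelling by natural numbers. Hence the class of a pair over any
  label types, such as those produced by contraction or juxtaposition, is nonempty and
  \<open>rep\<close> chooses a genuine member.\<close>

lemma ex_nat_pair:
  assumes "graph_pair P" obtains Q where "Q \<in> pair_class P"
proof -
  obtain G g where P: "P = (G, g)" by (cases P)
  note G = graph_pairD[OF assms[unfolded P]]
  obtain f :: "'a \<Rightarrow> nat" where f: "inj_on f (verts G)"
    using feynman_graphD(1)[OF G(1)] finite_imp_inj_to_nat_seg by blast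
  obtain k :: "'b \<Rightarrow> nat" where k: "inj_on k (halfs G)"
    using feynman_graphD(2)[OF G(1)] finite_imp_inj_to_nat_seg by blast
  have g: "inj_on f (verts g)" "inj_on k (halfs g)" using f k covering_subgraphD[OF G(6)] by simp_all
  note R = relabel[OF G(1) f k] and r = relabel[OF G(2) g]
  have "specified_subgraph (relabel f k g) (relabel f k G)"
    by (rule specified_subgraph_iso[OF R(1) r(1) G(1,2) R(2) r(2) covering_relabel[OF G(6)] G(5)])
  then have "(relabel f k G, relabel f k g) \<in> pair_class P"
    unfolding pair_class_def graph_pair_def P
    using R r dom_spec_relabel[OF G(1) f k G(3)] dom_spec_relabel[OF G(2) g G(4)] pair_isoI by blast
  then show ?thesis by (rule that)
qed

lemma rep_pair_class:
  assumes "graph_pair P"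
  shows "graph_pair (rep (pair_class P))" "pair_iso P (rep (pair_class P))"
proof -
  have "rep (pair_class P) \<in> pair_class P"
    unfolding rep_def using ex_nat_pair[OF assms] by (metis someI)
  then show "graph_pair (rep (pair_class P))" "pair_iso P (rep (pair_class P))"
    unfolding pair_class_def by simp_all
qed

lemma pair_class_rep [simp]: "graph_pair P \<Longrightarrow> pair_class (rep (pair_class P)) = pair_class P"
  using pair_class_eqI rep_pair_class by metis

lemma pair_class_eqD:
  assumes "graph_pair P" "graph_pair Q" "pair_class P = pair_class Q" shows "pair_iso P Q"
proof (rule pair_iso_trans[OF rep_pair_class(2)[OF assms(1)] _ assms(1) rep_pair_class(1)[OF assms(1)]])
  show "pair_iso (rep (pair_class P)) Q"
    unfolding assms(3)
    by (rule pair_iso_sym[OF rep_pair_class(2)[OF assms(2)] assms(2) rep_pair_class(1)[OF assms(2)]])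
qed

section \<open>Admissible pairs and the bases of the two spaces\<close>

lemma D_pair_graph_pair: "D_pair T P \<Longrightarrow> graph_pair P"
  unfolding D_pair_def graph_pair_def using specified_graphD(1,5) by (cases P) blast

lemma D_pair_iso:
  assumes "pair_iso P Q" "D_pair T P" "graph_pair Q" shows "D_pair T Q"
proof -
  obtain G g H h where PQ: "P = (G, g)" "Q = (H, h)" by (cases P, cases Q) auto
  note H = graph_pairD[OF assms(3)[unfolded PQ]]
  obtain f k where fk: "sgraph_iso f k G H" "sgraph_iso f k g h"
    using assms(1) unfolding PQ by (rule pair_isoE)
  have "specified_graph T G" "specified_graph T g" using assms(2) unfolding PQ D_pair_iff by blast+
  then show ?thesis
    unfolding PQ D_pair_iff
    using specified_graph_iso[OF fk(1) H(1,3)] specified_graph_iso[OF fk(2) H(2,4)] H(5) by blast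
qed

text \<open>The pair may carry arbitrary labels although the basis is defined from pairs with
  natural labels; this is what puts the classes of quotients and juxtapositions into the
  basis.\<close>

lemma D_basisI:
  assumes "D_pair T P" shows "pair_class P \<in> D_basis T"
proof -
  note P = D_pair_graph_pair[OF assms]
  have "D_pair T (rep (pair_class P))"
    by (rule D_pair_iso[OF rep_pair_class(2)[OF P] assms rep_pair_class(1)[OF P]])
  then show ?thesis unfolding D_basis_def using pair_class_rep[OF P] by (metis image_eqI mem_Collect_eq)
qed

lemma D_basisE:
  assumes "c \<in> D_basis T" shows "D_pair T (rep c)" "pair_class (rep c) = c"
proof -
  obtain P :: "(nat, nat, 'a) spair" where P: "D_pair T P" "c = pair_class P"
    using assms unfolding D_basis_def by blast
  note GP = D_pair_graph_pair[OF P(1)]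
  show "D_pair T (rep c)" unfolding P(2)
    by (rule D_pair_iso[OF rep_pair_class(2)[OF GP] P(1) rep_pair_class(1)[OF GP]])
  show "pair_class (rep c) = c" unfolding P(2) using GP by simp
qed

lemma connected_graph_iso:
  assumes "sgraph_iso f k G H" "feynman_graph G" "feynman_graph H" "connected_graph G"
  shows "connected_graph H"
  using assms(4) unfolding connected_graph_def pi0_image[OF assms(1-3)] is_singleton_def by auto

lemma F_pair_iff: "F_pair T (G, g) \<longleftrightarrow> D_pair T (G, g) \<and> connected_graph G"
proof -
  have "connected_graph (contract G g)" if "D_pair T (G, g)" "connected_graph G"
    using that(2) covering.pi0_contract[OF graph_pairD(7)[OF D_pair_graph_pair[OF that(1)]]]
    unfolding connected_graph_def is_singleton_def by auto
  then show ?thesis unfolding F_pair_def by auto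
qed

lemma F_basisI:
  assumes "F_pair T P" shows "pair_class P \<in> F_basis T"
proof -
  obtain G g where P: "P = (G, g)" by (cases P)
  obtain H h where Q: "rep (pair_class P) = (H, h)" by (cases "rep (pair_class P)")
  have D: "D_pair T (G, g)" and c: "connected_graph G" using assms unfolding P F_pair_iff by blast+
  note GP = D_pair_graph_pair[OF D]
  note R = rep_pair_class[OF GP, folded P, unfolded Q]
  have "D_pair T (H, h)" using D_pair_iso[OF R(2)] D R(1) P by simp
  moreover obtain f k where "sgraph_iso f k G H" using R(2) unfolding P by (rule pair_isoE)
  then have "connected_graph H"
    using connected_graph_iso c graph_pairD(1)[OF GP] graph_pairD(1)[OF R(1)] by blast
  ultimately have "F_pair T (rep (pair_class P))" unfolding Q F_pair_iff by blast
  then show ?thesis unfolding F_basis_def using pair_class_rep[OF GP] P by (metis image_eqI mem_Collect_eq)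
qed

lemma covering_D_pair: "D_pair T (G, g) \<Longrightarrow> covering G g"
  using graph_pairD(7) D_pair_graph_pair by blast

text \<open>This makes every term of the coproduct and of the coaction a tensor of admissible
  pairs.\<close>

lemma D_pair_sub_specs:
  assumes "D_pair T (G, g)" "d \<in> sub_specs T g"
  shows "D_pair T (G, d)" "D_pair T (g, d)" "D_pair T (contract G d, contract g d)"
proof -
  have G: "specified_graph T G" "specified_graph T g" "specified_subgraph g G"
    using assms(1) unfolding D_pair_iff by blast+
  have d: "specified_graph T d" "specified_subgraph d g" using assms(2) sub_specs_iff[OF G(2)] by blast+
  show gd: "D_pair T (g, d)" using d G unfolding D_pair_iff by blast
  have dG: "specified_subgraph d G"
    using specified_subgraph_trans specified_graphD(1) d G by blast
  then show "D_pair T (G, d)" using d G unfolding D_pair_iff by blast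
  show "D_pair T (contract G d, contract g d)"
    unfolding D_pair_iff
    using specified_contract[OF G(1) d(1) dG] specified_contract[OF G(2) d]
      specified_subgraph_contract[OF covering_D_pair[OF gd] covering_D_pair[OF assms(1)] G(3)] by blast
qed

lemma contract_iso:
  assumes I: "sgraph_iso f k G H" and i: "sgraph_iso f k d e" and Gd: "covering G d" and He: "covering H e"
  shows "sgraph_iso ((`) f) k (contract G d) (contract H e)"
proof -
  interpret Gd: covering G d by fact
  interpret He: covering H e by fact
  note pi = pi0_image[OF i Gd.feynman_sub He.feynman_sub]
  note comp = component_of_image[OF i Gd.feynman_sub He.feynman_sub]
  note ext = external_image[OF i Gd.feynman_sub]
  have extG: "x \<in> halfs G" if "x \<in> external d" for x using that by (simp add: external_def)
  show ?thesis
    unfolding sgraph_iso_def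
  proof (intro conjI ballI)
    have "inj_on ((`) f) (pi0 d)"
      using inj_on_image_eq_iff[OF sgraph_iso_inj_verts[OF I]] pi0_subset[OF Gd.feynman_sub]
      by (intro inj_onI) auto
    then show "bij_betw ((`) f) (verts (contract G d)) (verts (contract H e))"
      using pi by (simp add: bij_betw_def)
    have "inj_on k (external d)" using sgraph_iso_inj[OF I] extG by (meson inj_on_subset subsetI)
    then show "bij_betw k (halfs (contract G d)) (halfs (contract H e))"
      using ext by (simp add: bij_betw_def)
    fix x assume "x \<in> halfs (contract G d)"
    then have x: "x \<in> external d" by simp
    note xG = extG[OF x]
    have kx: "k x \<in> external e" using x ext by simp
    show "bd (contract H e) (k x) = f ` bd (contract G d) x"
      using comp[of "bd G x"] feynman_graphD(3)[OF Gd.feynman xG] sgraph_isoD(3)[OF I xG] by simp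
    show "invol (contract H e) (k x) = k (invol (contract G d) x)"
      using x kx sgraph_isoD(4)[OF I xG] by simp
    show "htype (contract H e) (k x) = htype (contract G d) x"
      using sgraph_isoD(5)[OF I xG] by simp
  next
    fix B assume "B \<in> verts (contract G d)"
    then show "vindex (contract H e) (f ` B) = vindex (contract G d) B"
      using sgraph_isoD(7)[OF i, of B] by simp
  next
    fix K assume "K \<in> pi0 (contract G d)"
    then obtain C where C: "C \<in> pi0 G" "K = component_of d ` C" unfolding Gd.pi0_contract by (rule imageE)
    have fC: "f ` C \<in> pi0 H" using pi0_image[OF I Gd.feynman He.feynman] C(1) by simp
    have "(`) f ` K = component_of e ` f ` C"
      unfolding C(2) image_image using comp pi0_subset[OF Gd.feynman C(1)] by (intro image_cong) auto
    then show "spec (contract H e) ((`) f ` K) = spec (contract G d) K"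
      using He.spec_contract[OF fC] Gd.spec_contract[OF C(1)] sgraph_isoD(7)[OF I C(1)] C(2) by simp
  qed
qed

subsection \<open>Transport of specified covering subgraphs\<close>

text \<open>A specified subgraph of g is encoded by the set of its uncut half-edges and a partial
  map from sets of vertices to indices. The finiteness clause of \<open>physical_theory\<close>
  bounds the values of this map.\<close>

lemma finite_sub_specs:
  assumes "physical_theory T" "feynman_graph g"
  shows "finite (sub_specs T g)"
proof -
  \<comment> \<open>Every residue of a subgraph consists of a set of half-edges of g, so only
    finitely many multisets of legs occur, each with finitely many indices.\<close>
  define Ms where "Ms = (\<lambda>A. image_mset (htype g) (mset_set A)) ` Pow (halfs g)"
  define N where "N = (\<Union>M\<in>Ms. {i. (M, i) \<in> vertex_types T})"
  note fin = feynman_graphD(1,2)[OF assms(2)]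
  have "finite N"
    unfolding N_def Ms_def using fin assms(1) by (auto simp: physical_theory_def)
  then have finS: "finite (\<Union>A\<in>Pow (Pow (verts g)). {s. dom s = A \<and> ran s \<subseteq> N})"
    using fin by (intro finite_UN_I finite_set_of_finite_maps) (auto intro: finite_subset)
  define mk where "mk = (\<lambda>(S, s). g\<lparr>invol := (\<lambda>e. if e \<in> S then invol g e else e), spec := s\<rparr>)"
  have "sub_specs T g \<subseteq> mk ` (Pow (halfs g) \<times> (\<Union>A\<in>Pow (Pow (verts g)). {s. dom s = A \<and> ran s \<subseteq> N}))"
  proof
    fix d assume "d \<in> sub_specs T g"
    then have Sd: "specified_graph T d" and dg: "covering_subgraph d g"
      unfolding sub_specs_def using specified_subgraphD(1) by blast+
    interpret covering g d using assms(2) specified_graphD(1)[OF Sd] dg by (rule coveringI)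
    define S where "S = {e \<in> halfs g. invol d e \<noteq> e}"
    have "invol d = (\<lambda>e. if e \<in> S then invol g e else e)"
      unfolding S_def using invol_sub_neq feynman_graphD(7)[OF feynman_sub] by fastforce
    then have "d = mk (S, spec d)" unfolding mk_def using covering_subgraphD(7)[OF dg] by simp
    moreover have "S \<in> Pow (halfs g)" unfolding S_def by blast
    moreover have "dom (spec d) \<in> Pow (Pow (verts g))"
      using specified_graphD(5)[OF Sd] pi0_subset[OF feynman_sub] by auto
    moreover have "ran (spec d) \<subseteq> N"
    proof
      fix i assume "i \<in> ran (spec d)"
      then obtain C where C: "spec d C = Some i" unfolding ran_def by blast
      then have "C \<in> pi0 d" using specified_graphD(5)[OF Sd] by blast
      from specified_graphD(6)[OF Sd this] have "(residue_legs d C, i) \<in> vertex_types T" using C by simp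
      moreover have "residue_legs d C \<in> Ms"
        unfolding residue_legs_def Ms_def by (auto simp: external_def)
      ultimately show "i \<in> N" unfolding N_def by blast
    qed
    ultimately show "d \<in> mk ` (Pow (halfs g) \<times> (\<Union>A\<in>Pow (Pow (verts g)). {s. dom s = A \<and> ran s \<subseteq> N}))"
      by blast
  qed
  moreover have "finite (mk ` (Pow (halfs g) \<times> (\<Union>A\<in>Pow (Pow (verts g)). {s. dom s = A \<and> ran s \<subseteq> N})))"
    using fin finS by blast
  ultimately show ?thesis by (rule finite_subset)
qed

text \<open>Injectivity of k recovers the involution from its image, hence the components, and on
  these the specification is the one carried by d.\<close>

lemma sgraph_iso_sub_spec_inj:
  assumes k: "inj_on k (halfs g)"
    and a: "sgraph_iso f k a d" "specified_graph T a" "covering_subgraph a g"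
    and b: "sgraph_iso f k b d" "specified_graph T b" "covering_subgraph b g"
  shows "a = b"
proof -
  note ca = covering_subgraphD[OF a(3)] and cb = covering_subgraphD[OF b(3)]
  have inv: "invol a = invol b"
  proof
    fix e show "invol a e = invol b e"
    proof (cases "e \<in> halfs g")
      case True
      then have "k (invol a e) = k (invol b e)"
        using sgraph_isoD(4)[OF a(1), of e] sgraph_isoD(4)[OF b(1), of e] ca(2) cb(2) by simp
      moreover have "invol a e \<in> halfs g" "invol b e \<in> halfs g"
        using True feynman_graphD(4)[OF specified_graphD(1)[OF a(2)]]
          feynman_graphD(4)[OF specified_graphD(1)[OF b(2)]] ca(2) cb(2) by simp_all
      ultimately show ?thesis using k by (meson inj_onD)
    qed (use feynman_graphD(7)[OF specified_graphD(1)[OF a(2)]]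
          feynman_graphD(7)[OF specified_graphD(1)[OF b(2)]] ca(2) cb(2) in simp)
  qed
  then have "adjacency a = adjacency b" using ca(2,3) cb(2,3) by (simp add: adjacency_def)
  then have pi0: "pi0 a = pi0 b" using ca(1) cb(1) by (intro pi0_cong) (simp_all add: reach_def)
  have "spec a C = spec b C" for C
  proof (cases "C \<in> pi0 a")
    case True
    then show ?thesis using sgraph_isoD(7)[OF a(1), of C] sgraph_isoD(7)[OF b(1), of C] pi0 by simp
  next
    case False
    then have "C \<notin> dom (spec a)" "C \<notin> dom (spec b)"
      using specified_graphD(5)[OF a(2)] specified_graphD(5)[OF b(2)] pi0 by simp_all
    then show ?thesis by (simp add: domIff)
  qed
  then have "spec a = spec b" by blast
  then show "a = b" using ca(7) cb(7) inv by simp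
qed

lemma ex_transport:
  assumes I: "sgraph_iso f k g h" and g: "specified_graph T g" and h: "specified_graph T h"
    and d: "d \<in> sub_specs T g"
  obtains e where "e \<in> sub_specs T h" "sgraph_iso f k d e"
proof -
  have Sd: "specified_graph T d" and dg: "specified_subgraph d g" using d sub_specs_iff[OF g] by blast+
  note fey = specified_graphD(1)[OF g] specified_graphD(1)[OF h]
  interpret covering g d using fey(1) specified_graphD(1)[OF Sd] specified_subgraphD(1)[OF dg] by (rule coveringI)
  have inj: "inj_on f (verts d)" "inj_on k (halfs d)"
    using sgraph_iso_inj_verts[OF I] sgraph_iso_inj[OF I] by simp_all
  note R = relabel[OF feynman_sub inj]
  \<comment> \<open>Only the involution and the specification come from the relabelled d. The rest
    is taken from h, because a covering subgraph has to equal h as a record, including the values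
    outside vertices and half-edges.\<close>
  define e where "e = h\<lparr>invol := invol (relabel f k d), spec := spec (relabel f k d)\<rparr>"
  have e [simp]: "verts e = verts h" "halfs e = halfs h" "bd e = bd h" "htype e = htype h"
    "vindex e = vindex h" "invol e = invol (relabel f k d)" "spec e = spec (relabel f k d)"
    by (simp_all add: e_def)
  have iso: "sgraph_iso f k d e"
    using sgraph_isoD[OF I] sgraph_isoD(4,7)[OF R(1)] unfolding sgraph_iso_def by simp
  have cov_e: "covering_subgraph e h"
  proof (rule covering_subgraphI)
    fix x show "invol e x = x \<or> invol e x = invol h x"
    proof (cases "x \<in> halfs h")
      case True
      then obtain y where "y \<in> halfs g" "x = k y" using sgraph_iso_halfs[OF I] by auto
      then show ?thesis using sgraph_isoD(4)[OF iso, of y] sgraph_isoD(4)[OF I, of y] invol_sub[of y] by auto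
    next
      case False
      then show ?thesis using feynman_graphD(7)[OF R(2)] sgraph_iso_halfs[OF I] by simp
    qed
  qed simp_all
  have fe: "feynman_graph e"
    by (rule feynman_covering[OF fey(2) cov_e]) (simp add: feynman_graphD(5)[OF R(2)])
  have "pi0 e = pi0 (relabel f k d)"
    using pi0_image[OF iso feynman_sub fe] pi0_image[OF R(1) feynman_sub R(2)] by simp
  then have "dom (spec e) = pi0 e"
    using dom_spec_relabel[OF feynman_sub inj specified_graphD(5)[OF Sd]] by simp
  then have "specified_graph T e" by (rule specified_graph_iso[OF iso fe _ Sd])
  moreover have "specified_subgraph e h"
    by (rule specified_subgraph_iso[OF I iso feynman feynman_sub fey(2) fe cov_e dg])
  ultimately show thesis using that iso sub_specs_iff[OF h] by blast
qed

lemma ex_sub_specs_inj: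
  assumes i: "sgraph_iso f k g h" and g: "specified_graph T g" and h: "specified_graph T h"
  obtains t where "inj_on t (sub_specs T g)" "t ` sub_specs T g \<subseteq> sub_specs T h"
    "\<forall>d\<in>sub_specs T g. sgraph_iso f k d (t d)"
proof -
  define t where "t d = (SOME e. e \<in> sub_specs T h \<and> sgraph_iso f k d e)" for d
  have t: "t d \<in> sub_specs T h \<and> sgraph_iso f k d (t d)" if "d \<in> sub_specs T g" for d
    unfolding t_def by (rule someI_ex) (meson ex_transport[OF i g h that])
  moreover have "inj_on t (sub_specs T g)"
  proof (rule inj_onI)
    fix a b assume a: "a \<in> sub_specs T g" and b: "b \<in> sub_specs T g" and "t a = t b"
    then have ia: "sgraph_iso f k a (t a)" and ib: "sgraph_iso f k b (t a)" using t[OF a] t[OF b] by simp_all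
    have "specified_graph T a" "specified_graph T b" "covering_subgraph a g" "covering_subgraph b g"
      using a b sub_specs_iff[OF g] specified_subgraphD(1) by blast+
    then show "a = b" using sgraph_iso_sub_spec_inj[OF sgraph_iso_inj[OF i] ia _ _ ib] by blast
  qed
  ultimately show thesis by (intro that) blast+
qed

text \<open>With F arbitrary, this one statement settles the independence of the representative for
  the coproduct and for the coaction, also when the latter is read through components.\<close>

lemma sum_sub_specs_iso:
  assumes T: "physical_theory T" and P: "D_pair T (G, g)" and Q: "D_pair T (H, h)"
    and iso: "pair_iso (G, g) (H, h)"
  shows "(\<Sum>d\<in>sub_specs T g. F (pair_class (G, d)) (pair_class (contract G d, contract g d))) =
    (\<Sum>d\<in>sub_specs T h. F (pair_class (H, d)) (pair_class (contract H d, contract h d)))"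
proof -
  obtain f k where fk: "sgraph_iso f k G H" "sgraph_iso f k g h" using iso by (rule pair_isoE)
  note SG = P[unfolded D_pair_iff] and SH = Q[unfolded D_pair_iff]
  obtain t where t: "inj_on t (sub_specs T g)" "t ` sub_specs T g \<subseteq> sub_specs T h"
      "\<forall>d\<in>sub_specs T g. sgraph_iso f k d (t d)"
    using ex_sub_specs_inj[OF fk(2)] SG SH by metis
  have fh: "feynman_graph h" and fg: "feynman_graph g" using SG SH specified_graphD(1) by blast+
  have "t ` sub_specs T g = sub_specs T h"
  proof (rule card_subset_eq[OF finite_sub_specs[OF T] t(2)])
    show "feynman_graph h" by (rule fh)
    \<comment> \<open>The inverse isomorphism gives an injection back, so the two finite sets are
      equally large and t is onto.\<close>
    obtain s where s: "inj_on s (sub_specs T h)" "s ` sub_specs T h \<subseteq> sub_specs T g"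
      using ex_sub_specs_inj[OF sgraph_iso_sym[OF fk(2) fg fh]] SG SH by metis
    show "card (t ` sub_specs T g) = card (sub_specs T h)"
      using card_inj_on_le[OF s finite_sub_specs[OF T fg]] card_mono[OF finite_sub_specs[OF T fh] t(2)]
        card_image[OF t(1)] by simp
  qed
  then have bij: "bij_betw t (sub_specs T g) (sub_specs T h)" using t(1) by (simp add: bij_betw_def)
  show ?thesis
    unfolding sum.reindex_bij_betw[OF bij, symmetric]
  proof (rule sum.cong[OF refl])
    fix d assume d: "d \<in> sub_specs T g"
    then have e: "t d \<in> sub_specs T h" and i: "sgraph_iso f k d (t d)" using t by blast+
    note D = D_pair_sub_specs[OF P d] and E = D_pair_sub_specs[OF Q e]
    have 1: "pair_class (G, d) = pair_class (H, t d)"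
      by (intro pair_class_eqI D_pair_graph_pair[OF D(1)] D_pair_graph_pair[OF E(1)] pair_isoI[OF fk(1) i])
    have "pair_iso (contract G d, contract g d) (contract H (t d), contract h (t d))"
      by (rule pair_isoI[OF contract_iso[OF fk(1) i] contract_iso[OF fk(2) i]])
        (rule covering_D_pair[OF D(1)] covering_D_pair[OF D(2)] covering_D_pair[OF E(1)] covering_D_pair[OF E(2)])+
    then have "pair_class (contract G d, contract g d) = pair_class (contract H (t d), contract h (t d))"
      by (intro pair_class_eqI D_pair_graph_pair[OF D(3)] D_pair_graph_pair[OF E(3)])
    with 1 show "F (pair_class (G, d)) (pair_class (contract G d, contract g d)) =
      F (pair_class (H, t d)) (pair_class (contract H (t d), contract h (t d)))" by simp
  qed
qed


section \<open>Decomposition into connected components\<close>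

lemma restrict_sgraph_simps [simp]:
  "verts (restrict_sgraph G C) = C" "halfs (restrict_sgraph G C) = {e \<in> halfs G. bd G e \<in> C}"
  "bd (restrict_sgraph G C) = bd G" "htype (restrict_sgraph G C) = htype G"
  "vindex (restrict_sgraph G C) = vindex G"
  "invol (restrict_sgraph G C) = (\<lambda>e. if e \<in> halfs G \<and> bd G e \<in> C then invol G e else e)"
  "spec (restrict_sgraph G C) = spec G |` Pow C"
  by (simp_all add: restrict_sgraph_def restrict_graph_def)

text \<open>These are the unions of connected components. Unlike membership in \<open>pi0\<close>,
  the property passes to covering subgraphs, so one set C can be used to restrict both members of a
  pair.\<close>

definition saturated :: "('v, 'h, 't) sgraph \<Rightarrow> 'v set \<Rightarrow> bool" where
  "saturated G C \<longleftrightarrow> C \<subseteq> verts G \<and> (\<forall>e\<in>halfs G. bd G e \<in> C \<longrightarrow> bd G (invol G e) \<in> C)"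

lemma saturatedD:
  "saturated G C \<Longrightarrow> C \<subseteq> verts G"
  "saturated G C \<Longrightarrow> e \<in> halfs G \<Longrightarrow> bd G e \<in> C \<Longrightarrow> bd G (invol G e) \<in> C"
  unfolding saturated_def by blast+

lemma saturated_pi0: "feynman_graph G \<Longrightarrow> C \<in> pi0 G \<Longrightarrow> saturated G C"
  unfolding saturated_def using pi0_subset[of G C] pi0_closed[of G C] by simp

lemma (in covering) saturated_sub: "saturated G C \<Longrightarrow> saturated d C"
  unfolding saturated_def using invol_sub by (metis sub_simps(1-3))

lemma reach_restrict_sgraph:
  assumes "saturated G C" "u \<in> C"
  shows "(u, v) \<in> reach (restrict_sgraph G C) \<longleftrightarrow> (u, v) \<in> reach G"
proof -
  have "reach (restrict_sgraph G C) = reach (restrict_graph G C)"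
    unfolding reach_def adjacency_def by simp
  then show ?thesis using reach_restrict[OF saturatedD(2)[OF assms(1)] assms(2)] by simp
qed

lemma pi0_restrict_sgraph:
  assumes "feynman_graph G" "saturated G C"
  shows "pi0 (restrict_sgraph G C) = {B \<in> pi0 G. B \<subseteq> C}"
proof -
  have comp: "component_of (restrict_sgraph G C) v = component_of G v" if "v \<in> C" for v
    using reach_restrict_sgraph[OF assms(2) that] by (auto simp: mem_component_of)
  have "component_of G v \<subseteq> C" if "v \<in> C" for v
    using reach_closed[of G C, OF saturatedD(2)[OF assms(2)] _ that] by (auto simp: mem_component_of)
  moreover have "B \<in> component_of G ` C" if B: "B \<in> pi0 G" "B \<subseteq> C" for B
  proof -
    obtain v where "v \<in> B" using pi0_nonempty[OF B(1)] by blast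
    then show ?thesis using pi0_eq[OF assms(1) B(1)] B(2) by blast
  qed
  moreover have "component_of G v \<in> pi0 G" if "v \<in> C" for v
    using that saturatedD(1)[OF assms(2)] by auto
  ultimately have "component_of G ` C = {B \<in> pi0 G. B \<subseteq> C}" by auto
  then show ?thesis unfolding pi0_def[of "restrict_sgraph G C"] using comp by simp
qed

lemma feynman_restrict_sgraph:
  assumes "feynman_graph G" "saturated G C" shows "feynman_graph (restrict_sgraph G C)"
proof -
  have "finite C" using finite_subset[OF saturatedD(1)[OF assms(2)] feynman_graphD(1)[OF assms(1)]] .
  then show ?thesis
    using feynman_graphD[OF assms(1)] saturatedD(2)[OF assms(2)] unfolding feynman_graph_def by auto
qed

lemma dom_spec_restrict_sgraph:
  assumes "feynman_graph G" "saturated G C" "dom (spec G) = pi0 G"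
  shows "dom (spec (restrict_sgraph G C)) = pi0 (restrict_sgraph G C)"
  unfolding pi0_restrict_sgraph[OF assms(1,2)] using assms(3) by auto

lemma external_restrict_sgraph: "external (restrict_sgraph G C) = {e \<in> external G. bd G e \<in> C}"
  unfolding external_def by auto

lemma specified_restrict_sgraph:
  assumes S: "specified_graph T G" and C: "saturated G C"
  shows "specified_graph T (restrict_sgraph G C)"
proof -
  note G = specified_graphD[OF S]
  note pi0 = pi0_restrict_sgraph[OF G(1) C]
  let ?R = "restrict_sgraph G C"
  show ?thesis
    unfolding specified_graph_def
  proof (intro conjI ballI impI)
    show "feynman_graph ?R" by (rule feynman_restrict_sgraph[OF G(1) C])
    show "dom (spec ?R) = pi0 ?R" by (rule dom_spec_restrict_sgraph[OF G(1) C G(5)])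
    show "htype ?R ` halfs ?R \<subseteq> edge_types T" using G(3) by auto
    show "locally_one_PI ?R"
      unfolding locally_one_PI_iff[OF feynman_restrict_sgraph[OF G(1) C]]
    proof
      fix e assume "e \<in> halfs ?R"
      then have e: "e \<in> halfs G" "bd G e \<in> C" by simp_all
      \<comment> \<open>Cutting an edge keeps C closed, so the detour around the edge stays inside
        C.\<close>
      have sat: "saturated (cut_edge e G) C" using C unfolding saturated_def by simp
      have "(bd G e, bd G (invol G e)) \<in> reach (cut_edge e G)"
        using G(2) e(1) unfolding locally_one_PI_iff[OF G(1)] by blast
      then have *: "(bd G e, bd G (invol G e)) \<in> reach (restrict_sgraph (cut_edge e G) C)"
        using reach_restrict_sgraph[OF sat e(2)] by simp
      have "invol (cut_edge e ?R) = invol (restrict_sgraph (cut_edge e G) C)"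
        using e saturatedD(2)[OF C e] feynman_graphD(4)[OF G(1)] by (auto simp: fun_eq_iff)
      then have "adjacency (cut_edge e ?R) = adjacency (restrict_sgraph (cut_edge e G) C)"
        unfolding adjacency_def by simp
      then show "(bd ?R e, bd ?R (invol ?R e)) \<in> reach (cut_edge e ?R)"
        using * e by (simp add: reach_def)
    qed
  next
    fix v assume "v \<in> verts ?R"
    then have v: "v \<in> C" "v \<in> verts G" using saturatedD(1)[OF C] by auto
    have eq: "{e \<in> halfs ?R. bd ?R e = v} = {e \<in> halfs G. bd G e = v}" using v by auto
    then have "vertex_legs ?R v = vertex_legs G v" unfolding vertex_legs_def by simp
    then show "(vertex_legs ?R v, vindex ?R v) \<in> vertex_types T" using G(4)[OF v(2)] by simp
    assume "{e \<in> halfs ?R. bd ?R e = v} \<subseteq> external ?R"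
    then have "{e \<in> halfs G. bd G e = v} \<subseteq> external G"
      unfolding eq external_restrict_sgraph by blast
    then show "spec ?R {v} = Some (vindex ?R v)" using G(7)[OF v(2)] v(1) by simp
  next
    fix B assume "B \<in> pi0 ?R"
    then have B: "B \<in> pi0 G" "B \<subseteq> C" unfolding pi0 by blast+
    have "{e \<in> external ?R. bd ?R e \<in> B} = {e \<in> external G. bd G e \<in> B}"
      unfolding external_restrict_sgraph using B(2) by auto
    then have "residue_legs ?R B = residue_legs G B" unfolding residue_legs_def by simp
    then show "(residue_legs ?R B, the (spec ?R B)) \<in> vertex_types T" using G(6)[OF B(1)] B(2) by simp
  qed
qed

lemma (in covering) specified_subgraph_restrict:
  assumes "specified_subgraph d G" "saturated G C"
  shows "specified_subgraph (restrict_sgraph d C) (restrict_sgraph G C)"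
  unfolding specified_subgraph_def
proof (intro conjI ballI impI)
  show "covering_subgraph (restrict_sgraph d C) (restrict_sgraph G C)"
    by (rule covering_subgraphI) (use invol_sub in auto)
  fix B assume B: "B \<in> pi0 (restrict_sgraph d C) \<inter> pi0 (restrict_sgraph G C)"
    and e: "\<forall>e\<in>halfs (restrict_sgraph G C). bd (restrict_sgraph G C) e \<in> B \<longrightarrow>
      invol (restrict_sgraph d C) e = invol (restrict_sgraph G C) e"
  then have B': "B \<in> pi0 d" "B \<in> pi0 G" "B \<subseteq> C"
    unfolding pi0_restrict_sgraph[OF feynman assms(2)] pi0_restrict_sgraph[OF feynman_sub saturated_sub[OF assms(2)]]
    by blast+
  have "invol d e = invol G e" if "e \<in> halfs G" "bd G e \<in> B" for e
  proof -
    have "bd G e \<in> C" using that B'(3) by blast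
    then show ?thesis using e that by auto
  qed
  then have "spec d B = spec G B" using specified_subgraphD(2)[OF assms(1) B'(1,2)] by blast
  then show "spec (restrict_sgraph d C) B = spec (restrict_sgraph G C) B" using B'(3) by simp
qed

lemma sgraph_iso_restrict:
  assumes I: "sgraph_iso f k G H" and G: "feynman_graph G" and C: "saturated G C"
  shows "sgraph_iso f k (restrict_sgraph G C) (restrict_sgraph H (f ` C))"
proof -
  have eq: "bd H (k e) \<in> f ` C \<longleftrightarrow> bd G e \<in> C" if "e \<in> halfs G" for e
    using inj_on_image_mem_iff[OF sgraph_iso_inj_verts[OF I] _ saturatedD(1)[OF C]]
      sgraph_isoD(3)[OF I that] feynman_graphD(3)[OF G that] by simp
  have H: "halfs H = k ` halfs G" by (rule sgraph_iso_halfs[OF I])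
  have halfs: "{e \<in> halfs H. bd H e \<in> f ` C} = k ` {e \<in> halfs G. bd G e \<in> C}"
  proof -
    have "{e \<in> halfs H. bd H e \<in> f ` C} = k ` {e \<in> halfs G. bd H (k e) \<in> f ` C}" unfolding H by blast
    also have "{e \<in> halfs G. bd H (k e) \<in> f ` C} = {e \<in> halfs G. bd G e \<in> C}"
      using eq by (intro Collect_cong) (simp cong: conj_cong)
    finally show ?thesis .
  qed
  show ?thesis
    unfolding sgraph_iso_def
  proof (intro conjI ballI)
    show "bij_betw f (verts (restrict_sgraph G C)) (verts (restrict_sgraph H (f ` C)))"
      using inj_on_subset[OF sgraph_iso_inj_verts[OF I] saturatedD(1)[OF C]] by (simp add: bij_betw_def)
    have "inj_on k {e \<in> halfs G. bd G e \<in> C}"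
      by (rule inj_on_subset[OF sgraph_iso_inj[OF I]]) blast
    then show "bij_betw k (halfs (restrict_sgraph G C)) (halfs (restrict_sgraph H (f ` C)))"
      using halfs by (simp add: bij_betw_def)
    fix e assume "e \<in> halfs (restrict_sgraph G C)"
    then have e: "e \<in> halfs G" "bd G e \<in> C" by simp_all
    have "k e \<in> halfs H" "bd H (k e) \<in> f ` C" using e eq[OF e(1)] H by blast+
    then show "bd (restrict_sgraph H (f ` C)) (k e) = f (bd (restrict_sgraph G C) e)"
      "invol (restrict_sgraph H (f ` C)) (k e) = k (invol (restrict_sgraph G C) e)"
      "htype (restrict_sgraph H (f ` C)) (k e) = htype (restrict_sgraph G C) e"
      using sgraph_isoD(3-5)[OF I e(1)] e by simp_all
  next
    fix v assume "v \<in> verts (restrict_sgraph G C)"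
    then show "vindex (restrict_sgraph H (f ` C)) (f v) = vindex (restrict_sgraph G C) v"
      using sgraph_isoD(6)[OF I] saturatedD(1)[OF C] by auto
  next
    fix B assume "B \<in> pi0 (restrict_sgraph G C)"
    then have "B \<in> pi0 G" "B \<subseteq> C" unfolding pi0_restrict_sgraph[OF G C] by blast+
    then show "spec (restrict_sgraph H (f ` C)) (f ` B) = spec (restrict_sgraph G C) B"
      using sgraph_isoD(7)[OF I] by (simp add: image_mono)
  qed
qed

lemma graph_pair_restrict:
  assumes "graph_pair (G, g)" "saturated G C"
  shows "graph_pair (restrict_sgraph G C, restrict_sgraph g C)"
proof -
  note G = graph_pairD[OF assms(1)]
  interpret covering G g by (rule G(7))
  note s = assms(2) saturated_sub[OF assms(2)]
  show ?thesis
    unfolding graph_pair_def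
    using feynman_restrict_sgraph[OF G(1) s(1)] feynman_restrict_sgraph[OF G(2) s(2)]
      dom_spec_restrict_sgraph[OF G(1) s(1) G(3)] dom_spec_restrict_sgraph[OF G(2) s(2) G(4)]
      specified_subgraph_restrict[OF G(5) s(1)] by simp
qed

lemma F_pair_restrict:
  assumes "D_pair T (G, g)" "C \<in> pi0 G"
  shows "F_pair T (restrict_sgraph G C, restrict_sgraph g C)"
proof -
  interpret covering G g by (rule covering_D_pair[OF assms(1)])
  have C: "saturated G C" by (rule saturated_pi0[OF feynman assms(2)])
  have "pi0 (restrict_sgraph G C) = {C}"
  proof -
    have "B = C" if "B \<in> pi0 G" "B \<subseteq> C" for B
      using pi0_disjoint[OF feynman that(1) assms(2)] pi0_nonempty[OF that(1)] that(2) by blast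
    then show ?thesis unfolding pi0_restrict_sgraph[OF feynman C] using assms(2) by blast
  qed
  then have "connected_graph (restrict_sgraph G C)" unfolding connected_graph_def by simp
  moreover have S: "specified_graph T G" "specified_graph T g" "specified_subgraph g G"
    using assms(1) unfolding D_pair_iff by simp_all
  ultimately show ?thesis
    unfolding F_pair_iff D_pair_iff
    using specified_restrict_sgraph[OF S(1) C] specified_restrict_sgraph[OF S(2) saturated_sub[OF C]]
      specified_subgraph_restrict[OF S(3) C] by simp
qed

section \<open>The multiset of components as a complete invariant\<close>

lemma component_classes_in_D'_basis:
  assumes "D_pair T (G, g)" shows "component_classes (G, g) \<in> D'_basis T"
proof -
  have "finite (pi0 G)" by (rule finite_pi0[OF covering.feynman[OF covering_D_pair[OF assms]]])
  then have "set_mset (component_classes (G, g)) =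
      (\<lambda>C. pair_class (restrict_sgraph G C, restrict_sgraph g C)) ` pi0 G"
    unfolding component_classes_def by simp
  then show ?thesis
    unfolding D'_basis_def using F_basisI[OF F_pair_restrict[OF assms]] by (simp add: image_subset_iff)
qed

lemma component_classes_iso:
  assumes "pair_iso P Q" "graph_pair P" "graph_pair Q"
  shows "component_classes P = component_classes Q"
proof -
  obtain G g H h where PQ: "P = (G, g)" "Q = (H, h)" by (cases P, cases Q) auto
  note G = graph_pairD[OF assms(2)[unfolded PQ]] and H = graph_pairD[OF assms(3)[unfolded PQ]]
  interpret covering G g by (rule G(7))
  obtain f k where fk: "sgraph_iso f k G H" "sgraph_iso f k g h"
    using assms(1) unfolding PQ by (rule pair_isoE)
  have "inj_on ((`) f) (pi0 G)"
    using inj_on_image_eq_iff[OF sgraph_iso_inj_verts[OF fk(1)]] pi0_subset[OF G(1)]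
    by (intro inj_onI) auto
  moreover have "pair_class (restrict_sgraph H (f ` C), restrict_sgraph h (f ` C)) =
      pair_class (restrict_sgraph G C, restrict_sgraph g C)" if C: "C \<in> pi0 G" for C
  proof (rule pair_class_eqI[symmetric])
    have sat: "saturated G C" by (rule saturated_pi0[OF G(1) C])
    have "f ` C \<in> pi0 H" using pi0_image[OF fk(1) G(1) H(1)] C by simp
    then have sat': "saturated H (f ` C)" by (rule saturated_pi0[OF H(1)])
    show "graph_pair (restrict_sgraph G C, restrict_sgraph g C)"
      by (rule graph_pair_restrict[OF assms(2)[unfolded PQ] sat])
    show "graph_pair (restrict_sgraph H (f ` C), restrict_sgraph h (f ` C))"
      by (rule graph_pair_restrict[OF assms(3)[unfolded PQ] sat'])
    show "pair_iso (restrict_sgraph G C, restrict_sgraph g C) (restrict_sgraph H (f ` C), restrict_sgraph h (f ` C))"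
      by (rule pair_isoI[OF sgraph_iso_restrict[OF fk(1) G(1) sat] sgraph_iso_restrict[OF fk(2) G(2) saturated_sub[OF sat]]])
  qed
  ultimately show ?thesis
    unfolding PQ component_classes_def prod.case pi0_image[OF fk(1) G(1) H(1)]
    by (rule image_mset_image[symmetric])
qed

text \<open>This turns equality of multisets of component classes into a matching of the components
  that preserves classes. The induction removes x from A together with some y of the same label from
  B.\<close>

lemma image_mset_eq_imp_bij_betw:
  assumes "finite A" "finite B" "image_mset f (mset_set A) = image_mset g (mset_set B)"
  obtains \<pi> where "bij_betw \<pi> A B" "\<And>x. x \<in> A \<Longrightarrow> g (\<pi> x) = f x"
proof -
  have "\<exists>\<pi>. bij_betw \<pi> A B \<and> (\<forall>x\<in>A. g (\<pi> x) = f x)"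
    using assms
  proof (induction A arbitrary: B rule: finite_induct)
    case empty
    then have "B = {}" by (simp add: mset_set_empty_iff)
    then show ?case by (auto simp: bij_betw_def)
  next
    case (insert x A)
    then have eq: "add_mset (f x) (image_mset f (mset_set A)) = image_mset g (mset_set B)" by simp
    then have "f x \<in># image_mset g (mset_set B)" by (metis union_single_eq_member)
    then obtain y where y: "y \<in> B" "g y = f x" using insert.prems(1) by auto
    then have "mset_set B = add_mset y (mset_set (B - {y}))"
      using insert.prems(1) by (metis mset_set.remove)
    with eq y have "image_mset f (mset_set A) = image_mset g (mset_set (B - {y}))" by simp
    from insert.IH[OF _ this] insert.prems(1)
    obtain \<pi> where \<pi>: "bij_betw \<pi> A (B - {y})" "\<forall>x\<in>A. g (\<pi> x) = f x" by auto
    have "bij_betw (\<pi>(x := y)) A (B - {y})"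
      using \<pi>(1) by (rule bij_betw_cong[THEN iffD1, rotated]) (use insert.hyps(2) in auto)
    then have "bij_betw (\<pi>(x := y)) (insert x A) (insert y (B - {y}))"
      using insert.hyps(2) by (intro bij_betw_combine[of _ "{x}" "{y}", simplified]) auto
    then have "bij_betw (\<pi>(x := y)) (insert x A) B" using y(1) by (simp add: insert_absorb)
    moreover have "\<forall>z\<in>insert x A. g ((\<pi>(x := y)) z) = f z" using \<pi>(2) y(2) by simp
    ultimately show ?case by blast
  qed
  then show thesis using that by blast
qed

text \<open>The pieces are cut along the components of G although the glued graph is g, which may
  have more of them. The glued maps are formed from G alone, so gluing g and gluing G yield the same
  maps.\<close>

lemma sgraph_iso_glue:
  assumes "covering G g" "covering H h" and \<pi>: "bij_betw \<pi> (pi0 G) (pi0 H)"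
    and iso: "\<And>C. C \<in> pi0 G \<Longrightarrow> sgraph_iso (f C) (k C) (restrict_sgraph g C) (restrict_sgraph h (\<pi> C))"
  shows "sgraph_iso (\<lambda>v. f (component_of G v) v) (\<lambda>e. k (component_of G (bd G e)) e) g h"
proof -
  interpret G: covering G g by fact
  interpret H: covering H h by fact
  let ?f = "\<lambda>v. f (component_of G v) v" and ?k = "\<lambda>e. k (component_of G (bd G e)) e"
  have comp: "component_of G v = C" if "C \<in> pi0 G" "v \<in> C" for C v
    using pi0_eq[OF G.feynman that] by simp
  have \<pi>0: "\<pi> C \<in> pi0 H" if "C \<in> pi0 G" for C using \<pi> that by (auto simp: bij_betw_def)
  have disj: "\<pi> C \<inter> \<pi> D = {}" if CD: "C \<in> pi0 G" "D \<in> pi0 G" "C \<noteq> D" for C D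
  proof -
    have "\<pi> C \<noteq> \<pi> D" using CD \<pi> by (auto simp: bij_betw_def inj_on_def)
    then show ?thesis using pi0_disjoint[OF H.feynman \<pi>0[OF CD(1)] \<pi>0[OF CD(2)]] by blast
  qed
  have vG: "verts G = (\<Union>C\<in>pi0 G. C)" and vH: "verts H = (\<Union>C\<in>pi0 G. \<pi> C)"
    using Union_pi0[OF G.feynman] Union_pi0[OF H.feynman] bij_betw_imp_surj_on[OF \<pi>] by simp_all
  have hG: "halfs G = (\<Union>C\<in>pi0 G. {e \<in> halfs G. bd G e \<in> C})"
    using feynman_graphD(3)[OF G.feynman] vG by blast
  have hH: "halfs H = (\<Union>C\<in>pi0 G. {e \<in> halfs H. bd H e \<in> \<pi> C})"
    using feynman_graphD(3)[OF H.feynman] vH by blast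
  have loc: "component_of G (bd G e) \<in> pi0 G" "bd G e \<in> component_of G (bd G e)" if "e \<in> halfs G" for e
    using feynman_graphD(3)[OF G.feynman that] by simp_all
  show ?thesis
    unfolding sgraph_iso_def
  proof (intro conjI ballI)
    have "bij_betw ?f C (\<pi> C)" if "C \<in> pi0 G" for C
    proof -
      have "bij_betw ?f C (\<pi> C) = bij_betw (f C) C (\<pi> C)"
        by (rule bij_betw_cong) (simp add: comp[OF that])
      then show ?thesis using sgraph_isoD(1)[OF iso[OF that]] by simp
    qed
    then have "bij_betw ?f (\<Union>C\<in>pi0 G. C) (\<Union>C\<in>pi0 G. \<pi> C)"
      by (rule bij_betw_UNION_disjoint[rotated]) (use disj in \<open>auto simp: disjoint_family_on_def\<close>)
    then show "bij_betw ?f (verts g) (verts h)" using vG vH by simp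
    have "bij_betw ?k {e \<in> halfs G. bd G e \<in> C} {e \<in> halfs H. bd H e \<in> \<pi> C}" if "C \<in> pi0 G" for C
    proof -
      have "bij_betw ?k {e \<in> halfs G. bd G e \<in> C} {e \<in> halfs H. bd H e \<in> \<pi> C} =
          bij_betw (k C) {e \<in> halfs G. bd G e \<in> C} {e \<in> halfs H. bd H e \<in> \<pi> C}"
        by (rule bij_betw_cong) (simp add: comp[OF that])
      then show ?thesis using sgraph_isoD(2)[OF iso[OF that]] by simp
    qed
    then have "bij_betw ?k (\<Union>C\<in>pi0 G. {e \<in> halfs G. bd G e \<in> C}) (\<Union>C\<in>pi0 G. {e \<in> halfs H. bd H e \<in> \<pi> C})"
      by (rule bij_betw_UNION_disjoint[rotated]) (use disj in \<open>auto simp: disjoint_family_on_def\<close>)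
    then show "bij_betw ?k (halfs g) (halfs h)" using hG hH by simp
    fix e assume "e \<in> halfs g"
    then have e: "e \<in> halfs G" by simp
    define C where "C = component_of G (bd G e)"
    have C: "C \<in> pi0 G" "bd G e \<in> C" unfolding C_def using loc[OF e] by blast+
    note I = iso[OF C(1)]
    have eC: "e \<in> halfs (restrict_sgraph g C)" using e C(2) by simp
    have "k C e \<in> halfs (restrict_sgraph h (\<pi> C))" using sgraph_iso_halfs[OF I] eC by blast
    then have kC: "k C e \<in> halfs H" "bd H (k C e) \<in> \<pi> C" by simp_all
    \<comment> \<open>The partner half-edge sits in the same component of G, so the same local map
      is used for it.\<close>
    have "bd G (invol g e) \<in> C"
      using G.invol_sub[of e] C pi0_closed[OF G.feynman C(1) e] by metis
    then have "component_of G (bd G (invol g e)) = C" by (rule comp[OF C(1)])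
    then show "bd h (?k e) = ?f (bd g e)" "invol h (?k e) = ?k (invol g e)" "htype h (?k e) = htype g e"
      using sgraph_isoD(3-5)[OF I eC] kC e C(2) by (simp_all flip: C_def)
  next
    fix v assume "v \<in> verts g"
    then have C: "component_of G v \<in> pi0 G" by simp
    then show "vindex h (?f v) = vindex g v" using sgraph_isoD(6)[OF iso[OF C], of v] by simp
  next
    \<comment> \<open>B may be smaller than the component C of G around it; the restriction to C
      still retains its specification.\<close>
    fix B assume B: "B \<in> pi0 g"
    then obtain v where v: "v \<in> verts G" "B = component_of g v" unfolding pi0_def by auto
    define C where "C = component_of G v"
    have C: "C \<in> pi0 G" unfolding C_def using v(1) by simp
    have BC: "B \<subseteq> C" unfolding C_def v(2) by (rule G.component_of_sub)
    have "B \<in> pi0 (restrict_sgraph g C)"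
      unfolding pi0_restrict_sgraph[OF G.feynman_sub G.saturated_sub[OF saturated_pi0[OF G.feynman C]]]
      using B BC by blast
    from sgraph_isoD(7)[OF iso[OF C] this]
    have "spec (restrict_sgraph h (\<pi> C)) (f C ` B) = spec g B" using BC by simp
    moreover have "f C ` B \<subseteq> \<pi> C"
      using sgraph_iso_verts[OF iso[OF C]] BC by auto
    moreover have "?f ` B = f C ` B" using comp[OF C] BC by (intro image_cong) auto
    ultimately show "spec h (?f ` B) = spec g B" by simp
  qed
qed

text \<open>This lets the gluing lemma be applied to G inside itself.\<close>

lemma covering_refl: "feynman_graph G \<Longrightarrow> covering G G"
  by (rule coveringI) (simp_all add: covering_subgraph_def)

text \<open>Equal classes of pairs provide, on each matched component, one pair of maps that serves
  G and g together. The glued maps for G and for g are then identical, which makes them an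
  isomorphism of pairs.\<close>

lemma component_classes_eqD:
  assumes "graph_pair P" "graph_pair Q" "component_classes P = component_classes Q"
  shows "pair_iso P Q"
proof -
  obtain G g H h where PQ: "P = (G, g)" "Q = (H, h)" by (cases P, cases Q) auto
  note GP = assms(1)[unfolded PQ] and HP = assms(2)[unfolded PQ]
  note G = graph_pairD[OF GP] and H = graph_pairD[OF HP]
  obtain \<pi> where \<pi>: "bij_betw \<pi> (pi0 G) (pi0 H)" and
    cls: "\<And>C. C \<in> pi0 G \<Longrightarrow> pair_class (restrict_sgraph H (\<pi> C), restrict_sgraph h (\<pi> C)) =
      pair_class (restrict_sgraph G C, restrict_sgraph g C)"
    by (rule image_mset_eq_imp_bij_betw[OF finite_pi0[OF G(1)] finite_pi0[OF H(1)]
          assms(3)[unfolded PQ component_classes_def prod.case]]) blast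
  have "\<exists>f k. sgraph_iso f k (restrict_sgraph G C) (restrict_sgraph H (\<pi> C)) \<and>
      sgraph_iso f k (restrict_sgraph g C) (restrict_sgraph h (\<pi> C))" if C: "C \<in> pi0 G" for C
  proof -
    have "\<pi> C \<in> pi0 H" using \<pi> C by (auto simp: bij_betw_def)
    then have "pair_iso (restrict_sgraph G C, restrict_sgraph g C) (restrict_sgraph H (\<pi> C), restrict_sgraph h (\<pi> C))"
      by (intro pair_class_eqD graph_pair_restrict[OF GP] graph_pair_restrict[OF HP]
          saturated_pi0[OF G(1) C] saturated_pi0[OF H(1)] cls[OF C, symmetric])
    then show ?thesis unfolding pair_iso_def by simp
  qed
  then obtain f k where fk: "\<And>C. C \<in> pi0 G \<Longrightarrow> sgraph_iso (f C) (k C) (restrict_sgraph G C) (restrict_sgraph H (\<pi> C))"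
    "\<And>C. C \<in> pi0 G \<Longrightarrow> sgraph_iso (f C) (k C) (restrict_sgraph g C) (restrict_sgraph h (\<pi> C))"
    by metis
  show ?thesis
    unfolding PQ
    by (rule pair_isoI[OF sgraph_iso_glue[OF covering_refl[OF G(1)] covering_refl[OF H(1)] \<pi> fk(1)]
          sgraph_iso_glue[OF G(7) H(7) \<pi> fk(2)]])
qed

lemma component_classes_connected:
  assumes "graph_pair (G, g)" "connected_graph G"
  shows "component_classes (G, g) = {#pair_class (G, g)#}"
proof -
  note G = graph_pairD[OF assms(1)]
  interpret covering G g by (rule G(7))
  obtain C where "pi0 G = {C}" using assms(2) unfolding connected_graph_def is_singleton_def by auto
  then have pi0: "pi0 G = {verts G}" using Union_pi0[OF G(1)] by simp
  have sat: "saturated G (verts G)" by (rule saturated_pi0[OF G(1)]) (simp add: pi0)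
  have "sgraph_iso (\<lambda>x. x) (\<lambda>x. x) (restrict_sgraph H (verts H)) H"
    if H: "feynman_graph H" "saturated H (verts H)" for H :: "('a, 'b, 'c) sgraph"
  proof -
    have "{e \<in> halfs H. bd H e \<in> verts H} = halfs H" using feynman_graphD(3)[OF H(1)] by auto
    then show ?thesis
      unfolding sgraph_iso_def pi0_restrict_sgraph[OF H] using feynman_graphD(3)[OF H(1)]
      by (auto simp: bij_betw_def)
  qed
  from this[OF G(1) sat] this[OF G(2)] saturated_sub[OF sat]
  have "pair_iso (restrict_sgraph G (verts G), restrict_sgraph g (verts G)) (G, g)"
    by (intro pair_isoI) simp_all
  then have "pair_class (restrict_sgraph G (verts G), restrict_sgraph g (verts G)) = pair_class (G, g)"
    by (intro pair_class_eqI graph_pair_restrict assms(1) sat)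
  then show ?thesis unfolding component_classes_def by (simp add: pi0)
qed


section \<open>Disjoint unions\<close>

lemma disjoint_union_simps [simp]:
  "verts (disjoint_union G H) = verts G <+> verts H" "halfs (disjoint_union G H) = halfs G <+> halfs H"
  "bd (disjoint_union G H) = map_sum (bd G) (bd H)"
  "invol (disjoint_union G H) = map_sum (invol G) (invol H)"
  "htype (disjoint_union G H) = case_sum (htype G) (htype H)"
  "vindex (disjoint_union G H) = case_sum (vindex G) (vindex H)"
  by (simp_all add: disjoint_union_def)

lemma Inl_image_eq_Inr_image [simp]:
  "Inl ` C = Inr ` D \<longleftrightarrow> C = {} \<and> D = {}" "Inr ` D = Inl ` C \<longleftrightarrow> C = {} \<and> D = {}"
  by blast+

lemma spec_disjoint_union_Inl [simp]: "spec (disjoint_union G H) (Inl ` C) = spec G C"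
  by (auto simp: disjoint_union_def inj_vimage_image_eq)

text \<open>The empty set lies in both ranges and is read from the left graph, whence the
  restriction to nonempty C. Components are never empty.\<close>

lemma spec_disjoint_union_Inr: "C \<noteq> {} \<Longrightarrow> spec (disjoint_union G H) (Inr ` C) = spec H C"
  by (auto simp: disjoint_union_def inj_vimage_image_eq)

lemma spec_disjoint_union_None:
  "\<not> K \<subseteq> range Inl \<Longrightarrow> \<not> K \<subseteq> range Inr \<Longrightarrow> spec (disjoint_union G H) K = None"
  by (simp add: disjoint_union_def)

lemma ball_Plus: "(\<forall>x\<in>A <+> B. P x) \<longleftrightarrow> (\<forall>a\<in>A. P (Inl a)) \<and> (\<forall>b\<in>B. P (Inr b))"
  by (auto simp: Plus_def)

lemma component_of_disjoint_union [simp]: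
  "component_of (disjoint_union G H) (Inl u) = Inl ` component_of G u"
  "component_of (disjoint_union G H) (Inr v) = Inr ` component_of H v"
proof -
  have l: "\<exists>w. (u, w) \<in> reach G \<and> x = Inl w" if "(Inl u, x) \<in> reach (disjoint_union G H)" for x
    using that
  proof (induction rule: reach_induct)
    case (step e)
    then obtain w where w: "bd (disjoint_union G H) e = Inl w" "(u, w) \<in> reach G" by blast
    then obtain f where f: "e = Inl f" "bd G f = w" by (cases e) auto
    then show ?case using step.hyps(1) w(2) reach_edge[of f G] by (auto intro: reach_trans)
  qed simp
  have r: "\<exists>w. (v, w) \<in> reach H \<and> x = Inr w" if "(Inr v, x) \<in> reach (disjoint_union G H)" for x
    using that
  proof (induction rule: reach_induct)
    case (step e)
    then obtain w where w: "bd (disjoint_union G H) e = Inr w" "(v, w) \<in> reach H" by blast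
    then obtain f where f: "e = Inr f" "bd H f = w" by (cases e) auto
    then show ?case using step.hyps(1) w(2) reach_edge[of f H] by (auto intro: reach_trans)
  qed simp
  have l': "(Inl u, Inl w) \<in> reach (disjoint_union G H)" if "(u, w) \<in> reach G" for w
    using that
  proof (rule reach_hom[where G = G and \<phi> = Inl, rotated])
    fix e assume "e \<in> halfs G"
    then show "(Inl (bd G e), Inl (bd G (invol G e))) \<in> reach (disjoint_union G H)"
      using reach_edge[of "Inl e" "disjoint_union G H"] by auto
  qed
  have r': "(Inr v, Inr w) \<in> reach (disjoint_union G H)" if "(v, w) \<in> reach H" for w
    using that
  proof (rule reach_hom[where G = H and \<phi> = Inr, rotated])
    fix e assume "e \<in> halfs H"
    then show "(Inr (bd H e), Inr (bd H (invol H e))) \<in> reach (disjoint_union G H)"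
      using reach_edge[of "Inr e" "disjoint_union G H"] by auto
  qed
  show "component_of (disjoint_union G H) (Inl u) = Inl ` component_of G u"
    using l l' by (auto simp: mem_component_of image_iff Bex_def)
  show "component_of (disjoint_union G H) (Inr v) = Inr ` component_of H v"
    using r r' by (auto simp: mem_component_of image_iff Bex_def)
qed

lemma pi0_disjoint_union: "pi0 (disjoint_union G H) = (`) Inl ` pi0 G \<union> (`) Inr ` pi0 H"
  by (simp add: pi0_def Plus_def image_Un image_image)

lemma feynman_disjoint_union:
  "feynman_graph (disjoint_union G H) \<longleftrightarrow> feynman_graph G \<and> feynman_graph H"
  unfolding feynman_graph_def
  by (simp add: ball_Plus split_sum_all image_subset_iff) blast

lemma external_disjoint_union: "external (disjoint_union G H) = external G <+> external H"
  unfolding external_def by auto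

lemma reach_disjoint_union [simp]:
  "(Inl u, Inl v) \<in> reach (disjoint_union G H) \<longleftrightarrow> (u, v) \<in> reach G"
  "(Inr x, Inr y) \<in> reach (disjoint_union G H) \<longleftrightarrow> (x, y) \<in> reach H"
  by (simp_all flip: mem_component_of add: inj_image_mem_iff)

lemma cut_edge_disjoint_union:
  "cut_edge (Inl e) (disjoint_union G H) = disjoint_union (cut_edge e G) H"
  "cut_edge (Inr f) (disjoint_union G H) = disjoint_union G (cut_edge f H)"
  by (auto simp: cut_edge_def disjoint_union_def fun_eq_iff split_sum_all)

lemma locally_one_PI_disjoint_union:
  assumes "feynman_graph G" "feynman_graph H"
  shows "locally_one_PI (disjoint_union G H) \<longleftrightarrow> locally_one_PI G \<and> locally_one_PI H"
proof -
  have "feynman_graph (disjoint_union G H)" using assms feynman_disjoint_union by blast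
  then show ?thesis
    using assms by (simp add: locally_one_PI_iff ball_Plus cut_edge_disjoint_union)
qed

lemma vertex_legs_disjoint_union [simp]:
  "vertex_legs (disjoint_union G H) (Inl u) = vertex_legs G u"
  "vertex_legs (disjoint_union G H) (Inr v) = vertex_legs H v"
proof -
  have "{e \<in> halfs G <+> halfs H. map_sum (bd G) (bd H) e = Inl u} = Inl ` {e \<in> halfs G. bd G e = u}"
    "{e \<in> halfs G <+> halfs H. map_sum (bd G) (bd H) e = Inr v} = Inr ` {e \<in> halfs H. bd H e = v}"
    by auto
  then show "vertex_legs (disjoint_union G H) (Inl u) = vertex_legs G u"
    "vertex_legs (disjoint_union G H) (Inr v) = vertex_legs H v"
    unfolding vertex_legs_def by (simp_all add: image_mset_image)
qed

lemma residue_legs_disjoint_union [simp]: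
  "residue_legs (disjoint_union G H) (Inl ` C) = residue_legs G C"
  "residue_legs (disjoint_union G H) (Inr ` D) = residue_legs H D"
proof -
  have "{e \<in> external G <+> external H. map_sum (bd G) (bd H) e \<in> Inl ` C} = Inl ` {e \<in> external G. bd G e \<in> C}"
    "{e \<in> external G <+> external H. map_sum (bd G) (bd H) e \<in> Inr ` D} = Inr ` {e \<in> external H. bd H e \<in> D}"
    by auto
  then show "residue_legs (disjoint_union G H) (Inl ` C) = residue_legs G C"
    "residue_legs (disjoint_union G H) (Inr ` D) = residue_legs H D"
    unfolding residue_legs_def external_disjoint_union by (simp_all add: image_mset_image)
qed

text \<open>The value of \<open>spec H\<close> at the empty set is invisible in the union, where
  that set is read from the left graph. It is therefore assumed to be undefined, as it is whenever
  the domain is the set of components.\<close>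

lemma dom_spec_disjoint_union:
  assumes "spec H {} = None"
  shows "dom (spec (disjoint_union G H)) = pi0 (disjoint_union G H) \<longleftrightarrow>
    dom (spec G) = pi0 G \<and> dom (spec H) = pi0 H"
proof -
  let ?U = "disjoint_union G H"
  have Inr_eq: "spec ?U (Inr ` C) = spec H C" if "C \<noteq> {}" for C
    using that by (rule spec_disjoint_union_Inr)
  have pl: "Inl ` C \<in> pi0 ?U \<longleftrightarrow> C \<in> pi0 G" for C
    using pi0_nonempty[of _ H] unfolding pi0_disjoint_union
    by (auto simp: image_iff inj_image_eq_iff)
  have pr: "Inr ` C \<in> pi0 ?U \<longleftrightarrow> C \<in> pi0 H" for C
    using pi0_nonempty[of _ G] unfolding pi0_disjoint_union
    by (auto simp: image_iff inj_image_eq_iff)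
  show ?thesis
  proof
    assume d: "dom (spec ?U) = pi0 ?U"
    have "C \<in> dom (spec G) \<longleftrightarrow> C \<in> pi0 G" for C
      using d pl[of C] spec_disjoint_union_Inl[of G H C] by (metis domIff)
    moreover have "C \<in> dom (spec H) \<longleftrightarrow> C \<in> pi0 H" for C
      using d pr[of C] Inr_eq[of C] assms pi0_nonempty[of C H] by (metis domIff)
    ultimately show "dom (spec G) = pi0 G \<and> dom (spec H) = pi0 H" by blast
  next
    assume d: "dom (spec G) = pi0 G \<and> dom (spec H) = pi0 H"
    have "K \<in> dom (spec ?U) \<longleftrightarrow> K \<in> pi0 ?U" for K
    proof -
      \<comment> \<open>A set of vertices is purely left, or purely right and nonempty, or mixed. A
        mixed set is neither a component nor in the domain of the specification.\<close>
      consider C where "K = Inl ` C" | C where "K = Inr ` C" "C \<noteq> {}"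
        | "\<not> K \<subseteq> range Inl" "\<not> K \<subseteq> range Inr"
        by (metis image_empty subset_image_iff)
      then show ?thesis
      proof cases
        case 1
        then show ?thesis using d pl by (metis domIff spec_disjoint_union_Inl)
      next
        case 2
        then show ?thesis using d pr Inr_eq by (metis domIff)
      next
        case 3
        then have "K \<notin> pi0 ?U" unfolding pi0_disjoint_union by blast
        then show ?thesis using spec_disjoint_union_None[OF 3] by (simp add: domIff)
      qed
    qed
    then show "dom (spec ?U) = pi0 ?U" by blast
  qed
qed

lemma isolated_disjoint_union:
  "{e \<in> halfs (disjoint_union G H). bd (disjoint_union G H) e = Inl u} \<subseteq> external (disjoint_union G H)
    \<longleftrightarrow> {e \<in> halfs G. bd G e = u} \<subseteq> external G"
  "{e \<in> halfs (disjoint_union G H). bd (disjoint_union G H) e = Inr v} \<subseteq> external (disjoint_union G H)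
    \<longleftrightarrow> {e \<in> halfs H. bd H e = v} \<subseteq> external H"
  unfolding external_disjoint_union by (auto simp: subset_iff Plus_def)

text \<open>Each clause splits over the summands. One direction assembles subgraphs of a union, the
  other shows that the two parts of such a subgraph are specified graphs themselves.\<close>

lemma specified_disjoint_union:
  assumes "spec H {} = None"
  shows "specified_graph T (disjoint_union G H) \<longleftrightarrow> specified_graph T G \<and> specified_graph T H"
proof (cases "feynman_graph G \<and> feynman_graph H")
  case True
  let ?U = "disjoint_union G H"
  have V: "(\<forall>v\<in>verts ?U. (vertex_legs ?U v, vindex ?U v) \<in> vertex_types T) \<longleftrightarrow>
      (\<forall>v\<in>verts G. (vertex_legs G v, vindex G v) \<in> vertex_types T) \<and>
      (\<forall>v\<in>verts H. (vertex_legs H v, vindex H v) \<in> vertex_types T)"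
    by (simp add: ball_Plus)
  have E: "htype ?U ` halfs ?U \<subseteq> edge_types T \<longleftrightarrow>
      htype G ` halfs G \<subseteq> edge_types T \<and> htype H ` halfs H \<subseteq> edge_types T"
    by (simp add: image_subset_iff ball_Plus)
  have R: "(\<forall>C\<in>pi0 ?U. (residue_legs ?U C, the (spec ?U C)) \<in> vertex_types T) \<longleftrightarrow>
      (\<forall>C\<in>pi0 G. (residue_legs G C, the (spec G C)) \<in> vertex_types T) \<and>
      (\<forall>C\<in>pi0 H. (residue_legs H C, the (spec H C)) \<in> vertex_types T)"
    unfolding pi0_disjoint_union ball_Un
    using spec_disjoint_union_Inr[of _ G H] pi0_nonempty[of _ H] by simp
  have s: "spec ?U {Inl u} = spec G {u}" "spec ?U {Inr v} = spec H {v}" for u v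
    using spec_disjoint_union_Inl[of G H "{u}"] spec_disjoint_union_Inr[of "{v}" G H] by simp_all
  have I: "(\<forall>v\<in>verts ?U. {e \<in> halfs ?U. bd ?U e = v} \<subseteq> external ?U \<longrightarrow> spec ?U {v} = Some (vindex ?U v)) \<longleftrightarrow>
      (\<forall>v\<in>verts G. {e \<in> halfs G. bd G e = v} \<subseteq> external G \<longrightarrow> spec G {v} = Some (vindex G v)) \<and>
      (\<forall>v\<in>verts H. {e \<in> halfs H. bd H e = v} \<subseteq> external H \<longrightarrow> spec H {v} = Some (vindex H v))"
    unfolding disjoint_union_simps(1) ball_Plus isolated_disjoint_union s by simp
  show ?thesis
    unfolding specified_graph_def V E R I dom_spec_disjoint_union[OF assms] feynman_disjoint_union
    using locally_one_PI_disjoint_union[of G H] True by blast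
next
  case False
  then show ?thesis using feynman_disjoint_union[of G H] unfolding specified_graph_def by blast
qed

lemma covering_disjoint_union:
  assumes "covering_subgraph a g" "covering_subgraph b h"
  shows "covering_subgraph (disjoint_union a b) (disjoint_union g h)"
proof (rule covering_subgraphI)
  fix e show "invol (disjoint_union a b) e = e \<or> invol (disjoint_union a b) e = invol (disjoint_union g h) e"
    using covering_subgraphD(6)[OF assms(1)] covering_subgraphD(6)[OF assms(2)] by (cases e) simp_all
qed (simp_all add: covering_subgraphD(1-5)[OF assms(1)] covering_subgraphD(1-5)[OF assms(2)])

lemma specified_subgraph_disjoint_union:
  assumes a: "covering_subgraph a g" and b: "covering_subgraph b h"
  shows "specified_subgraph (disjoint_union a b) (disjoint_union g h) \<longleftrightarrow>
    specified_subgraph a g \<and> specified_subgraph b h"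
proof -
  have int: "pi0 (disjoint_union a b) \<inter> pi0 (disjoint_union g h) =
      (`) Inl ` (pi0 a \<inter> pi0 g) \<union> (`) Inr ` (pi0 b \<inter> pi0 h)"
  proof -
    have "((`) Inl ` pi0 a \<union> (`) Inr ` pi0 b) \<inter> ((`) Inl ` pi0 g \<union> (`) Inr ` pi0 h) =
      (`) Inl ` (pi0 a \<inter> pi0 g) \<union> (`) Inr ` (pi0 b \<inter> pi0 h)"
      using pi0_nonempty[of _ a] pi0_nonempty[of _ b] by (auto simp: inj_image_eq_iff)
    then show ?thesis unfolding pi0_disjoint_union .
  qed
  have l: "(\<forall>e\<in>halfs (disjoint_union g h). bd (disjoint_union g h) e \<in> Inl ` C \<longrightarrow>
      invol (disjoint_union a b) e = invol (disjoint_union g h) e) \<longleftrightarrow>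
    (\<forall>e\<in>halfs g. bd g e \<in> C \<longrightarrow> invol a e = invol g e)" for C
    by (auto simp: ball_Plus)
  have r: "(\<forall>e\<in>halfs (disjoint_union g h). bd (disjoint_union g h) e \<in> Inr ` C \<longrightarrow>
      invol (disjoint_union a b) e = invol (disjoint_union g h) e) \<longleftrightarrow>
    (\<forall>e\<in>halfs h. bd h e \<in> C \<longrightarrow> invol b e = invol h e)" for C
    by (auto simp: ball_Plus)
  have "spec (disjoint_union a b) (Inr ` C) = spec b C" "spec (disjoint_union g h) (Inr ` C) = spec h C"
    if "C \<in> pi0 b \<inter> pi0 h" for C
    using that pi0_nonempty[of C b] by (auto intro: spec_disjoint_union_Inr)
  then show ?thesis
    unfolding specified_subgraph_def int ball_Un ball_simps l r spec_disjoint_union_Inl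
    using a b covering_disjoint_union[OF a b] by simp
qed

lemma sub_specs_disjoint_union:
  assumes g: "specified_graph T g" and h: "specified_graph T h"
  shows "sub_specs T (disjoint_union g h) = (\<lambda>(a, b). disjoint_union a b) ` (sub_specs T g \<times> sub_specs T h)"
proof -
  let ?U = "disjoint_union g h"
  have U: "specified_graph T ?U"
    using specified_disjoint_union[of h T g] g h pi0_nonempty[of "{}" h] specified_graphD(5)[OF h] by blast
  show ?thesis
  proof (intro set_eqI iffI)
    fix d assume "d \<in> (\<lambda>(a, b). disjoint_union a b) ` (sub_specs T g \<times> sub_specs T h)"
    then obtain a b where ab: "a \<in> sub_specs T g" "b \<in> sub_specs T h" "d = disjoint_union a b" by auto
    then have s: "specified_graph T a" "specified_subgraph a g" "specified_graph T b" "specified_subgraph b h"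
      using sub_specs_iff[OF g] sub_specs_iff[OF h] by blast+
    have "spec b {} = None" using specified_graphD(5)[OF s(3)] pi0_nonempty[of "{}" b] by blast
    then show "d \<in> sub_specs T ?U"
      unfolding ab(3) sub_specs_iff[OF U]
      using s specified_disjoint_union[of b T a] by (simp add:
          specified_subgraph_disjoint_union[OF specified_subgraphD(1)[OF s(2)] specified_subgraphD(1)[OF s(4)]])
  next
    fix d assume "d \<in> sub_specs T ?U"
    then have d: "specified_graph T d" "specified_subgraph d ?U" unfolding sub_specs_iff[OF U] by blast+
    interpret covering ?U d
      by (rule coveringI[OF specified_graphD(1)[OF U] specified_graphD(1)[OF d(1)] specified_subgraphD(1)[OF d(2)]])
    \<comment> \<open>At each half-edge the involution of d is the identity or that of the union, so
      it preserves the two summands and the projections lose nothing.\<close>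
    define a where "a = g\<lparr>invol := (\<lambda>e. projl (invol d (Inl e))), spec := (\<lambda>C. spec d (Inl ` C))\<rparr>"
    define b where "b = h\<lparr>invol := (\<lambda>e. projr (invol d (Inr e))), spec := (\<lambda>C. spec d (Inr ` C))\<rparr>"
    have inv: "invol d (Inl e) = Inl (projl (invol d (Inl e)))" "invol d (Inr f) = Inr (projr (invol d (Inr f)))" for e f
      using invol_sub[of "Inl e"] invol_sub[of "Inr f"] by auto
    have ca: "covering_subgraph a g"
    proof (rule covering_subgraphI)
      show "invol a e = e \<or> invol a e = invol g e" for e
        using invol_sub[of "Inl e"] by (auto simp: a_def)
    qed (simp_all add: a_def)
    have cb: "covering_subgraph b h"
    proof (rule covering_subgraphI)
      show "invol b e = e \<or> invol b e = invol h e" for e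
        using invol_sub[of "Inr e"] by (auto simp: b_def)
    qed (simp_all add: b_def)
    have "map_sum (invol a) (invol b) x = invol d x" for x
      by (cases x) (simp_all add: a_def b_def flip: inv)
    then have i: "invol d = map_sum (invol a) (invol b)" by (simp add: fun_eq_iff)
    have "spec (disjoint_union a b) K = spec d K" for K
    proof -
      consider C where "K = Inl ` C" | C where "K = Inr ` C" "C \<noteq> {}"
        | "\<not> K \<subseteq> range Inl" "\<not> K \<subseteq> range Inr"
        by (metis image_empty subset_image_iff)
      then show ?thesis
      proof cases
        case 1
        then show ?thesis by (simp add: a_def)
      next
        case 2
        then show ?thesis using spec_disjoint_union_Inr[of C a b] by (simp add: b_def)
      next
        case 3
        \<comment> \<open>A component of d lies inside one of the union, which is entirely left or
          entirely right.\<close>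
        have "K \<notin> pi0 d"
        proof
          assume "K \<in> pi0 d"
          then obtain x where "K = component_of d x" unfolding pi0_def by blast
          then have "K \<subseteq> component_of ?U x" using component_of_sub by simp
          with 3 show False by (cases x) auto
        qed
        then have "spec d K = None" using specified_graphD(5)[OF d(1)] by blast
        then show ?thesis using spec_disjoint_union_None[OF 3] by simp
      qed
    qed
    then have sp: "spec (disjoint_union a b) = spec d" by blast
    have "disjoint_union a b = ?U\<lparr>invol := invol (disjoint_union a b), spec := spec (disjoint_union a b)\<rparr>"
      by (rule covering_subgraphD(7)[OF covering_disjoint_union[OF ca cb]])
    also have "\<dots> = d"
      unfolding sp using covering_subgraphD(7)[OF cov] i by simp
    finally have dab: "d = disjoint_union a b" by simp
    have "spec b {} = None"
      using specified_graphD(5)[OF d(1)] pi0_nonempty[of "{}" d] by (auto simp: b_def)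
    then have "specified_graph T a" "specified_graph T b"
      using d(1) specified_disjoint_union[of b T a] unfolding dab by blast+
    moreover have "specified_subgraph a g" "specified_subgraph b h"
      using d(2) specified_subgraph_disjoint_union[OF ca cb] unfolding dab by blast+
    ultimately show "d \<in> (\<lambda>(a, b). disjoint_union a b) ` (sub_specs T g \<times> sub_specs T h)"
      unfolding dab using sub_specs_iff[OF g] sub_specs_iff[OF h] by blast
  qed
qed

lemma disjoint_union_inj:
  assumes "covering_subgraph a g" "covering_subgraph a' g" "covering_subgraph b h" "covering_subgraph b' h"
    and s: "spec b {} = None" "spec b' {} = None"
    and eq: "disjoint_union a b = disjoint_union a' b'"
  shows "a = a'" "b = b'"
proof -
  have "map_sum (invol a) (invol b) x = map_sum (invol a') (invol b') x" for x
    using arg_cong[OF eq, of invol] by simp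
  from this[of "Inl _"] this[of "Inr _"] have "invol a = invol a'" "invol b = invol b'"
    by (auto simp: fun_eq_iff)
  moreover have "spec a = spec a'"
    using spec_disjoint_union_Inl[of a b] spec_disjoint_union_Inl[of a' b'] eq by (auto simp: fun_eq_iff)
  moreover have "spec b C = spec b' C" for C
    using spec_disjoint_union_Inr[of C a b] spec_disjoint_union_Inr[of C a' b'] eq s by (cases "C = {}") auto
  then have "spec b = spec b'" by blast
  ultimately show "a = a'" "b = b'"
    using covering_subgraphD(7)[OF assms(1)] covering_subgraphD(7)[OF assms(2)]
      covering_subgraphD(7)[OF assms(3)] covering_subgraphD(7)[OF assms(4)] by simp_all
qed

text \<open>The vertices are sets over a sum type on one side and a sum of set types on the other,
  so there is an isomorphism and no equality. The maps do not depend on the graphs and hence serve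
  both members of a pair.\<close>

lemma contract_disjoint_union_iso:
  assumes "covering G a" "covering H b"
  shows "sgraph_iso (case_sum ((`) Inl) ((`) Inr)) (\<lambda>x. x)
    (disjoint_union (contract G a) (contract H b)) (contract (disjoint_union G H) (disjoint_union a b))"
proof -
  interpret Ga: covering G a by fact
  interpret Hb: covering H b by fact
  interpret U: covering "disjoint_union G H" "disjoint_union a b"
    using Ga.feynman Ga.feynman_sub Hb.feynman Hb.feynman_sub feynman_disjoint_union
      covering_disjoint_union[OF Ga.cov Hb.cov] by (blast intro: coveringI)
  let ?f = "case_sum ((`) Inl) ((`) Inr) :: 'a set + 'd set \<Rightarrow> ('a + 'd) set"
  show ?thesis
    unfolding sgraph_iso_def
  proof (intro conjI ballI)
    have "inj_on ?f (pi0 a <+> pi0 b)"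
    proof (rule inj_onI)
      fix x y assume "x \<in> pi0 a <+> pi0 b" "y \<in> pi0 a <+> pi0 b" "?f x = ?f y"
      then show "x = y"
        using pi0_nonempty[of _ a] pi0_nonempty[of _ b]
        by (cases x; cases y) (auto simp: inj_image_eq_iff)
    qed
    moreover have "?f ` (pi0 a <+> pi0 b) = pi0 (disjoint_union a b)"
      unfolding pi0_disjoint_union Plus_def by (simp add: image_Un image_image)
    ultimately show "bij_betw ?f (verts (disjoint_union (contract G a) (contract H b)))
        (verts (contract (disjoint_union G H) (disjoint_union a b)))"
      by (simp add: bij_betw_def)
    show "bij_betw (\<lambda>x. x) (halfs (disjoint_union (contract G a) (contract H b)))
        (halfs (contract (disjoint_union G H) (disjoint_union a b)))"
      by (simp add: bij_betw_def external_disjoint_union)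
  next
    fix e assume "e \<in> halfs (disjoint_union (contract G a) (contract H b))"
    then consider x where "e = Inl x" "x \<in> external a" | y where "e = Inr y" "y \<in> external b"
      by (auto simp: Plus_def)
    then have "bd (contract (disjoint_union G H) (disjoint_union a b)) e =
        ?f (bd (disjoint_union (contract G a) (contract H b)) e) \<and>
      invol (contract (disjoint_union G H) (disjoint_union a b)) e =
        invol (disjoint_union (contract G a) (contract H b)) e \<and>
      htype (contract (disjoint_union G H) (disjoint_union a b)) e =
        htype (disjoint_union (contract G a) (contract H b)) e"
      by cases (simp_all add: external_disjoint_union InlI InrI)
    then show "bd (contract (disjoint_union G H) (disjoint_union a b)) e =
        ?f (bd (disjoint_union (contract G a) (contract H b)) e)"
      "invol (contract (disjoint_union G H) (disjoint_union a b)) e =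
        invol (disjoint_union (contract G a) (contract H b)) e"
      "htype (contract (disjoint_union G H) (disjoint_union a b)) e =
        htype (disjoint_union (contract G a) (contract H b)) e"
      by blast+
  next
    fix v assume "v \<in> verts (disjoint_union (contract G a) (contract H b))"
    then show "vindex (contract (disjoint_union G H) (disjoint_union a b)) (?f v) =
        vindex (disjoint_union (contract G a) (contract H b)) v"
      using pi0_nonempty[of _ b] spec_disjoint_union_Inr[of _ a b] by (cases v) auto
  next
    fix L assume "L \<in> pi0 (disjoint_union (contract G a) (contract H b))"
    then consider K where "K \<in> pi0 (contract G a)" "L = Inl ` K" | K where "K \<in> pi0 (contract H b)" "L = Inr ` K"
      unfolding pi0_disjoint_union by blast
    then show "spec (contract (disjoint_union G H) (disjoint_union a b)) (?f ` L) =
        spec (disjoint_union (contract G a) (contract H b)) L"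
    proof cases
      case 1
      then obtain C where C: "C \<in> pi0 G" "K = component_of a ` C" unfolding Ga.pi0_contract by blast
      have "?f ` L = component_of (disjoint_union a b) ` Inl ` C"
        unfolding 1(2) C(2) by (simp add: image_image)
      moreover have "Inl ` C \<in> pi0 (disjoint_union G H)" unfolding pi0_disjoint_union using C(1) by blast
      ultimately show ?thesis
        using U.spec_contract[of "Inl ` C"] Ga.spec_contract[OF C(1)] C(2) 1(2) by simp
    next
      case 2
      then obtain C where C: "C \<in> pi0 H" "K = component_of b ` C" unfolding Hb.pi0_contract by blast
      have ne: "C \<noteq> {}" "K \<noteq> {}" using pi0_nonempty[OF C(1)] C(2) by simp_all
      have "?f ` L = component_of (disjoint_union a b) ` Inr ` C"
        unfolding 2(2) C(2) by (simp add: image_image)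
      moreover have "Inr ` C \<in> pi0 (disjoint_union G H)" unfolding pi0_disjoint_union using C(1) by blast
      ultimately show ?thesis
        using U.spec_contract[of "Inr ` C"] Hb.spec_contract[OF C(1)] C(2) 2(2)
          spec_disjoint_union_Inr[OF ne(1), of G H] spec_disjoint_union_Inr[OF ne(2), of "contract G a" "contract H b"]
        by simp
    qed
  qed
qed

subsection \<open>Juxtaposition of pairs\<close>

lemma juxtapose_simps: "juxtapose (G, g) (H, h) = (disjoint_union G H, disjoint_union g h)"
  by (simp add: juxtapose_def)

lemma graph_pair_juxtapose:
  assumes "graph_pair P" "graph_pair Q" shows "graph_pair (juxtapose P Q)"
proof -
  obtain G g H h where PQ: "P = (G, g)" "Q = (H, h)" by (cases P, cases Q) auto
  note G = graph_pairD[OF assms(1)[unfolded PQ]] and H = graph_pairD[OF assms(2)[unfolded PQ]]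
  have "spec H {} = None" "spec h {} = None"
    using H(3,4) pi0_nonempty[of "{}" H] pi0_nonempty[of "{}" h] by blast+
  then show ?thesis
    unfolding PQ juxtapose_simps graph_pair_def
    using G H specified_subgraph_disjoint_union[OF G(6) H(6)]
    by (simp add: feynman_disjoint_union dom_spec_disjoint_union)
qed

lemma D_pair_juxtapose:
  assumes "D_pair T P" "D_pair T Q" shows "D_pair T (juxtapose P Q)"
proof -
  obtain G g H h where PQ: "P = (G, g)" "Q = (H, h)" by (cases P, cases Q) auto
  note G = graph_pairD[OF D_pair_graph_pair[OF assms(1)[unfolded PQ]]]
    and H = graph_pairD[OF D_pair_graph_pair[OF assms(2)[unfolded PQ]]]
  have "spec H {} = None" "spec h {} = None"
    using H(3,4) pi0_nonempty[of "{}" H] pi0_nonempty[of "{}" h] by blast+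
  then show ?thesis
    using assms specified_subgraph_disjoint_union[OF G(6) H(6)]
    unfolding PQ juxtapose_simps D_pair_iff by (simp add: specified_disjoint_union)
qed

lemma restrict_disjoint_union_iso:
  assumes "feynman_graph G" "saturated G C"
  shows "sgraph_iso Inl Inl (restrict_sgraph G C) (restrict_sgraph (disjoint_union G H) (Inl ` C))"
    and "C \<noteq> {} \<Longrightarrow> sgraph_iso Inr Inr (restrict_sgraph G C) (restrict_sgraph (disjoint_union H G) (Inr ` C))"
proof -
  have "{e \<in> halfs G <+> halfs H. map_sum (bd G) (bd H) e \<in> Inl ` C} = Inl ` {e \<in> halfs G. bd G e \<in> C}"
    by auto
  then show "sgraph_iso Inl Inl (restrict_sgraph G C) (restrict_sgraph (disjoint_union G H) (Inl ` C))"
    unfolding sgraph_iso_def by (auto simp: bij_betw_def pi0_restrict_sgraph[OF assms] image_mono)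
  have "{e \<in> halfs H <+> halfs G. map_sum (bd H) (bd G) e \<in> Inr ` C} = Inr ` {e \<in> halfs G. bd G e \<in> C}"
    by auto
  then show "sgraph_iso Inr Inr (restrict_sgraph G C) (restrict_sgraph (disjoint_union H G) (Inr ` C))"
    unfolding sgraph_iso_def using pi0_nonempty[of _ G] spec_disjoint_union_Inr[of _ H G]
    by (auto simp: bij_betw_def pi0_restrict_sgraph[OF assms] image_mono)
qed

lemma component_classes_juxtapose:
  assumes "graph_pair P" "graph_pair Q"
  shows "component_classes (juxtapose P Q) = component_classes P + component_classes Q"
proof -
  obtain G g H h where PQ: "P = (G, g)" "Q = (H, h)" by (cases P, cases Q) auto
  note GP = assms(1)[unfolded PQ] and HP = assms(2)[unfolded PQ]
  note G = graph_pairD[OF GP] and H = graph_pairD[OF HP]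
  interpret G: covering G g by (rule G(7))
  interpret H: covering H h by (rule H(7))
  let ?U = "disjoint_union G H" and ?u = "disjoint_union g h"
  let ?c = "\<lambda>C. pair_class (restrict_sgraph ?U C, restrict_sgraph ?u C)"
  have UP: "graph_pair (?U, ?u)" using graph_pair_juxtapose[OF GP HP] by (simp add: juxtapose_simps)
  have "(`) Inl ` pi0 G \<inter> (`) Inr ` pi0 H = {}" using pi0_nonempty[of _ G] by blast
  then have ms: "mset_set (pi0 ?U) = mset_set ((`) Inl ` pi0 G) + mset_set ((`) Inr ` pi0 H)"
    unfolding pi0_disjoint_union using finite_pi0[OF G(1)] finite_pi0[OF H(1)] by (simp add: mset_set_Union)
  have l: "?c (Inl ` C) = pair_class (restrict_sgraph G C, restrict_sgraph g C)" if C: "C \<in> pi0 G" for C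
  proof -
    have sat: "saturated G C" by (rule saturated_pi0[OF G(1) C])
    have "Inl ` C \<in> pi0 ?U" using C unfolding pi0_disjoint_union by blast
    then have satU: "saturated ?U (Inl ` C)" by (rule saturated_pi0[OF graph_pairD(1)[OF UP]])
    show ?thesis
      by (rule pair_class_eqI[symmetric, OF graph_pair_restrict[OF GP sat] graph_pair_restrict[OF UP satU]
            pair_isoI[OF restrict_disjoint_union_iso(1)[OF G(1) sat]
              restrict_disjoint_union_iso(1)[OF G(2) G.saturated_sub[OF sat]]]])
  qed
  have r: "?c (Inr ` C) = pair_class (restrict_sgraph H C, restrict_sgraph h C)" if C: "C \<in> pi0 H" for C
  proof -
    have sat: "saturated H C" by (rule saturated_pi0[OF H(1) C])
    have "Inr ` C \<in> pi0 ?U" using C unfolding pi0_disjoint_union by blast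
    then have satU: "saturated ?U (Inr ` C)" by (rule saturated_pi0[OF graph_pairD(1)[OF UP]])
    show ?thesis
      by (rule pair_class_eqI[symmetric, OF graph_pair_restrict[OF HP sat] graph_pair_restrict[OF UP satU]
            pair_isoI[OF restrict_disjoint_union_iso(2)[OF H(1) sat pi0_nonempty[OF C]]
              restrict_disjoint_union_iso(2)[OF H(2) H.saturated_sub[OF sat] pi0_nonempty[OF C]]]])
  qed
  have "inj_on ((`) Inl) (pi0 G)" "inj_on ((`) Inr) (pi0 H)" by (auto simp: inj_on_def inj_image_eq_iff)
  then have "image_mset ?c (mset_set ((`) Inl ` pi0 G)) = component_classes P"
    "image_mset ?c (mset_set ((`) Inr ` pi0 H)) = component_classes Q"
    unfolding PQ component_classes_def prod.case using l r by (blast intro: image_mset_image)+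
  then show ?thesis
    unfolding PQ juxtapose_simps by (simp add: component_classes_def ms)
qed

lemma D_pair_empty: "D_pair T (empty_sgraph :: ('a, 'b, 'c) sgraph, empty_sgraph)"
proof -
  let ?E = "empty_sgraph :: ('a, 'b, 'c) sgraph"
  have "pi0 ?E = {}" by (simp add: pi0_def empty_sgraph_def)
  moreover have "verts ?E = {}" "halfs ?E = {}" "invol ?E = id" "spec ?E = Map.empty"
    by (simp_all add: empty_sgraph_def)
  ultimately have "specified_graph T ?E"
    unfolding specified_graph_def feynman_graph_def locally_one_PI_def by simp
  then show ?thesis
    unfolding D_pair_iff specified_subgraph_def covering_subgraph_def by simp
qed

lemma component_classes_empty [simp]: "component_classes (empty_sgraph, empty_sgraph) = {#}"
  by (simp add: component_classes_def pi0_def empty_sgraph_def)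

text \<open>Juxtaposing connected pairs realises every monomial, which gives \<open>D'_rep\<close>
  something to choose. The juxtaposition is relabelled through \<open>rep\<close>, as its labels are
  no longer natural numbers.\<close>

lemma ex_D_pair:
  assumes "M \<in> D'_basis T"
  shows "\<exists>P :: (nat, nat, 't) spair. D_pair T P \<and> component_classes P = (M :: 't pclass multiset)"
  using assms
proof (induction M)
  case empty
  then show ?case using D_pair_empty component_classes_empty by blast
next
  case (add c M)
  then obtain P :: "(nat, nat, 't) spair" where P: "D_pair T P" "component_classes P = M"
    by (auto simp: D'_basis_def)
  from add.prems obtain Q :: "(nat, nat, 't) spair" where Q: "F_pair T Q" "c = pair_class Q"
    by (auto simp: D'_basis_def F_basis_def)
  obtain G g where Gg: "Q = (G, g)" by (cases Q)
  have D: "D_pair T Q" and c: "connected_graph G" using Q(1) unfolding Gg F_pair_iff by blast+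
  let ?J = "juxtapose Q P"
  have J: "D_pair T ?J" by (rule D_pair_juxtapose[OF D P(1)])
  note R = rep_pair_class[OF D_pair_graph_pair[OF J]]
  have "component_classes (rep (pair_class ?J)) = component_classes ?J"
    by (rule component_classes_iso[OF R(2) D_pair_graph_pair[OF J] R(1), symmetric])
  also have "\<dots> = component_classes Q + component_classes P"
    by (rule component_classes_juxtapose[OF D_pair_graph_pair[OF D] D_pair_graph_pair[OF P(1)]])
  also have "\<dots> = add_mset c M"
    using component_classes_connected[OF D_pair_graph_pair[OF D, unfolded Gg] c] Gg P(2) Q(2) by simp
  finally show ?case using D_pair_iso[OF R(2) J R(1)] by blast
qed

text \<open>A subgraph of a juxtaposition splits uniquely into subgraphs of the two parts.
  Contraction commutes with juxtaposition only up to isomorphism, hence the passage to classes under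
  F.\<close>

lemma sum_sub_specs_juxtapose:
  assumes P: "D_pair T (G, g)" and Q: "D_pair T (H, h)"
  shows "(\<Sum>d\<in>sub_specs T (disjoint_union g h). F (pair_class (disjoint_union G H, d))
      (pair_class (contract (disjoint_union G H) d, contract (disjoint_union g h) d))) =
    (\<Sum>a\<in>sub_specs T g. \<Sum>b\<in>sub_specs T h. F (pair_class (juxtapose (G, a) (H, b)))
      (pair_class (juxtapose (contract G a, contract g a) (contract H b, contract h b))))"
proof -
  have g: "specified_graph T g" and h: "specified_graph T h" using P Q unfolding D_pair_iff by blast+
  have inj: "inj_on (\<lambda>(a, b). disjoint_union a b) (sub_specs T g \<times> sub_specs T h)"
  proof (rule inj_onI, clarify)
    fix a b a' b' assume ab: "a \<in> sub_specs T g" "b \<in> sub_specs T h" "a' \<in> sub_specs T g" "b' \<in> sub_specs T h"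
      and eq: "disjoint_union a b = disjoint_union a' b'"
    have cov: "covering_subgraph a g" "covering_subgraph a' g" "covering_subgraph b h" "covering_subgraph b' h"
      using ab sub_specs_iff[OF g] sub_specs_iff[OF h] specified_subgraphD(1)[of _ g]
        specified_subgraphD(1)[of _ h] by blast+
    have "specified_graph T b" "specified_graph T b'" using ab sub_specs_iff[OF h] by blast+
    then have "spec b {} = None" "spec b' {} = None"
      using specified_graphD(5) pi0_nonempty[of "{}" b] pi0_nonempty[of "{}" b'] by blast+
    then show "a = a' \<and> b = b'" using disjoint_union_inj[OF cov _ _ eq] by blast
  qed
  show ?thesis
    unfolding sub_specs_disjoint_union[OF g h] sum.reindex[OF inj] sum.cartesian_product
  proof (rule sum.cong[OF refl], clarify)
    fix a b assume a: "a \<in> sub_specs T g" and b: "b \<in> sub_specs T h"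
    note A = D_pair_sub_specs[OF P a] and B = D_pair_sub_specs[OF Q b]
    have du: "disjoint_union a b \<in> sub_specs T (disjoint_union g h)"
      unfolding sub_specs_disjoint_union[OF g h] using a b by blast
    have U: "D_pair T (disjoint_union G H, disjoint_union g h)"
      using D_pair_juxtapose[OF P Q] by (simp add: juxtapose_simps)
    have "pair_iso (juxtapose (contract G a, contract g a) (contract H b, contract h b))
       (contract (disjoint_union G H) (disjoint_union a b), contract (disjoint_union g h) (disjoint_union a b))"
      unfolding juxtapose_simps
      by (rule pair_isoI; rule contract_disjoint_union_iso)
        (rule covering_D_pair[OF A(1)] covering_D_pair[OF A(2)] covering_D_pair[OF B(1)] covering_D_pair[OF B(2)])+
    then have "pair_class (juxtapose (contract G a, contract g a) (contract H b, contract h b)) =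
       pair_class (contract (disjoint_union G H) (disjoint_union a b), contract (disjoint_union g h) (disjoint_union a b))"
      by (intro pair_class_eqI D_pair_graph_pair[OF D_pair_juxtapose[OF A(3) B(3)]]
          D_pair_graph_pair[OF D_pair_sub_specs(3)[OF U du]])
    then show "((\<lambda>d. F (pair_class (disjoint_union G H, d))
        (pair_class (contract (disjoint_union G H) d, contract (disjoint_union g h) d))) \<circ>
        (\<lambda>(a, b). disjoint_union a b)) (a, b) =
      F (pair_class (juxtapose (G, a) (H, b)))
        (pair_class (juxtapose (contract G a, contract g a) (contract H b, contract h b)))"
      by (simp add: juxtapose_simps)
  qed
qed


section \<open>Linear maps on free vector spaces\<close>

lemma lookup_scale: "Poly_Mapping.lookup (scale c x) a = c * Poly_Mapping.lookup x a"
  unfolding scale_def by (simp add: Poly_Mapping.map.rep_eq when_def)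

lemma scale_zero [simp]: "scale c 0 = 0" "scale 0 x = 0"
  and scale_one [simp]: "scale 1 x = x"
  and scale_scale [simp]: "scale c (scale d x) = scale (c * d) x"
  and scale_add: "scale c (x + y) = scale c x + scale c y"
  and scale_add_left: "scale (c + d) x = scale c x + scale d x"
  by (rule poly_mapping_eqI; simp add: lookup_scale lookup_add algebra_simps)+

lemma scale_sum: "scale c (\<Sum>i\<in>I. f i) = (\<Sum>i\<in>I. scale c (f i))"
  by (rule poly_mapping_eqI) (simp add: lookup_scale lookup_sum sum_distrib_left)

lemma scale_single [simp]: "scale c (Poly_Mapping.single a b) = Poly_Mapping.single a (c * b)"
  by (rule poly_mapping_eqI) (simp add: lookup_scale lookup_single when_def)

lemma scale_mult_left: "scale c x * y = scale c (x * y)"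
  and scale_mult_right: "x * scale c y = scale c (x * (y :: 'a::comm_monoid_add \<Rightarrow>\<^sub>0 'k::field))"
  unfolding scale_def mult_map_scale_conv_mult by (simp_all add: ac_simps)

lemma lin_superset:
  assumes "finite A" "Poly_Mapping.keys x \<subseteq> A"
  shows "lin f x = (\<Sum>a\<in>A. scale (Poly_Mapping.lookup x a) (f a))"
  unfolding lin_def using assms by (intro sum.mono_neutral_left) (auto simp: in_keys_iff)

lemma lin_zero [simp]: "lin f 0 = 0"
  by (simp add: lin_def)

lemma lin_basis [simp]: "lin f (basis a) = f a"
  by (simp add: lin_def)

lemma lin_add: "lin f (x + y) = lin f x + lin f y"
proof -
  let ?A = "Poly_Mapping.keys x \<union> Poly_Mapping.keys y"
  have "Poly_Mapping.keys (x + y) \<subseteq> ?A" by (rule keys_add)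
  then show ?thesis
    by (simp add: lin_superset[of ?A] lookup_add scale_add_left sum.distrib)
qed

lemma lin_scale: "lin f (scale c x) = scale c (lin f x)"
proof -
  have "Poly_Mapping.keys (scale c x) \<subseteq> Poly_Mapping.keys x" by (auto simp: in_keys_iff lookup_scale)
  then show ?thesis
    by (simp add: lin_superset[of "Poly_Mapping.keys x"] lookup_scale scale_sum)
qed

lemma lin_sum: "lin f (\<Sum>i\<in>I. g i) = (\<Sum>i\<in>I. lin f (g i))"
  by (induction I rule: infinite_finite_induct) (simp_all add: lin_add)

lemma lin_cong:
  assumes "\<And>a. a \<in> Poly_Mapping.keys x \<Longrightarrow> f a = g a" shows "lin f x = lin g x"
  unfolding lin_def using assms by simp

lemma lin_lin: "lin g (lin f x) = lin (\<lambda>a. lin g (f a)) x"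
  by (simp add: lin_def[of f] lin_def[of "\<lambda>a. lin g (f a)"] lin_sum lin_scale)

lemma lin_id [simp]: "lin basis x = x"
proof (rule poly_mapping_eqI)
  fix k
  have "Poly_Mapping.lookup (lin basis x) k =
      (\<Sum>a\<in>Poly_Mapping.keys x. if a = k then Poly_Mapping.lookup x k else 0)"
    unfolding lin_def lookup_sum by (intro sum.cong) (auto simp: lookup_single when_def)
  then show "Poly_Mapping.lookup (lin basis x) k = Poly_Mapping.lookup x k"
    by (simp add: in_keys_iff)
qed

lemma lin_fun_sum: "lin (\<lambda>a. \<Sum>i\<in>I. f i a) x = (\<Sum>i\<in>I. lin (f i) x)"
  unfolding lin_def by (simp add: scale_sum sum.swap[of _ I])

lemma lin_fun_add: "lin (\<lambda>a. f a + g a) x = lin f x + lin g x"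
  unfolding lin_def by (simp add: scale_add sum.distrib)

lemma lin_fun_scale: "lin (\<lambda>a. scale c (f a)) x = scale c (lin f x)"
  unfolding lin_def by (simp add: scale_sum mult.commute)

text \<open>Linearity on the whole ambient space, in the form of being determined by the values on
  basis elements; identities between composites can then be checked on a basis.\<close>

definition extends_linearly :: "(('a \<Rightarrow>\<^sub>0 'k::field) \<Rightarrow> ('b \<Rightarrow>\<^sub>0 'k)) \<Rightarrow> bool" where
  "extends_linearly F \<longleftrightarrow> (\<exists>f. F = lin f)"

lemma extends_linearly_lin [simp]: "extends_linearly (lin f)"
  unfolding extends_linearly_def by blast

lemma extends_linearly_id [simp]: "extends_linearly (\<lambda>x. x)" "extends_linearly id"
  unfolding extends_linearly_def by (rule exI[of _ basis], simp add: fun_eq_iff)+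

lemma extends_linearly_comp:
  assumes "extends_linearly F" "extends_linearly G"
  shows "extends_linearly (\<lambda>x. F (G x))" "extends_linearly (F \<circ> G)"
proof -
  obtain f g where "F = lin f" "G = lin g" using assms unfolding extends_linearly_def by blast
  then show "extends_linearly (\<lambda>x. F (G x))" "extends_linearly (F \<circ> G)"
    unfolding extends_linearly_def by (auto simp: lin_lin fun_eq_iff intro!: exI[of _ "\<lambda>a. lin f (g a)"])
qed

lemma extends_linearly_maps [simp]:
  "extends_linearly (tensor_map F G)" "extends_linearly assoc_map" "extends_linearly tau23"
  "extends_linearly (mult_map m)" "extends_linearly (m13 m)" "extends_linearly (counit_map eps)"
  by (simp_all add: tensor_map_def assoc_map_def tau23_def mult_map_def m13_def counit_map_def
      extends_linearly_comp)

lemma extends_linearly_sum: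
  assumes "extends_linearly F" shows "F (\<Sum>i\<in>I. x i) = (\<Sum>i\<in>I. F (x i))"
  using assms lin_sum unfolding extends_linearly_def by blast

lemma extends_linearly_eqI:
  assumes "extends_linearly F" "extends_linearly G" "x \<in> free_space A"
    and "\<And>a. a \<in> A \<Longrightarrow> F (basis a) = G (basis a)"
  shows "F x = G x"
proof -
  obtain f g where fg: "F = lin f" "G = lin g" using assms(1,2) unfolding extends_linearly_def by blast
  show ?thesis
    unfolding fg by (rule lin_cong) (use assms(3,4) in \<open>auto simp: fg free_space_def\<close>)
qed

lemma free_space_basis [simp]: "basis a \<in> free_space A \<longleftrightarrow> a \<in> A"
  by (simp add: free_space_def)

lemma free_space_zero [simp]: "0 \<in> free_space A"
  by (simp add: free_space_def)

lemma free_space_add: "x \<in> free_space A \<Longrightarrow> y \<in> free_space A \<Longrightarrow> x + y \<in> free_space A"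
  unfolding free_space_def using keys_add[of x y] by blast

lemma free_space_scale: "x \<in> free_space A \<Longrightarrow> scale c x \<in> free_space A"
  unfolding free_space_def by (auto simp: in_keys_iff lookup_scale)

lemma free_space_sum: "(\<And>i. i \<in> I \<Longrightarrow> x i \<in> free_space A) \<Longrightarrow> (\<Sum>i\<in>I. x i) \<in> free_space A"
  by (induction I rule: infinite_finite_induct) (simp_all add: free_space_add)

lemma free_space_lin:
  "(\<And>a. a \<in> A \<Longrightarrow> f a \<in> free_space B) \<Longrightarrow> x \<in> free_space A \<Longrightarrow> lin f x \<in> free_space B"
  unfolding lin_def by (intro free_space_sum free_space_scale) (auto simp: free_space_def)

lemma free_space_mult:
  assumes "x \<in> free_space A" "y \<in> free_space A" "\<And>a b. a \<in> A \<Longrightarrow> b \<in> A \<Longrightarrow> a + b \<in> A"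
  shows "x * y \<in> free_space A"
  using keys_mult[of x y] assms unfolding free_space_def by blast

lemma linear_on_lin: "(\<And>a. a \<in> A \<Longrightarrow> f a \<in> free_space B) \<Longrightarrow> linear_on A B (lin f)"
  unfolding linear_on_def using free_space_lin[of A f B] by (simp add: lin_add lin_scale)

lemma tensor_basis [simp]: "tensor (basis a) (basis b) = basis (a, b)"
  by (simp add: tensor_def)

lemma tensor_sum_left: "tensor (\<Sum>i\<in>I. x i) y = (\<Sum>i\<in>I. tensor (x i) y)"
  by (simp add: tensor_def lin_sum)

lemma tensor_sum_right: "tensor x (\<Sum>i\<in>I. y i) = (\<Sum>i\<in>I. tensor x (y i))"
  by (simp add: tensor_def lin_sum lin_fun_sum)

lemma tensor_basis_left: "tensor (basis a) y = lin (\<lambda>b. basis (a, b)) y"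
  by (simp add: tensor_def)

lemma lin_prod_left: "lin (\<lambda>(a, b). basis (h a, b)) (tensor (basis a) y) = tensor (basis (h a)) y"
  by (simp add: tensor_basis_left lin_lin)

lemma tensor_map_basis: "tensor_map F G (basis (a, b)) = tensor (F (basis a)) (G (basis b))"
  by (simp add: tensor_map_def)

text \<open>With the convolution product the finitely supported functions on a monoid form its
  monoid algebra, and maps multiplicative on exponents extend multiplicatively. The condition is
  imposed on the supports, because multiplicativity of the coaction is established on admissible
  monomials.\<close>

lemma lin_mult:
  fixes x y :: "'a::comm_monoid_add \<Rightarrow>\<^sub>0 'k::field" and f :: "'a \<Rightarrow> ('b::comm_monoid_add \<Rightarrow>\<^sub>0 'k)"
  assumes "\<And>a b. a \<in> Poly_Mapping.keys x \<Longrightarrow> b \<in> Poly_Mapping.keys y \<Longrightarrow> f (a + b) = f a * f b"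
  shows "lin f (x * y) = lin f x * lin f y"
proof -
  let ?x = "Poly_Mapping.lookup x" and ?y = "Poly_Mapping.lookup y"
  let ?X = "Poly_Mapping.keys x" and ?Y = "Poly_Mapping.keys y"
  have "x * y = lin basis x * lin basis y" by simp
  also have "\<dots> = (\<Sum>a\<in>?X. \<Sum>b\<in>?Y. scale (?x a * ?y b) (basis (a + b)))"
    unfolding lin_def by (simp add: sum_product mult_single)
  finally have "lin f (x * y) = (\<Sum>a\<in>?X. \<Sum>b\<in>?Y. scale (?x a * ?y b) (f (a + b)))"
    by (simp only: lin_sum lin_scale lin_basis)
  also have "\<dots> = (\<Sum>a\<in>?X. \<Sum>b\<in>?Y. scale (?x a) (f a) * scale (?y b) (f b))"
    by (intro sum.cong refl) (simp add: assms scale_mult_left scale_mult_right mult.commute)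
  also have "\<dots> = lin f x * lin f y" unfolding lin_def sum_product ..
  finally show ?thesis .
qed

lemma basis_mult [simp]: "basis a * basis b = basis (a + b)"
  by (simp add: mult_single)

text \<open>The tensor product of two monoid algebras is the algebra of the product monoid, into
  which both factors embed as algebras. This reduces \<open>tensor_mult\<close> to
  \<open>lin_mult\<close>.\<close>

lemma tensor_eq_mult:
  fixes x :: "'a::comm_monoid_add \<Rightarrow>\<^sub>0 'k::field" and y :: "'b::comm_monoid_add \<Rightarrow>\<^sub>0 'k"
  shows "tensor x y = lin (\<lambda>a. basis (a, 0)) x * lin (\<lambda>b. basis (0, b)) y"
proof -
  have "tensor x y = lin (\<lambda>a. basis (a, 0) * lin (\<lambda>b. basis (0, b)) y) x"
    unfolding tensor_def
  proof (rule lin_cong)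
    fix a
    have "basis (a, 0) * lin (\<lambda>b. basis (0, b)) y = lin (\<lambda>b. basis (a, b)) y"
      unfolding lin_def by (simp add: sum_distrib_left scale_mult_right mult_single)
    then show "lin (\<lambda>b. basis (a, b)) y = basis (a, 0) * lin (\<lambda>b. basis (0, b)) y" ..
  qed
  also have "\<dots> = lin (\<lambda>a. basis (a, 0)) x * lin (\<lambda>b. basis (0, b)) y"
    unfolding lin_def[of _ x] by (simp add: sum_distrib_right del: scale_single flip: scale_mult_left)
  finally show ?thesis .
qed

lemma tensor_mult:
  fixes x x' :: "'a::comm_monoid_add \<Rightarrow>\<^sub>0 'k::field" and y y' :: "'b::comm_monoid_add \<Rightarrow>\<^sub>0 'k"
  shows "tensor (x * x') (y * y') = tensor x y * tensor x' y'"
proof -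
  have "lin (\<lambda>a. basis (a, 0 :: 'b)) (x * x') = lin (\<lambda>a. basis (a, 0)) x * lin (\<lambda>a. basis (a, 0)) x'"
    "lin (\<lambda>b. basis (0 :: 'a, b)) (y * y') = lin (\<lambda>b. basis (0, b)) y * lin (\<lambda>b. basis (0, b)) y'"
    by (rule lin_mult; simp)+
  then show ?thesis unfolding tensor_eq_mult by (simp add: ac_simps)
qed


section \<open>The structure maps on basis elements\<close>

lemma component_classes_rep:
  assumes "graph_pair P"
  shows "component_classes (rep (pair_class P)) = component_classes P"
  by (rule component_classes_iso[OF rep_pair_class(2)[OF assms] assms rep_pair_class(1)[OF assms], symmetric])

lemma D'_rep:
  assumes "M \<in> D'_basis T"
  shows "D_pair T (D'_rep T M)" "component_classes (D'_rep T M) = M"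
  using someI_ex[OF ex_D_pair[OF assms]] unfolding D'_rep_def by blast+

lemma pair_class_D'_rep:
  assumes "D_pair T (G, g)" shows "pair_class (D'_rep T (component_classes (G, g))) = pair_class (G, g)"
proof -
  note R = D'_rep[OF component_classes_in_D'_basis[OF assms]]
  show ?thesis
    by (rule pair_class_eqI[OF D_pair_graph_pair[OF R(1)] D_pair_graph_pair[OF assms]
          component_classes_eqD[OF D_pair_graph_pair[OF R(1)] D_pair_graph_pair[OF assms] R(2)]])
qed

lemma D_to_D'_basis:
  assumes "graph_pair P"
  shows "D_to_D' (basis (pair_class P)) = basis (component_classes P)"
  unfolding D_to_D'_def by (simp add: component_classes_rep[OF assms])

lemma extends_linearly_structure_maps [simp]:
  "extends_linearly (D'_coaction T)" "extends_linearly (D_coproduct T)" "extends_linearly unshuffle"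
  "extends_linearly D_to_D'"
  by (simp_all add: D'_coaction_def D_coproduct_def unshuffle_def D_to_D'_def)

lemma component_classes_rep_sub:
  assumes "D_pair T (G, g)" "d \<in> sub_specs T g"
  shows "component_classes (rep (pair_class (G, d))) = component_classes (G, d)"
    "component_classes (rep (pair_class (contract G d, contract g d))) =
      component_classes (contract G d, contract g d)"
  by (rule component_classes_rep[OF D_pair_graph_pair], rule D_pair_sub_specs[OF assms])+

text \<open>The pair chosen by \<open>D'_rep\<close> may be replaced by any admissible pair with the
  same components, since those components determine the pair up to isomorphism.\<close>

lemma sum_D'_rep:
  assumes T: "physical_theory T" and P: "D_pair T (G, g)"
  shows "(case D'_rep T (component_classes (G, g)) of (H, h) \<Rightarrow>
      \<Sum>d\<in>sub_specs T h. F (pair_class (H, d)) (pair_class (contract H d, contract h d))) =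
    (\<Sum>d\<in>sub_specs T g. F (pair_class (G, d)) (pair_class (contract G d, contract g d)))"
proof -
  obtain H h where R: "D'_rep T (component_classes (G, g)) = (H, h)" by fastforce
  note M = D'_rep[OF component_classes_in_D'_basis[OF P], unfolded R]
  have "pair_iso (H, h) (G, g)"
    by (rule component_classes_eqD[OF D_pair_graph_pair[OF M(1)] D_pair_graph_pair[OF P] M(2)])
  from sum_sub_specs_iso[OF T M(1) P this] show ?thesis unfolding R by simp
qed

lemma D'_coaction_basis:
  assumes T: "physical_theory T" and P: "D_pair T (G, g)"
  shows "D'_coaction T (basis (component_classes (G, g))) =
    (\<Sum>d\<in>sub_specs T g. basis (pair_class (G, d), component_classes (contract G d, contract g d)))"
proof -
  \<comment> \<open>The summand is rewritten as a function of classes, the form in which sums over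
    subgraphs are transported.\<close>
  let ?F = "\<lambda>c c'. basis (c, component_classes (rep c'))"
  obtain H h where R: "D'_rep T (component_classes (G, g)) = (H, h)" by fastforce
  have H: "D_pair T (H, h)" using D'_rep(1)[OF component_classes_in_D'_basis[OF P]] R by simp
  have "D'_coaction T (basis (component_classes (G, g))) =
      (\<Sum>d\<in>sub_specs T h. basis (pair_class (H, d), component_classes (contract H d, contract h d)))"
    unfolding D'_coaction_def by (simp add: R)
  also have "\<dots> = (\<Sum>d\<in>sub_specs T h. ?F (pair_class (H, d)) (pair_class (contract H d, contract h d)))"
    by (intro sum.cong refl) (simp add: component_classes_rep_sub[OF H])
  also have "\<dots> = (\<Sum>d\<in>sub_specs T g. ?F (pair_class (G, d)) (pair_class (contract G d, contract g d)))"
    using sum_D'_rep[OF T P, of ?F] unfolding R by simp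
  also have "\<dots> = (\<Sum>d\<in>sub_specs T g. basis (pair_class (G, d), component_classes (contract G d, contract g d)))"
    by (intro sum.cong refl) (simp add: component_classes_rep_sub[OF P])
  finally show ?thesis .
qed

lemma D_coproduct_basis:
  assumes T: "physical_theory T" and P: "D_pair T (G, g)"
  shows "D_coproduct T (basis (pair_class (G, g))) =
    (\<Sum>d\<in>sub_specs T g. basis (pair_class (G, d), pair_class (contract G d, contract g d)))"
proof -
  obtain H h where R: "rep (pair_class (G, g)) = (H, h)" by fastforce
  note GP = D_pair_graph_pair[OF P]
  note r = rep_pair_class[OF GP, unfolded R]
  have "D_coproduct T (basis (pair_class (G, g))) =
      (\<Sum>d\<in>sub_specs T h. basis (pair_class (H, d), pair_class (contract H d, contract h d)))"
    unfolding D_coproduct_def by (simp add: R)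
  also have "\<dots> = (\<Sum>d\<in>sub_specs T g. basis (pair_class (G, d), pair_class (contract G d, contract g d)))"
    using sum_sub_specs_iso[OF T P D_pair_iso[OF r(2) P r(1)] r(2), of "\<lambda>c c'. basis (c, c')"] by (rule sym)
  finally show ?thesis .
qed

lemma D'_basisE:
  assumes "M \<in> D'_basis T"
  obtains G g :: "(nat, nat, 't) sgraph" where "D_pair T (G, g)" "M = component_classes (G, g)"
proof -
  obtain G g where R: "D'_rep T M = (G, g)" by fastforce
  show thesis using that D'_rep[OF assms] unfolding R by simp
qed

lemma linear_on_D'_coaction:
  assumes T: "physical_theory T"
  shows "linear_on (D'_basis T) (D_basis T \<times> D'_basis T) (D'_coaction T)"
proof -
  have "D'_coaction T (basis M) \<in> free_space (D_basis T \<times> D'_basis T)" if M: "M \<in> D'_basis T" for M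
  proof -
    from M obtain G g :: "(nat, nat, 'a) sgraph" where P: "D_pair T (G, g)" "M = component_classes (G, g)"
      by (rule D'_basisE)
    show ?thesis
      unfolding P(2) D'_coaction_basis[OF T P(1)]
    proof (rule free_space_sum)
      fix d assume "d \<in> sub_specs T g"
      note D = D_pair_sub_specs[OF P(1) this]
      show "basis (pair_class (G, d), component_classes (contract G d, contract g d)) \<in>
          free_space (D_basis T \<times> D'_basis T)"
        using D_basisI[OF D(1)] component_classes_in_D'_basis[OF D(3)] by simp
    qed
  qed
  then show ?thesis unfolding D'_coaction_def by (intro linear_on_lin) simp
qed

section \<open>The coaction\<close>

lemma sub_specs_subset:
  assumes "specified_graph T g" "d \<in> sub_specs T g" "d' \<in> sub_specs T d"
  shows "d' \<in> sub_specs T g"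
proof -
  have d: "specified_graph T d" "specified_subgraph d g" using assms(2) sub_specs_iff[OF assms(1)] by blast+
  have d': "specified_graph T d'" "specified_subgraph d' d" using assms(3) sub_specs_iff[OF d(1)] by blast+
  show ?thesis
    unfolding sub_specs_iff[OF assms(1)]
    using d' specified_subgraph_trans[OF specified_graphD(1)[OF d'(1)] specified_graphD(1)[OF d(1)]
        specified_graphD(1)[OF assms(1)] d'(2) d(2)] by blast
qed

lemma coaction_coassociative:
  assumes T: "physical_theory T" and P: "D_pair T (G, g)"
  shows "assoc_map (tensor_map (D_coproduct T) id (D'_coaction T (basis (component_classes (G, g))))) =
    tensor_map id (D'_coaction T) (D'_coaction T (basis (component_classes (G, g))) :: _ \<Rightarrow>\<^sub>0 'k::field)"
proof -
  let ?S = "sub_specs T g"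
  let ?f = "\<lambda>d d'. basis (pair_class (G, d'), pair_class (contract G d', contract d d'),
    component_classes (contract G d, contract g d)) :: _ \<Rightarrow>\<^sub>0 'k"
  have Sg: "specified_graph T g" using P unfolding D_pair_iff by blast
  have fin: "finite ?S" by (rule finite_sub_specs[OF T specified_graphD(1)[OF Sg]])
  have "assoc_map (tensor_map (D_coproduct T) id (D'_coaction T (basis (component_classes (G, g))))) =
      (\<Sum>d\<in>?S. assoc_map (tensor (D_coproduct T (basis (pair_class (G, d))))
        (basis (component_classes (contract G d, contract g d)))))"
    by (simp add: D'_coaction_basis[OF T P] extends_linearly_sum tensor_map_basis)
  also have "\<dots> = (\<Sum>d\<in>?S. \<Sum>d'\<in>sub_specs T d. ?f d d')"
    by (intro sum.cong refl)
      (simp add: D_coproduct_basis[OF T D_pair_sub_specs(1)[OF P]] tensor_sum_left extends_linearly_sum,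
        simp add: assoc_map_def)
  \<comment> \<open>The inner range is cut out of the fixed finite set \<open>?S\<close>, so that
    the order of summation over the chains can be exchanged.\<close>
  also have "\<dots> = (\<Sum>d\<in>?S. \<Sum>d'\<in>{d'\<in>?S. d' \<in> sub_specs T d}. ?f d d')"
    by (intro sum.cong refl) (auto dest: sub_specs_subset[OF Sg])
  also have "\<dots> = (\<Sum>d'\<in>?S. \<Sum>d\<in>{d\<in>?S. d' \<in> sub_specs T d}. ?f d d')"
    by (rule sum.swap_restrict[OF fin fin])
  also have "\<dots> = (\<Sum>d'\<in>?S. tensor (basis (pair_class (G, d')))
      (D'_coaction T (basis (component_classes (contract G d', contract g d')))))"
  proof (rule sum.cong[OF refl])
    fix d' assume d': "d' \<in> ?S"
    note D' = D_pair_sub_specs[OF P d']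
    have "tensor (basis (pair_class (G, d')))
        (D'_coaction T (basis (component_classes (contract G d', contract g d')))) =
      (\<Sum>h\<in>sub_specs T (contract g d'). basis (pair_class (G, d'), pair_class (contract G d', h),
        component_classes (contract (contract G d') h, contract (contract g d') h)) :: _ \<Rightarrow>\<^sub>0 'k)"
      by (simp add: D'_coaction_basis[OF T D'(3)] tensor_sum_right)
    \<comment> \<open>Subgraphs h of the quotient by d' are parametrised by the intermediate graphs
      d.\<close>
    also have "\<dots> = (\<Sum>d\<in>{d\<in>?S. d' \<in> sub_specs T d}. basis (pair_class (G, d'),
        pair_class (contract G d', contract d d'), component_classes
          (contract (contract G d') (contract d d'), contract (contract g d') (contract d d'))))"
      by (rule sum.reindex_bij_betw[OF bij_betw_contract_sub_specs[OF Sg d'], symmetric])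
    also have "\<dots> = (\<Sum>d\<in>{d\<in>?S. d' \<in> sub_specs T d}. ?f d d')"
    proof (rule sum.cong[OF refl])
      fix d assume "d \<in> {d\<in>?S. d' \<in> sub_specs T d}"
      then have d: "d \<in> ?S" "d' \<in> sub_specs T d" by blast+
      note D = D_pair_sub_specs[OF P d(1)]
      note DD = D_pair_sub_specs[OF D(1) d(2)] D_pair_sub_specs[OF D(2) d(2)]
      have cov: "covering d d'" "covering G d" "covering g d"
        using covering_D_pair DD D by blast+
      have "contract d d' \<in> sub_specs T (contract g d')"
        using bij_betw_contract_sub_specs[OF Sg d'] d by (auto simp: bij_betw_def)
      note Q = D_pair_sub_specs(3)[OF D'(3) this]
      \<comment> \<open>The iterated quotient enters only through its component classes, so its
        isomorphism with the single quotient is enough.\<close>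
      have "component_classes (contract (contract G d') (contract d d'), contract (contract g d') (contract d d')) =
          component_classes (contract G d, contract g d)"
        by (rule component_classes_iso[OF pair_isoI[OF contract_contract_iso[OF cov(1,2)]
                contract_contract_iso[OF cov(1,3)]] D_pair_graph_pair[OF Q] D_pair_graph_pair[OF D(3)]])
      then show "basis (pair_class (G, d'), pair_class (contract G d', contract d d'), component_classes
          (contract (contract G d') (contract d d'), contract (contract g d') (contract d d'))) = ?f d d'"
        by simp
    qed
    finally show "(\<Sum>d\<in>{d\<in>?S. d' \<in> sub_specs T d}. ?f d d') = tensor (basis (pair_class (G, d')))
      (D'_coaction T (basis (component_classes (contract G d', contract g d'))))" ..
  qed
  also have "\<dots> = tensor_map id (D'_coaction T) (D'_coaction T (basis (component_classes (G, g))))"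
    by (simp add: D'_coaction_basis[OF T P] extends_linearly_sum tensor_map_basis)
  finally show ?thesis .
qed

subsection \<open>The counit\<close>

lemma component_of_no_internal:
  assumes "external d = halfs d" shows "component_of d v = {v}"
  by (rule isolated_component) (use assms in \<open>auto simp: external_def\<close>)

text \<open>With all edges cut, the components are single vertices and the last clause of
  \<open>specified_graph\<close> leaves only the vertex indices as specification. The same clause
  for g makes this choice compatible with g. The resulting subgraph is the one on which the counit
  does not vanish.\<close>

lemma ex1_no_internal_sub_spec:
  assumes S: "specified_graph T g"
  shows "\<exists>!d. d \<in> sub_specs T g \<and> external d = halfs d"
proof -
  note g = specified_graphD[OF S]
  define s where "s C = (if C \<in> (\<lambda>v. {v}) ` verts g then Some (vindex g (the_elem C)) else None)" for C
  define d where "d = g\<lparr>invol := (\<lambda>e. e), spec := s\<rparr>"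
  have d [simp]: "verts d = verts g" "halfs d = halfs g" "bd d = bd g" "htype d = htype g"
    "vindex d = vindex g" "invol d = (\<lambda>e. e)" "spec d = s"
    by (simp_all add: d_def)
  have ext: "external d = halfs g" by (simp add: external_def)
  have comp: "component_of d v = {v}" for v by (rule component_of_no_internal) (simp add: ext)
  have pi0: "pi0 d = (\<lambda>v. {v}) ` verts g" unfolding pi0_def comp by simp
  have fd: "feynman_graph d" using feynman_graphD(1-3)[OF g(1)] unfolding feynman_graph_def by auto
  have "specified_graph T d"
    unfolding specified_graph_def
  proof (intro conjI ballI impI)
    show "feynman_graph d" by (rule fd)
    show "locally_one_PI d" unfolding locally_one_PI_iff[OF fd] by simp
    show "htype d ` halfs d \<subseteq> edge_types T" using g(3) by simp
    show "dom (spec d) = pi0 d" unfolding pi0 by (auto simp: s_def split: if_splits)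
    fix v assume "v \<in> verts d"
    then show "(vertex_legs d v, vindex d v) \<in> vertex_types T"
      using g(4)[of v] by (simp add: vertex_legs_def)
    show "spec d {v} = Some (vindex d v)" using \<open>v \<in> verts d\<close> by (simp add: s_def)
  next
    fix C assume "C \<in> pi0 d"
    then obtain v where "v \<in> verts g" "C = {v}" unfolding pi0 by blast
    then show "(residue_legs d C, the (spec d C)) \<in> vertex_types T"
      using g(4)[of v] unfolding residue_legs_def ext by (simp add: s_def vertex_legs_def)
  qed
  moreover have "specified_subgraph d g"
    unfolding specified_subgraph_def
  proof (intro conjI ballI impI)
    show "covering_subgraph d g" by (rule covering_subgraphI) simp_all
    fix C assume "C \<in> pi0 d \<inter> pi0 g" and e: "\<forall>e\<in>halfs g. bd g e \<in> C \<longrightarrow> invol d e = invol g e"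
    then obtain v where v: "v \<in> verts g" "C = {v}" unfolding pi0 by blast
    then have "{e \<in> halfs g. bd g e = v} \<subseteq> external g" using e by (auto simp: external_def)
    then show "spec d C = spec g C" using g(7)[OF v(1)] v by (simp add: s_def)
  qed
  ultimately have "d \<in> sub_specs T g" unfolding sub_specs_iff[OF S] by blast
  then have "d \<in> sub_specs T g \<and> external d = halfs d" using ext by simp
  moreover have "d' = d" if d': "d' \<in> sub_specs T g" "external d' = halfs d'" for d'
  proof -
    have S': "specified_graph T d'" and c: "specified_subgraph d' g" using d'(1) sub_specs_iff[OF S] by blast+
    note cov = covering_subgraphD[OF specified_subgraphD(1)[OF c]]
    have "invol d' e = e" for e
      using d'(2) feynman_graphD(7)[OF specified_graphD(1)[OF S']] by (cases "e \<in> halfs d'") (auto simp: external_def)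
    then have inv: "invol d' = (\<lambda>e. e)" by blast
    have pi0': "pi0 d' = (\<lambda>v. {v}) ` verts g"
      unfolding pi0_def component_of_no_internal[OF d'(2)] cov(1) by simp
    have "spec d' C = s C" for C
    proof (cases "C \<in> pi0 d'")
      case True
      then obtain v where v: "v \<in> verts g" "C = {v}" unfolding pi0' by blast
      then show ?thesis
        using specified_graphD(7)[OF S', of v] d'(2) cov by (auto simp: s_def)
    next
      case False
      then have "C \<notin> dom (spec d')" using specified_graphD(5)[OF S'] by simp
      then show ?thesis using False unfolding pi0' by (simp add: s_def domIff)
    qed
    then have "spec d' = s" by blast
    then show "d' = d" unfolding d_def using cov(7) inv by simp
  qed
  ultimately show ?thesis by (metis (no_types, lifting))
qed

text \<open>Vertices of the quotient take their index from the specification of d; the last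
  assumption says that this is the index they already had.\<close>

lemma contract_no_internal_iso:
  assumes Hd: "covering H d" and e: "external d = halfs d"
    and v: "\<And>v. v \<in> verts H \<Longrightarrow> the (spec d {v}) = vindex H v"
  shows "sgraph_iso (\<lambda>v. {v}) (\<lambda>x. x) H (contract H d)"
proof -
  interpret covering H d by (rule Hd)
  have pi0: "pi0 d = (\<lambda>v. {v}) ` verts H" unfolding pi0_def component_of_no_internal[OF e] by simp
  have "spec (contract H d) ((\<lambda>v. {v}) ` C) = spec H C" if "C \<in> pi0 H" for C
    using spec_contract[OF that] by (simp add: component_of_no_internal[OF e])
  then show ?thesis
    unfolding sgraph_iso_def using v e
    by (auto simp: bij_betw_def pi0 component_of_no_internal[OF e] inj_on_def)
qed

lemma component_classes_no_internal:
  assumes P: "D_pair T (G, g)" and d: "d \<in> sub_specs T g" and e: "external d = halfs d"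
  shows "component_classes (contract G d, contract g d) = component_classes (G, g)"
proof -
  note D = D_pair_sub_specs[OF P d]
  interpret gd: covering g d by (rule covering_D_pair[OF D(2)])
  interpret Gd: covering G d by (rule covering_D_pair[OF D(1)])
  interpret Gg: covering G g by (rule covering_D_pair[OF P])
  have S: "specified_graph T d" using D(1) unfolding D_pair_iff by blast
  have v: "the (spec d {v}) = vindex d v" if "v \<in> verts d" for v
    using specified_graphD(7)[OF S that] e by auto
  have "pair_iso (G, g) (contract G d, contract g d)"
    by (rule pair_isoI; rule contract_no_internal_iso) (use v e gd.covering_axioms Gd.covering_axioms in simp_all)
  then show ?thesis
    using component_classes_iso D_pair_graph_pair[OF P] D_pair_graph_pair[OF D(3)] by metis
qed

lemma D_counit_basis:
  assumes "graph_pair (G, d)"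
  shows "D_counit (basis (pair_class (G, d)) :: _ \<Rightarrow>\<^sub>0 'k::field) = (if external d = halfs d then 1 else 0)"
proof -
  obtain H h where R: "rep (pair_class (G, d)) = (H, h)" by fastforce
  note r = rep_pair_class[OF assms, unfolded R]
  obtain f k where I: "sgraph_iso f k d h" using r(2) by (rule pair_isoE)
  note fd = graph_pairD(2)[OF assms]
  have "external h = halfs h \<longleftrightarrow> k ` external d = k ` halfs d"
    using external_image[OF I fd] sgraph_iso_halfs[OF I] by simp
  also have "\<dots> \<longleftrightarrow> external d = halfs d"
    by (rule inj_on_image_eq_iff[OF sgraph_iso_inj[OF I]]) (auto simp: external_def)
  finally show ?thesis unfolding D_counit_def by (simp add: R)
qed

lemma coaction_counital:
  assumes T: "physical_theory T" and P: "D_pair T (G, g)"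
  shows "counit_map D_counit (D'_coaction T (basis (component_classes (G, g)))) =
    (basis (component_classes (G, g)) :: _ \<Rightarrow>\<^sub>0 'k::field)"
proof -
  have Sg: "specified_graph T g" using P unfolding D_pair_iff by blast
  have fin: "finite (sub_specs T g)" by (rule finite_sub_specs[OF T specified_graphD(1)[OF Sg]])
  obtain d0 where d0: "d0 \<in> sub_specs T g" "external d0 = halfs d0"
    and u: "\<And>d. d \<in> sub_specs T g \<Longrightarrow> external d = halfs d \<Longrightarrow> d = d0"
    using ex1_no_internal_sub_spec[OF Sg] by blast
  have "counit_map D_counit (D'_coaction T (basis (component_classes (G, g)))) =
      (\<Sum>d\<in>sub_specs T g. scale (D_counit (basis (pair_class (G, d)) :: _ \<Rightarrow>\<^sub>0 'k))
        (basis (component_classes (contract G d, contract g d))))"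
    by (simp add: D'_coaction_basis[OF T P] extends_linearly_sum) (simp add: counit_map_def)
  \<comment> \<open>The counit selects the unique subgraph without internal edges, and dividing by
    it changes the pair only by an isomorphism.\<close>
  also have "\<dots> = (\<Sum>d\<in>sub_specs T g. if d = d0 then basis (component_classes (G, g)) else 0)"
  proof (rule sum.cong[OF refl])
    fix d assume d: "d \<in> sub_specs T g"
    then have "external d = halfs d \<longleftrightarrow> d = d0" using u d0(2) by blast
    then show "scale (D_counit (basis (pair_class (G, d)) :: _ \<Rightarrow>\<^sub>0 'k))
        (basis (component_classes (contract G d, contract g d))) =
      (if d = d0 then basis (component_classes (G, g)) else 0)"
      using D_counit_basis[OF D_pair_graph_pair[OF D_pair_sub_specs(1)[OF P d]], where 'k = 'k]
        component_classes_no_internal[OF P d] by auto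
  qed
  also have "\<dots> = basis (component_classes (G, g))" using fin d0(1) by simp
  finally show ?thesis .
qed


section \<open>Compatibility with the unshuffling coproduct\<close>

text \<open>
  The left factor of the coaction is read through the multiset of connected components, so that
  both factors are polynomial algebras and multiplicativity becomes a statement about the ring
  structure of the ambient type.
\<close>

definition split_coaction ::
  "'t qft \<Rightarrow> 't pclass multiset \<Rightarrow> ('t pclass multiset \<times> 't pclass multiset \<Rightarrow>\<^sub>0 'k::field)" where
  "split_coaction T M = (case D'_rep T M of (G, g) \<Rightarrow>
     \<Sum>d\<in>sub_specs T g. basis (component_classes (G, d), component_classes (contract G d, contract g d)))"

text \<open>On basis elements this is the inverse of the passage from a class to its multiset of
  components, hence of \<open>D_to_D'\<close>.\<close>

definition D_class :: "'t qft \<Rightarrow> 't pclass multiset \<Rightarrow> 't pclass" where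
  "D_class T M = pair_class (D'_rep T M)"

lemma split_coaction_eq:
  assumes T: "physical_theory T" and P: "D_pair T (G, g)"
  shows "split_coaction T (component_classes (G, g)) =
    (\<Sum>d\<in>sub_specs T g. basis (component_classes (G, d), component_classes (contract G d, contract g d)))"
proof -
  let ?F = "\<lambda>c c'. basis (component_classes (rep c), component_classes (rep c'))"
  obtain H h where R: "D'_rep T (component_classes (G, g)) = (H, h)" by fastforce
  have H: "D_pair T (H, h)" using D'_rep(1)[OF component_classes_in_D'_basis[OF P]] R by simp
  have "split_coaction T (component_classes (G, g)) =
      (\<Sum>d\<in>sub_specs T h. ?F (pair_class (H, d)) (pair_class (contract H d, contract h d)))"
    unfolding split_coaction_def R prod.case
    by (intro sum.cong refl) (simp add: component_classes_rep_sub[OF H])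
  also have "\<dots> = (\<Sum>d\<in>sub_specs T g. ?F (pair_class (G, d)) (pair_class (contract G d, contract g d)))"
    using sum_D'_rep[OF T P, of ?F] unfolding R prod.case .
  also have "\<dots> = (\<Sum>d\<in>sub_specs T g. basis (component_classes (G, d), component_classes (contract G d, contract g d)))"
    by (intro sum.cong refl) (simp add: component_classes_rep_sub[OF P])
  finally show ?thesis .
qed

text \<open>No information is lost by reading the left factor through its components:
  \<open>D_class\<close> recovers the class.\<close>

lemma D'_coaction_eq_split_coaction:
  assumes T: "physical_theory T" and M: "M \<in> D'_basis T"
  shows "D'_coaction T (basis M) = lin (\<lambda>(A, B). basis (D_class T A, B)) (split_coaction T M)"
proof -
  from M obtain G g :: "(nat, nat, 'a) sgraph" where P: "D_pair T (G, g)" "M = component_classes (G, g)"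
    by (rule D'_basisE)
  show ?thesis
    unfolding P(2) D'_coaction_basis[OF T P(1)] split_coaction_eq[OF T P(1)] lin_sum lin_basis prod.case
    by (intro sum.cong refl) (simp add: D_class_def pair_class_D'_rep[OF D_pair_sub_specs(1)[OF P(1)]])
qed

text \<open>Subgraphs and quotients of a juxtaposition are juxtapositions, and the components of a
  juxtaposition add up. Addition of exponents is the product of basis elements in the ring.\<close>

lemma split_coaction_add:
  assumes T: "physical_theory T" and "M \<in> D'_basis T" "N \<in> D'_basis T"
  shows "split_coaction T (M + N) = split_coaction T M * split_coaction T N"
proof -
  let ?F = "\<lambda>c c'. basis (component_classes (rep c), component_classes (rep c'))"
  from assms(2) obtain G g :: "(nat, nat, 'a) sgraph" where P: "D_pair T (G, g)" "M = component_classes (G, g)"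
    by (rule D'_basisE)
  from assms(3) obtain H h :: "(nat, nat, 'a) sgraph" where Q: "D_pair T (H, h)" "N = component_classes (H, h)"
    by (rule D'_basisE)
  let ?U = "disjoint_union G H" and ?u = "disjoint_union g h"
  have U: "D_pair T (?U, ?u)" using D_pair_juxtapose[OF P(1) Q(1)] by (simp add: juxtapose_simps)
  have "M + N = component_classes (?U, ?u)"
    using component_classes_juxtapose[OF D_pair_graph_pair[OF P(1)] D_pair_graph_pair[OF Q(1)]]
    unfolding P(2) Q(2) juxtapose_simps by simp
  then have "split_coaction T (M + N) =
      (\<Sum>d\<in>sub_specs T ?u. ?F (pair_class (?U, d)) (pair_class (contract ?U d, contract ?u d)))"
    unfolding split_coaction_eq[OF T U]
    by (simp add: split_coaction_eq[OF T U] component_classes_rep_sub[OF U])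
  also have "\<dots> = (\<Sum>a\<in>sub_specs T g. \<Sum>b\<in>sub_specs T h. ?F (pair_class (juxtapose (G, a) (H, b)))
      (pair_class (juxtapose (contract G a, contract g a) (contract H b, contract h b))))"
    by (rule sum_sub_specs_juxtapose[OF P(1) Q(1)])
  also have "\<dots> = (\<Sum>a\<in>sub_specs T g. \<Sum>b\<in>sub_specs T h.
      basis (component_classes (G, a), component_classes (contract G a, contract g a)) *
      basis (component_classes (H, b), component_classes (contract H b, contract h b)))"
  proof (intro sum.cong refl)
    fix a b assume a: "a \<in> sub_specs T g" and b: "b \<in> sub_specs T h"
    note A = D_pair_graph_pair[OF D_pair_sub_specs(1)[OF P(1) a]] D_pair_graph_pair[OF D_pair_sub_specs(3)[OF P(1) a]]
    note B = D_pair_graph_pair[OF D_pair_sub_specs(1)[OF Q(1) b]] D_pair_graph_pair[OF D_pair_sub_specs(3)[OF Q(1) b]]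
    show "?F (pair_class (juxtapose (G, a) (H, b)))
      (pair_class (juxtapose (contract G a, contract g a) (contract H b, contract h b))) =
      basis (component_classes (G, a), component_classes (contract G a, contract g a)) *
      basis (component_classes (H, b), component_classes (contract H b, contract h b))"
      by (simp add: component_classes_rep graph_pair_juxtapose component_classes_juxtapose A B)
  qed
  also have "\<dots> = split_coaction T M * split_coaction T N"
    unfolding P(2) Q(2) split_coaction_eq[OF T P(1)] split_coaction_eq[OF T Q(1)] sum_product ..
  finally show ?thesis .
qed

lemma component_classes_eq_empty_iff:
  assumes "graph_pair (G, g)" shows "component_classes (G, g) = {#} \<longleftrightarrow> verts G = {}"
proof -
  note G = graph_pairD(1)[OF assms]
  have "component_classes (G, g) = {#} \<longleftrightarrow> pi0 G = {}"
    unfolding component_classes_def using finite_pi0[OF G] by (simp add: mset_set_empty_iff)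
  then show ?thesis by (simp add: pi0_def)
qed

lemma basis_zero_prod [simp]: "basis (0, 0) = 1"
  by (simp flip: zero_prod_def)

lemma basis_zero_triple: "basis (0, (0, 0)) = 1"
  by (simp flip: zero_prod_def)

lemma lin_one [simp]: "lin f 1 = f 0"
  using lin_basis[of f 0] by simp

lemma tensor_one [simp]: "tensor 1 1 = 1"
  using tensor_basis[of 0 0] by simp

text \<open>A pair without components has no vertices and hence no half-edges, so its only subgraph
  is the one without internal edges.\<close>

lemma split_coaction_empty:
  assumes T: "physical_theory T" shows "split_coaction T {#} = 1"
proof -
  have "{#} \<in> D'_basis T" by (simp add: D'_basis_def)
  then obtain G g :: "(nat, nat, 'a) sgraph" where P: "D_pair T (G, g)" "{#} = component_classes (G, g)"
    by (rule D'_basisE)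
  have Sg: "specified_graph T g" using P(1) unfolding D_pair_iff by blast
  have empty: "verts G = {}" using P component_classes_eq_empty_iff[OF D_pair_graph_pair[OF P(1)]] by simp
  have sub: "external d = halfs d" if "d \<in> sub_specs T g" for d
  proof -
    note D = D_pair_sub_specs(1)[OF P(1) that]
    interpret covering G d by (rule covering_D_pair[OF D])
    show ?thesis using feynman_graphD(3)[OF feynman] empty by (auto simp: external_def)
  qed
  obtain d where d: "sub_specs T g = {d}" using ex1_no_internal_sub_spec[OF Sg] sub by blast
  then have "d \<in> sub_specs T g" by simp
  have "component_classes (G, d) = {#}"
    using component_classes_eq_empty_iff[OF D_pair_graph_pair[OF D_pair_sub_specs(1)[OF P(1) \<open>d \<in> _\<close>]]] empty
    by blast
  moreover have "component_classes (contract G d, contract g d) = {#}"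
    using component_classes_no_internal[OF P(1) \<open>d \<in> _\<close> sub[OF \<open>d \<in> _\<close>]] P(2) by simp
  ultimately show ?thesis
    using split_coaction_eq[OF T P(1)] unfolding d P(2)[symmetric] by simp
qed

lemma unshuffle_one [simp]: "unshuffle 1 = 1"
  and unshuffle_add: "unshuffle (basis (M + N)) = unshuffle (basis M) * unshuffle (basis N)"
  and unshuffle_single: "unshuffle (basis {#x#}) = basis ({#x#}, {#}) + basis ({#}, {#x#})"
  by (simp_all add: unshuffle_def)

lemma unshuffle_add_mset:
  "unshuffle (basis (add_mset x M)) = unshuffle (basis {#x#}) * unshuffle (basis M)"
  using unshuffle_add[of "{#x#}" M] by simp

lemma D'_basis_add: "M \<in> D'_basis T \<Longrightarrow> N \<in> D'_basis T \<Longrightarrow> M + N \<in> D'_basis T"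
  and D'_basis_empty: "{#} \<in> D'_basis T"
  by (simp_all add: D'_basis_def)

lemma free_space_unshuffle:
  "M \<in> D'_basis T \<Longrightarrow>
    (unshuffle (basis M) :: _ \<Rightarrow>\<^sub>0 'k::field) \<in> free_space (D'_basis T \<times> D'_basis T)"
proof (induction M)
  case empty
  show ?case by (simp add: free_space_def zero_prod_def D'_basis_empty)
next
  case (add x M)
  have x: "{#x#} \<in> D'_basis T" and M: "M \<in> D'_basis T" using add.prems by (simp_all add: D'_basis_def)
  show ?case
    unfolding unshuffle_add_mset[of x M]
  proof (rule free_space_mult)
    show "(unshuffle (basis {#x#}) :: _ \<Rightarrow>\<^sub>0 'k) \<in> free_space (D'_basis T \<times> D'_basis T)"
      unfolding unshuffle_single using x D'_basis_empty[of T] by (intro free_space_add) simp_all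
    show "(unshuffle (basis M) :: _ \<Rightarrow>\<^sub>0 'k) \<in> free_space (D'_basis T \<times> D'_basis T)" by (rule add.IH[OF M])
  qed (auto intro: D'_basis_add)
qed

lemma linear_on_unshuffle: "linear_on (D'_basis T) (D'_basis T \<times> D'_basis T) unshuffle"
  unfolding unshuffle_def
proof (rule linear_on_lin)
  fix M assume "M \<in> D'_basis T"
  from free_space_unshuffle[OF this]
  show "(\<Prod>x\<in>#M. basis ({#x#}, {#}) + basis ({#}, {#x#})) \<in> free_space (D'_basis T \<times> D'_basis T)"
    by (simp add: unshuffle_def)
qed

text \<open>This is the comodule morphism identity with left factors multiplied in the polynomial
  ring. On the right, the two coactions are embedded with the unit in the slot of the other. Both
  sides are multiplicative in M, so induction reduces the claim to a single generator.\<close>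

lemma split_coaction_unshuffle:
  assumes T: "physical_theory T" and "M \<in> D'_basis T"
  shows "lin (\<lambda>(A, B). tensor (basis A) (unshuffle (basis B))) (split_coaction T M) =
    lin (\<lambda>(A, B). lin (\<lambda>(a, b). basis (a, (b, {#}))) (split_coaction T A) *
      lin (\<lambda>(a, b). basis (a, ({#}, b))) (split_coaction T B)) (unshuffle (basis M) :: _ \<Rightarrow>\<^sub>0 'k::field)"
    (is "lin ?l (?E M) = lin ?r _")
  using assms(2)
proof (induction M)
  case empty
  show ?case
    by (simp add: split_coaction_empty[OF T] zero_prod_def basis_zero_triple)
next
  case (add x M)
  have x: "{#x#} \<in> D'_basis T" and M: "M \<in> D'_basis T" using add.prems by (simp_all add: D'_basis_def)
  have l: "lin ?l (?E {#x#} * ?E M) = lin ?l (?E {#x#}) * lin ?l (?E M)"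
  proof (rule lin_mult)
    fix p q :: "'a pclass multiset \<times> 'a pclass multiset"
    obtain A B C D where "p = (A, B)" "q = (C, D)" by fastforce
    then show "?l (p + q) = ?l p * (?l q :: _ \<Rightarrow>\<^sub>0 'k)"
      by (simp add: unshuffle_add flip: tensor_mult)
  qed
  \<comment> \<open>Multiplicativity of the coaction is available on admissible monomials, so the
    exponents that occur in the unshuffling have to be confined to these.\<close>
  have r: "lin ?r (unshuffle (basis {#x#}) * unshuffle (basis M)) =
      lin ?r (unshuffle (basis {#x#})) * (lin ?r (unshuffle (basis M)) :: _ \<Rightarrow>\<^sub>0 'k)"
  proof (rule lin_mult)
    fix p q :: "'a pclass multiset \<times> 'a pclass multiset"
    assume "p \<in> Poly_Mapping.keys (unshuffle (basis {#x#}) :: _ \<Rightarrow>\<^sub>0 'k)"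
      "q \<in> Poly_Mapping.keys (unshuffle (basis M) :: _ \<Rightarrow>\<^sub>0 'k)"
    moreover have "Poly_Mapping.keys (unshuffle (basis N) :: _ \<Rightarrow>\<^sub>0 'k) \<subseteq> D'_basis T \<times> D'_basis T"
      if "N \<in> D'_basis T" for N
      using free_space_unshuffle[OF that, where 'k = 'k] by (simp add: free_space_def)
    ultimately have "p \<in> D'_basis T \<times> D'_basis T" "q \<in> D'_basis T \<times> D'_basis T" using x M by blast+
    then obtain A B C D where [simp]: "p = (A, B)" "q = (C, D)" and
      ABCD: "A \<in> D'_basis T" "B \<in> D'_basis T" "C \<in> D'_basis T" "D \<in> D'_basis T" by auto
    have 1: "lin (\<lambda>(a, b). basis (a, (b, {#}))) (?E A * ?E C) =
        lin (\<lambda>(a, b). basis (a, (b, {#}))) (?E A) * (lin (\<lambda>(a, b). basis (a, (b, {#}))) (?E C) :: _ \<Rightarrow>\<^sub>0 'k)"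
      by (rule lin_mult) auto
    have 2: "lin (\<lambda>(a, b). basis (a, ({#}, b))) (?E B * ?E D) =
        lin (\<lambda>(a, b). basis (a, ({#}, b))) (?E B) * (lin (\<lambda>(a, b). basis (a, ({#}, b))) (?E D) :: _ \<Rightarrow>\<^sub>0 'k)"
      by (rule lin_mult) auto
    show "?r (p + q) = ?r p * (?r q :: _ \<Rightarrow>\<^sub>0 'k)"
      by (simp add: split_coaction_add[OF T] ABCD 1 2 ac_simps)
  qed
  \<comment> \<open>Every quotient of a connected pair is connected, so the right factor of each
    term is a single generator, which is primitive. The coaction of the empty monomial is the unit,
    so both sides produce the same two terms for each subgraph.\<close>
  have "lin ?l (?E {#x#}) = lin ?r (unshuffle (basis {#x#}))"
  proof -
    obtain G g :: "(nat, nat, 'a) sgraph" where P: "F_pair T (G, g)" "x = pair_class (G, g)"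
      using x unfolding D'_basis_def F_basis_def by auto
    have D: "D_pair T (G, g)" and c: "connected_graph G" using P(1) unfolding F_pair_iff by blast+
    have cc: "{#x#} = component_classes (G, g)"
      using component_classes_connected[OF D_pair_graph_pair[OF D] c] P(2) by simp
    define y where "y d = pair_class (contract G d, contract g d)" for d
    have y: "component_classes (contract G d, contract g d) = {#y d#}" if d: "d \<in> sub_specs T g" for d
    proof -
      have "F_pair T (G, d)" using D_pair_sub_specs(1)[OF D d] c unfolding F_pair_iff by blast
      then have "connected_graph (contract G d)" unfolding F_pair_def by blast
      then show ?thesis
        unfolding y_def by (rule component_classes_connected[OF D_pair_graph_pair[OF D_pair_sub_specs(3)[OF D d]]])
    qed
    have E: "?E {#x#} = (\<Sum>d\<in>sub_specs T g. basis (component_classes (G, d), {#y d#}) :: _ \<Rightarrow>\<^sub>0 'k)"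
      unfolding cc split_coaction_eq[OF T D] by (intro sum.cong refl) (simp add: y)
    show ?thesis
      unfolding unshuffle_single lin_add
      by (simp add: E split_coaction_empty[OF T] zero_prod_def basis_zero_triple lin_sum unshuffle_single tensor_basis_left
          lin_add sum.distrib)
  qed
  then show ?case
    using l r add.IH[OF M]
    by (simp add: unshuffle_add_mset[of x M] split_coaction_add[OF T x M, simplified])
qed


section \<open>The unshuffling coproduct as a comodule morphism\<close>

text \<open>Juxtaposition adds multisets of components and these determine the class, so
  \<open>D_class\<close> expresses the product on classes through addition of exponents.\<close>

lemma D_mult_basis:
  assumes P: "D_pair T (G, g)" and Q: "D_pair T (H, h)"
  shows "D_mult (basis (pair_class (G, g))) (basis (pair_class (H, h))) =
    basis (D_class T (component_classes (G, g) + component_classes (H, h)))"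
proof -
  note p = D_pair_graph_pair[OF P] and q = D_pair_graph_pair[OF Q]
  let ?p = "rep (pair_class (G, g))" and ?q = "rep (pair_class (H, h))"
  have "D_pair T ?p" by (rule D_pair_iso[OF rep_pair_class(2)[OF p] P rep_pair_class(1)[OF p]])
  moreover have "D_pair T ?q" by (rule D_pair_iso[OF rep_pair_class(2)[OF q] Q rep_pair_class(1)[OF q]])
  ultimately have "D_pair T (juxtapose ?p ?q)" by (rule D_pair_juxtapose)
  then have "pair_class (D'_rep T (component_classes (juxtapose ?p ?q))) = pair_class (juxtapose ?p ?q)"
    using pair_class_D'_rep by (cases "juxtapose ?p ?q") auto
  moreover have "component_classes (juxtapose ?p ?q) = component_classes (G, g) + component_classes (H, h)"
    by (simp add: component_classes_juxtapose rep_pair_class p q component_classes_rep)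
  ultimately show ?thesis by (simp add: D_mult_def D_class_def)
qed

text \<open>Embedding the two coactions with a unit in the missing slot and multiplying in the ring
  exchanges the middle factors and multiplies the left ones at once; \<open>D_class\<close> then
  turns the left monomial into a class.\<close>

lemma m13_coaction:
  assumes T: "physical_theory T" and A: "A \<in> D'_basis T" and B: "B \<in> D'_basis T"
  shows "m13 D_mult (tensor (D'_coaction T (basis A)) (D'_coaction T (basis B))) =
    lin (\<lambda>(a, p). basis (D_class T a, p))
      (lin (\<lambda>(a, b). basis (a, (b, {#}))) (split_coaction T A) *
       lin (\<lambda>(a, b). basis (a, ({#}, b))) (split_coaction T B))"
proof -
  from A obtain G g :: "(nat, nat, 'a) sgraph" where P: "D_pair T (G, g)" "A = component_classes (G, g)"
    by (rule D'_basisE)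
  from B obtain H h :: "(nat, nat, 'a) sgraph" where Q: "D_pair T (H, h)" "B = component_classes (H, h)"
    by (rule D'_basisE)
  have "m13 D_mult (tensor (D'_coaction T (basis A)) (D'_coaction T (basis B))) =
    (\<Sum>a\<in>sub_specs T g. \<Sum>b\<in>sub_specs T h. m13 D_mult (basis
      ((pair_class (G, a), component_classes (contract G a, contract g a)),
       (pair_class (H, b), component_classes (contract H b, contract h b)))))"
    unfolding P(2) Q(2) D'_coaction_basis[OF T P(1)] D'_coaction_basis[OF T Q(1)] tensor_sum_left
    by (simp add: tensor_sum_right extends_linearly_sum)
  also have "\<dots> = (\<Sum>a\<in>sub_specs T g. \<Sum>b\<in>sub_specs T h.
      basis (D_class T (component_classes (G, a) + component_classes (H, b)),
        (component_classes (contract G a, contract g a), component_classes (contract H b, contract h b))))"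
  proof (intro sum.cong refl)
    fix a b assume a: "a \<in> sub_specs T g" and b: "b \<in> sub_specs T h"
    show "m13 D_mult (basis ((pair_class (G, a), component_classes (contract G a, contract g a)),
        (pair_class (H, b), component_classes (contract H b, contract h b)))) =
      basis (D_class T (component_classes (G, a) + component_classes (H, b)),
        (component_classes (contract G a, contract g a), component_classes (contract H b, contract h b)))"
      by (simp add: m13_def tau23_def tensor_map_def mult_map_def
          D_mult_basis[OF D_pair_sub_specs(1)[OF P(1) a] D_pair_sub_specs(1)[OF Q(1) b]])
  qed
  also have "\<dots> = lin (\<lambda>(a, p). basis (D_class T a, p))
      (lin (\<lambda>(a, b). basis (a, (b, {#}))) (split_coaction T A) *
       lin (\<lambda>(a, b). basis (a, ({#}, b))) (split_coaction T B))"
    unfolding P(2) Q(2) split_coaction_eq[OF T P(1)] split_coaction_eq[OF T Q(1)]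
    by (simp add: lin_sum sum_product)
  finally show ?thesis .
qed

lemma extends_linearly_apply_lin:
  assumes "extends_linearly F" shows "F (lin f x) = lin (\<lambda>a. F (f a)) x"
  using assms lin_lin unfolding extends_linearly_def by blast

lemma coaction_unshuffle:
  assumes T: "physical_theory T" and M: "M \<in> D'_basis T"
  shows "tensor_map id unshuffle (D'_coaction T (basis M)) =
    (m13 D_mult (tensor_map (D'_coaction T) (D'_coaction T) (unshuffle (basis M))) :: _ \<Rightarrow>\<^sub>0 'k::field)"
proof -
  \<comment> \<open>This reads the left monomial as a class again, undoing the passage to
    \<open>split_coaction\<close>.\<close>
  let ?J = "lin (\<lambda>(a, p). basis (D_class T a, p)) :: _ \<Rightarrow> (_ \<Rightarrow>\<^sub>0 'k)"
  let ?r = "\<lambda>(A, B). lin (\<lambda>(a, b). basis (a, (b, {#}))) (split_coaction T A) *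
      lin (\<lambda>(a, b). basis (a, ({#}, b))) (split_coaction T B) :: _ \<Rightarrow>\<^sub>0 'k"
  have "tensor_map id unshuffle (D'_coaction T (basis M)) =
      lin (\<lambda>(A, B). ?J (tensor (basis A) (unshuffle (basis B)))) (split_coaction T M)"
    unfolding D'_coaction_eq_split_coaction[OF T M] tensor_map_def lin_lin
    by (rule lin_cong) (auto simp: lin_prod_left)
  also have "\<dots> = ?J (lin (\<lambda>(A, B). tensor (basis A) (unshuffle (basis B))) (split_coaction T M))"
    unfolding lin_lin by (rule lin_cong) auto
  also have "\<dots> = ?J (lin ?r (unshuffle (basis M)))"
    by (simp only: split_coaction_unshuffle[OF T M])
  also have "\<dots> = lin (\<lambda>(A, B). m13 D_mult (tensor (D'_coaction T (basis A)) (D'_coaction T (basis B))))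
      (unshuffle (basis M))"
    unfolding lin_lin
  proof (rule lin_cong)
    fix p assume "p \<in> Poly_Mapping.keys (unshuffle (basis M) :: _ \<Rightarrow>\<^sub>0 'k)"
    then have "p \<in> D'_basis T \<times> D'_basis T"
      using free_space_unshuffle[OF M, where 'k = 'k] unfolding free_space_def by blast
    then show "?J (?r p) =
        (case p of (A, B) \<Rightarrow> m13 D_mult (tensor (D'_coaction T (basis A)) (D'_coaction T (basis B))))"
      by (auto simp: m13_coaction[OF T])
  qed
  also have "\<dots> = m13 D_mult (tensor_map (D'_coaction T) (D'_coaction T) (unshuffle (basis M)))"
    unfolding tensor_map_def extends_linearly_apply_lin[OF extends_linearly_maps(5)] by (rule lin_cong) auto
  finally show ?thesis .
qed

section \<open>The algebra isomorphism\<close>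

lemma component_classes_rep_D_class:
  assumes "M \<in> D'_basis T"
  shows "D_class T M \<in> D_basis T" "component_classes (rep (D_class T M)) = M"
  using D_basisI[OF D'_rep(1)[OF assms]] component_classes_rep[OF D_pair_graph_pair[OF D'_rep(1)[OF assms]]]
    D'_rep(2)[OF assms] by (simp_all add: D_class_def)

lemma D_class_component_classes_rep:
  assumes "c \<in> D_basis T"
  shows "component_classes (rep c) \<in> D'_basis T" "D_class T (component_classes (rep c)) = c"
proof -
  obtain G g where R: "rep c = (G, g)" by fastforce
  note c = D_basisE[OF assms, unfolded R]
  show "component_classes (rep c) \<in> D'_basis T" unfolding R by (rule component_classes_in_D'_basis[OF c(1)])
  show "D_class T (component_classes (rep c)) = c"
    unfolding R D_class_def pair_class_D'_rep[OF c(1)] by (rule c(2))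
qed

lemma bij_betw_D_to_D':
  "bij_betw (D_to_D' :: _ \<Rightarrow> (_ \<Rightarrow>\<^sub>0 'k::field)) (free_space (D_basis T)) (free_space (D'_basis T))"
proof (rule bij_betwI)
  \<comment> \<open>The inverse is the linear extension of \<open>D_class\<close>, which undoes the
    passage to components on basis elements.\<close>
  let ?g = "lin (\<lambda>M. basis (D_class T M)) :: _ \<Rightarrow> (_ \<Rightarrow>\<^sub>0 'k)"
  show "(D_to_D' :: _ \<Rightarrow> (_ \<Rightarrow>\<^sub>0 'k)) \<in> free_space (D_basis T) \<rightarrow> free_space (D'_basis T)"
    unfolding D_to_D'_def by (auto intro!: free_space_lin[of "D_basis T"] D_class_component_classes_rep)
  show "?g \<in> free_space (D'_basis T) \<rightarrow> free_space (D_basis T)"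
    by (auto intro!: free_space_lin[of "D'_basis T"] component_classes_rep_D_class)
  show "?g (D_to_D' x) = x" if "x \<in> free_space (D_basis T)" for x :: "_ \<Rightarrow>\<^sub>0 'k"
    by (rule extends_linearly_eqI[of "\<lambda>x. ?g (D_to_D' x)" "\<lambda>x. x", OF _ _ that])
      (simp_all add: extends_linearly_comp D_to_D'_def D_class_component_classes_rep)
  show "D_to_D' (?g x) = x" if "x \<in> free_space (D'_basis T)" for x :: "_ \<Rightarrow>\<^sub>0 'k"
    by (rule extends_linearly_eqI[of "\<lambda>x. D_to_D' (?g x)" "\<lambda>x. x", OF _ _ that])
      (simp_all add: extends_linearly_comp D_to_D'_def component_classes_rep_D_class)
qed

lemma lin_mult_lin:
  fixes f :: "'a \<Rightarrow> ('c::comm_monoid_add \<Rightarrow>\<^sub>0 'k::field)"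
  shows "lin f x * lin g y = lin (\<lambda>a. lin (\<lambda>b. f a * g b) y) x"
  unfolding lin_def
  by (simp add: sum_product scale_sum scale_mult_left scale_mult_right mult.commute)

lemma juxtapose_in_D_basis:
  assumes "c \<in> D_basis T" "d \<in> D_basis T"
  shows "pair_class (juxtapose (rep c) (rep d)) \<in> D_basis T"
  by (rule D_basisI[OF D_pair_juxtapose[OF D_basisE(1)[OF assms(1)] D_basisE(1)[OF assms(2)]]])

lemma free_space_D_mult:
  assumes "x \<in> free_space (D_basis T)" "y \<in> free_space (D_basis T)"
  shows "D_mult x y \<in> free_space (D_basis T)"
  unfolding D_mult_def
  by (intro free_space_lin[OF _ assms(1)] free_space_lin[OF _ assms(2)]) (simp add: juxtapose_in_D_basis)

lemma D_to_D'_mult: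
  assumes "x \<in> free_space (D_basis T)" "y \<in> free_space (D_basis T)"
  shows "D_to_D' (D_mult x y) = D_to_D' x * D_to_D' y"
  unfolding D_to_D'_def D_mult_def lin_lin lin_mult_lin
proof (intro lin_cong)
  fix c d assume "c \<in> Poly_Mapping.keys x" "d \<in> Poly_Mapping.keys y"
  then have "c \<in> D_basis T" "d \<in> D_basis T" using assms unfolding free_space_def by blast+
  note c = D_pair_graph_pair[OF D_basisE(1)[OF this(1)]] and d = D_pair_graph_pair[OF D_basisE(1)[OF this(2)]]
  show "lin (\<lambda>c. basis (component_classes (rep c))) (basis (pair_class (juxtapose (rep c) (rep d)))) =
      basis (component_classes (rep c)) * basis (component_classes (rep d))"
    by (simp add: component_classes_rep[OF graph_pair_juxtapose[OF c d]] component_classes_juxtapose[OF c d])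
qed

lemma D_to_D'_one [simp]: "D_to_D' D_one = 1"
  unfolding D_one_def by (simp add: D_to_D'_basis[OF D_pair_graph_pair[OF D_pair_empty]])

lemma free_space_D_one: "D_one \<in> free_space (D_basis T)"
  unfolding D_one_def by (simp add: D_basisI[OF D_pair_empty])

lemma free_space_one: "0 \<in> A \<Longrightarrow> 1 \<in> free_space A"
  by (simp add: free_space_def)

lemma comm_algebra_D':
  "comm_algebra (D'_basis T) (*) (1 :: _ \<Rightarrow>\<^sub>0 'k::field)"
  unfolding comm_algebra_def linear_on_def
  by (auto simp: ac_simps distrib_left scale_mult_right
      intro: free_space_mult D'_basis_add free_space_one D'_basis_empty)

text \<open>Juxtaposition is commutative and associative only up to isomorphism. Instead of
  constructing these isomorphisms, the laws are pulled back from the polynomial algebra along the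
  injective multiplicative map \<open>D_to_D'\<close>; linearity is immediate from the
  definition.\<close>

lemma comm_algebra_D:
  "comm_algebra (D_basis T) D_mult (D_one :: _ \<Rightarrow>\<^sub>0 'k::field)"
proof -
  let ?A = "free_space (D_basis T) :: (_ \<Rightarrow>\<^sub>0 'k) set"
  have inj: "x = y" if "x \<in> ?A" "y \<in> ?A" "D_to_D' x = D_to_D' y" for x y
    using that bij_betw_D_to_D'[of T, where 'k = 'k] by (auto simp: bij_betw_def dest: inj_onD)
  show ?thesis
    unfolding comm_algebra_def linear_on_def
  proof (intro conjI ballI allI)
    show "D_one \<in> ?A" by (rule free_space_D_one)
    fix x y assume x: "x \<in> ?A" and y: "y \<in> ?A"
    show "D_mult x y \<in> ?A" by (rule free_space_D_mult[OF x y])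
    show "D_mult x y = D_mult y x"
      by (rule inj) (simp_all add: free_space_D_mult x y D_to_D'_mult[OF x y] D_to_D'_mult[OF y x] mult.commute)
    fix z assume z: "z \<in> ?A"
    show "D_mult x (y + z) = D_mult x y + D_mult x z"
      unfolding D_mult_def by (simp add: lin_add lin_fun_add)
    show "D_mult (D_mult x y) z = D_mult x (D_mult y z)"
      by (rule inj) (simp_all add: free_space_D_mult x y z D_to_D'_mult[of _ T] mult.assoc)
  next
    fix x c y
    show "D_mult x (scale c y) = scale c (D_mult x y)"
      unfolding D_mult_def by (simp add: lin_scale lin_fun_scale)
  next
    fix x assume x: "x \<in> ?A"
    show "D_mult D_one x = x"
      by (rule inj) (simp_all add: free_space_D_mult free_space_D_one x D_to_D'_mult[of _ T])
  qed
qed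

lemma algebra_iso_D_to_D':
  "algebra_iso (D_basis T) D_mult D_one (D'_basis T) (*) 1 (D_to_D' :: _ \<Rightarrow> (_ \<Rightarrow>\<^sub>0 'k::field))"
proof -
  have "linear_on (D_basis T) (D'_basis T) (D_to_D' :: _ \<Rightarrow> (_ \<Rightarrow>\<^sub>0 'k))"
    unfolding D_to_D'_def by (rule linear_on_lin) (simp add: D_class_component_classes_rep)
  then show ?thesis
    unfolding algebra_iso_def using comm_algebra_D comm_algebra_D' bij_betw_D_to_D' D_to_D'_mult by auto
qed

theorem theorem9:
  fixes T :: "'t qft"
  assumes "physical_theory T"
  shows
    "comodule_coalgebra (D_basis T) D_mult (D_coproduct T) D_counit
       (D'_basis T) unshuffle
       (D'_coaction T :: ('t pclass multiset \<Rightarrow>\<^sub>0 'k::field) \<Rightarrow> ('t pclass \<times> 't pclass multiset \<Rightarrow>\<^sub>0 'k)) \<and>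
     algebra_iso (D_basis T) D_mult D_one (D'_basis T) (*) 1
       (D_to_D' :: ('t pclass \<Rightarrow>\<^sub>0 'k) \<Rightarrow> ('t pclass multiset \<Rightarrow>\<^sub>0 'k)) \<and>
     (\<forall>G g :: (nat, nat, 't) sgraph. D_pair T (G, g) \<longrightarrow>
        D'_coaction T (D_to_D' (basis (pair_class (G, g)) :: 't pclass \<Rightarrow>\<^sub>0 'k)) =
        (\<Sum>d\<in>sub_specs T g.
           tensor (basis (pair_class (G, d)))
             (D_to_D' (basis (pair_class (contract G d, contract g d))))))"
proof (intro conjI allI impI)
  let ?coa = "D'_coaction T :: (_ \<Rightarrow>\<^sub>0 'k) \<Rightarrow> _"
  note lin_coa = extends_linearly_structure_maps(1)[of T] and comp = extends_linearly_comp(1)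
  \<comment> \<open>All maps involved extend linearly, so each identity is checked on monomials, and
    every admissible monomial is the multiset of components of some pair.\<close>
  have coassoc: "assoc_map (tensor_map (D_coproduct T) id (?coa x)) = tensor_map id ?coa (?coa x)"
    if x: "x \<in> free_space (D'_basis T)" for x
  proof (rule extends_linearly_eqI[OF comp[OF extends_linearly_maps(2) comp[OF extends_linearly_maps(1) lin_coa]]
        comp[OF extends_linearly_maps(1) lin_coa] x])
    fix M assume "M \<in> D'_basis T"
    then obtain G g :: "(nat, nat, 't) sgraph" where "D_pair T (G, g)" "M = component_classes (G, g)"
      by (rule D'_basisE)
    then show "assoc_map (tensor_map (D_coproduct T) id (?coa (basis M))) = tensor_map id ?coa (?coa (basis M))"
      using coaction_coassociative[OF assms] by simp
  qed
  have counit: "counit_map D_counit (?coa x) = x" if x: "x \<in> free_space (D'_basis T)" for x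
  proof (rule extends_linearly_eqI[OF comp[OF extends_linearly_maps(6) lin_coa] extends_linearly_id(1) x])
    fix M assume "M \<in> D'_basis T"
    then obtain G g :: "(nat, nat, 't) sgraph" where "D_pair T (G, g)" "M = component_classes (G, g)"
      by (rule D'_basisE)
    then show "counit_map D_counit (?coa (basis M)) = basis M"
      using coaction_counital[OF assms] by simp
  qed
  have morphism: "tensor_map id unshuffle (?coa x) = m13 D_mult (tensor_map ?coa ?coa (unshuffle x))"
    if x: "x \<in> free_space (D'_basis T)" for x
    by (rule extends_linearly_eqI[OF comp[OF extends_linearly_maps(1) lin_coa]
          comp[OF extends_linearly_maps(5) comp[OF extends_linearly_maps(1) extends_linearly_structure_maps(3)]] x])
      (rule coaction_unshuffle[OF assms])
  show "comodule_coalgebra (D_basis T) D_mult (D_coproduct T) D_counit (D'_basis T) unshuffle ?coa"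
    unfolding comodule_coalgebra_def left_coaction_def
    using linear_on_D'_coaction[OF assms] linear_on_unshuffle coassoc counit morphism by blast
  show "algebra_iso (D_basis T) D_mult D_one (D'_basis T) (*) 1 (D_to_D' :: (_ \<Rightarrow>\<^sub>0 'k) \<Rightarrow> _)"
    by (rule algebra_iso_D_to_D')
  \<comment> \<open>The coaction is defined on monomials; read through the isomorphism, it is the
    sum over the subgraphs of the given pair itself.\<close>
  fix G g :: "(nat, nat, 't) sgraph" assume P: "D_pair T (G, g)"
  have "?coa (D_to_D' (basis (pair_class (G, g)))) =
      (\<Sum>d\<in>sub_specs T g. basis (pair_class (G, d), component_classes (contract G d, contract g d)))"
    by (simp add: D_to_D'_basis[OF D_pair_graph_pair[OF P]] D'_coaction_basis[OF assms P])
  also have "\<dots> = (\<Sum>d\<in>sub_specs T g. tensor (basis (pair_class (G, d)))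
      (D_to_D' (basis (pair_class (contract G d, contract g d)))))"
    by (intro sum.cong refl) (simp add: D_to_D'_basis[OF D_pair_graph_pair[OF D_pair_sub_specs(3)[OF P]]])
  finally show "?coa (D_to_D' (basis (pair_class (G, g)))) = \<dots>" .
qed

end
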